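(* Let $F(X,Y)$ be a given Boolean relational specification. If $Y_i\in Y$ is uniquely defined in terms of $(X,Y^{1:i-1})$ by a circuit of size $s$, then a Skolem function for $Y_i$ can be learned, with high probability, using a number of NP oracle calls polynomial in $|F|$ and $s$.
   Context: $F(X,Y)$ is a Boolean formula over input variables $X=\{X_1,\dots,X_n\}$ and output variables $Y=\{Y_1,\dots,Y_m\}$; $|F|$ is its size; $Y^{1:i-1}=\{Y_1,\dots,Y_{i-1}\}$. The learner is a randomized algorithm that is given $F$ and has access to an NP oracle; "with high probability" is over its internal randomness. For $Z\subseteq (X\cup Y)\setminus\{Y_i\}$, the variable $Y_i$ is uniquely defined in terms of $Z$ if $F(X,Y)\wedge F(\hat X,\hat Y)\wedge (Z=\hat Z)\implies Y_i=\hat Y_i$ holds, where $\hat X,\hat Y$ are fresh copies of $X,Y$ and $\hat Z$ is the corresponding copy of $Z$. It is uniquely defined in terms of $(X,Y^{1:i-1})$ by a circuit of size $s$ if there is a circuit of size $s$ computing $Y_i$ from $(X,Y^{1:i-1})$ on all satisfying assignments of $F$. Skolem functions for $F$ are Boolean functions $\Psi=\langle\psi_1,\dots,\psi_m\rangle$ such that $\exists Y\,F(X,Y)\equiv F(X,\Psi(X))$; $\psi_i$ may be written in terms of other $Y$ variables provided there are no cyclic dependencies. For $Y_i$ uniquely defined in terms of $(X,Y^{1:i-1})$, a Skolem function for $Y_i$ is a circuit $h$ on $(X,Y^{1:i-1})$ such that $h(\vec x,\vec y^{1:i-1})=\vec y_i$ for every $(\vec x,\vec y)$ with $F(\vec x,\vec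 y)=1$. *)

theory Defs
  imports "HOL-Probability.Probability" "HOL-Computational_Algebra.Polynomial"
begin

section \<open>Relational specifications\<close>

datatype var = X nat | Y nat

type_synonym assignment = "var \<Rightarrow> bool"

datatype formula =
    Const bool
  | Atom var
  | Neg formula
  | Conj formula formula
  | Disj formula formula

primrec holds :: "formula \<Rightarrow> assignment \<Rightarrow> bool" where
  "holds (Const b) a = b"
| "holds (Atom v) a = a v"
| "holds (Neg f) a = (\<not> holds f a)"
| "holds (Conj f g) a = (holds f a \<and> holds g a)"
| "holds (Disj f g) a = (holds f a \<or> holds g a)"

primrec formula_vars :: "formula \<Rightarrow> var set" where
  "formula_vars (Const b) = {}"
| "formula_vars (Atom v) = {v}"
| "formula_vars (Neg f) = formula_vars f"
| "formula_vars (Conj f g) = formula_vars f \<union> formula_vars g"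
| "formula_vars (Disj f g) = formula_vars f \<union> formula_vars g"

(* Number of nodes of the syntax tree. (The size function generated by datatype gives 0 to leaves.) *)
primrec formula_size :: "formula \<Rightarrow> nat" where
  "formula_size (Const b) = 1"
| "formula_size (Atom v) = 1"
| "formula_size (Neg f) = formula_size f + 1"
| "formula_size (Conj f g) = formula_size f + formula_size g + 1"
| "formula_size (Disj f g) = formula_size f + formula_size g + 1"

definition relational_spec :: "nat \<Rightarrow> nat \<Rightarrow> formula \<Rightarrow> bool" where
  "relational_spec n m F \<longleftrightarrow> formula_vars F \<subseteq> X ` {1..n} \<union> Y ` {1..m}"


section \<open>Boolean circuits\<close>

(* Gates are listed in topological order; Wire k is the output of the k-th gate, counted from 0. *)
datatype wire = Input var | Wire nat

datatype gate =
    Const_Gate bool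
  | Not_Gate wire
  | And_Gate wire wire
  | Or_Gate wire wire

datatype circuit = Circuit (gates: "gate list") (out_wire: wire)

primrec wire_value :: "assignment \<Rightarrow> bool list \<Rightarrow> wire \<Rightarrow> bool" where
  "wire_value a vs (Input v) = a v"
| "wire_value a vs (Wire k) = vs ! k"

primrec gate_value :: "assignment \<Rightarrow> bool list \<Rightarrow> gate \<Rightarrow> bool" where
  "gate_value a vs (Const_Gate b) = b"
| "gate_value a vs (Not_Gate u) = (\<not> wire_value a vs u)"
| "gate_value a vs (And_Gate u w) = (wire_value a vs u \<and> wire_value a vs w)"
| "gate_value a vs (Or_Gate u w) = (wire_value a vs u \<or> wire_value a vs w)"

definition gate_values :: "assignment \<Rightarrow> gate list \<Rightarrow> bool list" where
  "gate_values a gs = foldl (\<lambda>vs g. vs @ [gate_value a vs g]) [] gs"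

definition circuit_value :: "circuit \<Rightarrow> assignment \<Rightarrow> bool" where
  "circuit_value C a = wire_value a (gate_values a (gates C)) (out_wire C)"

definition circuit_size :: "circuit \<Rightarrow> nat" where
  "circuit_size C = length (gates C)"

primrec wire_ok :: "var set \<Rightarrow> nat \<Rightarrow> wire \<Rightarrow> bool" where
  "wire_ok Z k (Input v) = (v \<in> Z)"
| "wire_ok Z k (Wire j) = (j < k)"

primrec gate_ok :: "var set \<Rightarrow> nat \<Rightarrow> gate \<Rightarrow> bool" where
  "gate_ok Z k (Const_Gate b) = True"
| "gate_ok Z k (Not_Gate u) = wire_ok Z k u"
| "gate_ok Z k (And_Gate u w) = (wire_ok Z k u \<and> wire_ok Z k w)"
| "gate_ok Z k (Or_Gate u w) = (wire_ok Z k u \<and> wire_ok Z k w)"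

definition circuit_on :: "var set \<Rightarrow> circuit \<Rightarrow> bool" where
  "circuit_on Z C \<longleftrightarrow>
     (\<forall>k < length (gates C). gate_ok Z k (gates C ! k)) \<and>
     wire_ok Z (length (gates C)) (out_wire C)"


section \<open>Unique definability and Skolem functions\<close>

definition uniquely_defined :: "formula \<Rightarrow> var set \<Rightarrow> var \<Rightarrow> bool" where
  "uniquely_defined F Z v \<longleftrightarrow>
     (\<forall>a b. holds F a \<and> holds F b \<and> (\<forall>z\<in>Z. a z = b z) \<longrightarrow> a v = b v)"

definition computes_on_models :: "formula \<Rightarrow> var set \<Rightarrow> var \<Rightarrow> circuit \<Rightarrow> bool" where
  "computes_on_models F Z v C \<longleftrightarrow>
     circuit_on Z C \<and> (\<forall>a. holds F a \<longrightarrow> circuit_value C a = a v)"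

definition uniquely_defined_by_circuit :: "formula \<Rightarrow> var set \<Rightarrow> var \<Rightarrow> nat \<Rightarrow> bool" where
  "uniquely_defined_by_circuit F Z v s \<longleftrightarrow>
     uniquely_defined F Z v \<and> (\<exists>C. circuit_size C = s \<and> computes_on_models F Z v C)"

definition preceding_vars :: "nat \<Rightarrow> nat \<Rightarrow> var set" where
  "preceding_vars n i = X ` {1..n} \<union> Y ` {1..<i}"

definition skolem_function :: "nat \<Rightarrow> formula \<Rightarrow> nat \<Rightarrow> circuit \<Rightarrow> bool" where
  "skolem_function n F i h \<longleftrightarrow> computes_on_models F (preceding_vars n i) (Y i) h"

(* The conjunct uniquely_defined in uniquely_defined_by_circuit follows from the other one,
   so it is not an additional restriction. *)

lemma gate_values_cong:
  assumes "\<forall>g \<in> set gs. \<exists>k. gate_ok Z k g" and "\<forall>z\<in>Z. a z = b z"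
  shows "gate_values a gs = gate_values b gs"
proof -
  have wire: "wire_value a vs u = wire_value b vs u" if "wire_ok Z k u" for vs u k
    using that assms(2) by (cases u) auto
  have gate: "gate_value a vs g = gate_value b vs g" if "gate_ok Z k g" for vs g k
    using that by (cases g) (auto simp: wire)
  have "foldl (\<lambda>vs g. vs @ [gate_value a vs g]) ws gs
      = foldl (\<lambda>vs g. vs @ [gate_value b vs g]) ws gs" for ws
    using assms(1) by (induction gs arbitrary: ws) (auto simp: gate)
  then show ?thesis by (simp add: gate_values_def)
qed

lemma circuit_value_cong:
  assumes "circuit_on Z C" and "\<forall>z\<in>Z. a z = b z"
  shows "circuit_value C a = circuit_value C b"
proof -
  have "\<forall>g \<in> set (gates C). \<exists>k. gate_ok Z k g"
    using assms(1) by (metis circuit_on_def in_set_conv_nth)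
  then have eq: "gate_values a (gates C) = gate_values b (gates C)"
    using gate_values_cong assms(2) by blast
  then show ?thesis
    using assms by (cases "out_wire C") (auto simp: circuit_value_def circuit_on_def)
qed

lemma uniquely_defined_by_circuit_iff:
  "uniquely_defined_by_circuit F Z v s \<longleftrightarrow>
     (\<exists>C. circuit_size C = s \<and> computes_on_models F Z v C)"
proof -
  have "uniquely_defined F Z v" if C: "computes_on_models F Z v C" for C
    unfolding uniquely_defined_def
  proof (intro allI impI)
    fix a b
    assume ab: "holds F a \<and> holds F b \<and> (\<forall>z\<in>Z. a z = b z)"
    then have "circuit_value C a = circuit_value C b"
      using C circuit_value_cong unfolding computes_on_models_def by blast
    then show "a v = b v" using C ab unfolding computes_on_models_def by simp
  qed
  then show ?thesis unfolding uniquely_defined_by_circuit_def by blast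
qed


section \<open>Randomized algorithms with an oracle\<close>

text \<open>
  Algorithms are programs of a first-order functional language over binary trees, a variant of
  the languages WHILE and F that Jones uses as a model of computation polynomially equivalent to
  Turing machines, extended by a fair coin and an oracle. A program is a list of function bodies,
  each with a single parameter; variables are de Bruijn indices. The tree Tip plays the role of
  false, every other tree that of true.
\<close>

datatype btree = Tip | Fork btree btree

datatype expr =
    Var nat
  | Empty
  | Join expr expr
  | First expr
  | Second expr
  | Cond expr expr expr
  | Bind expr expr
  | Call nat expr
  | Flip
  | Query expr

lemma case_expr_mono [partial_function_mono]:
  assumes "\<And>k. monotone orda ordb (\<lambda>f. c1 k f)"
    and "monotone orda ordb (\<lambda>f. c2 f)"
    and "\<And>e1 e2. monotone orda ordb (\<lambda>f. c3 e1 e2 f)"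
    and "\<And>e1. monotone orda ordb (\<lambda>f. c4 e1 f)"
    and "\<And>e1. monotone orda ordb (\<lambda>f. c5 e1 f)"
    and "\<And>e1 e2 e3. monotone orda ordb (\<lambda>f. c6 e1 e2 e3 f)"
    and "\<And>e1 e2. monotone orda ordb (\<lambda>f. c7 e1 e2 f)"
    and "\<And>k e1. monotone orda ordb (\<lambda>f. c8 k e1 f)"
    and "monotone orda ordb (\<lambda>f. c9 f)"
    and "\<And>e1. monotone orda ordb (\<lambda>f. c10 e1 f)"
  shows "monotone orda ordb (\<lambda>f. case e of
      Var k \<Rightarrow> c1 k f
    | Empty \<Rightarrow> c2 f
    | Join e1 e2 \<Rightarrow> c3 e1 e2 f
    | First e1 \<Rightarrow> c4 e1 f
    | Second e1 \<Rightarrow> c5 e1 f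
    | Cond e1 e2 e3 \<Rightarrow> c6 e1 e2 e3 f
    | Bind e1 e2 \<Rightarrow> c7 e1 e2 f
    | Call k e1 \<Rightarrow> c8 k e1 f
    | Flip \<Rightarrow> c9 f
    | Query e1 \<Rightarrow> c10 e1 f)"
  using assms by (cases e) simp_all

type_synonym program = "expr list"

primrec first :: "btree \<Rightarrow> btree" where
  "first Tip = Tip" | "first (Fork l r) = l"

primrec second :: "btree \<Rightarrow> btree" where
  "second Tip = Tip" | "second (Fork l r) = r"

definition tree_of_bool :: "bool \<Rightarrow> btree" where
  "tree_of_bool b = (if b then Fork Tip Tip else Tip)"

text \<open>
  Evaluation yields a value, the running time, and the number of oracle calls. Each evaluation step
  takes unit time, except that building a tree is charged with the size of that tree (the size
  function generated by the datatype command counts the inner nodes). Without this charge, sharing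
  would allow exponentially large trees, and hence exponentially large oracle queries, in linear
  time. Missing probability mass is the probability of not terminating.
\<close>

partial_function (spmf) eval ::
  "program \<Rightarrow> btree set \<Rightarrow> btree list \<Rightarrow> expr \<Rightarrow> (btree \<times> nat \<times> nat) spmf" where
  "eval P \<O> env e = (case e of
     Var k \<Rightarrow> return_spmf (if k < length env then env ! k else Tip, 1, 0)
   | Empty \<Rightarrow> return_spmf (Tip, 1, 0)
   | Join e1 e2 \<Rightarrow>
       bind_spmf (eval P \<O> env e1) (\<lambda>(v1, t1, q1).
       bind_spmf (eval P \<O> env e2) (\<lambda>(v2, t2, q2).
       return_spmf (Fork v1 v2, t1 + t2 + size (Fork v1 v2), q1 + q2)))
   | First e1 \<Rightarrow>
       bind_spmf (eval P \<O> env e1) (\<lambda>(v, t, q). return_spmf (first v, t + 1, q))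
   | Second e1 \<Rightarrow>
       bind_spmf (eval P \<O> env e1) (\<lambda>(v, t, q). return_spmf (second v, t + 1, q))
   | Cond e1 e2 e3 \<Rightarrow>
       bind_spmf (eval P \<O> env e1) (\<lambda>(v1, t1, q1).
       bind_spmf (eval P \<O> env (if v1 \<noteq> Tip then e2 else e3)) (\<lambda>(v2, t2, q2).
       return_spmf (v2, t1 + t2 + 1, q1 + q2)))
   | Bind e1 e2 \<Rightarrow>
       bind_spmf (eval P \<O> env e1) (\<lambda>(v1, t1, q1).
       bind_spmf (eval P \<O> (v1 # env) e2) (\<lambda>(v2, t2, q2).
       return_spmf (v2, t1 + t2 + 1, q1 + q2)))
   | Call f e1 \<Rightarrow>
       bind_spmf (eval P \<O> env e1) (\<lambda>(v1, t1, q1).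
       bind_spmf (if f < length P then eval P \<O> [v1] (P ! f) else return_spmf (Tip, 1, 0))
         (\<lambda>(v2, t2, q2). return_spmf (v2, t1 + t2 + 1, q1 + q2)))
   | Flip \<Rightarrow> bind_spmf coin_spmf (\<lambda>b. return_spmf (tree_of_bool b, 1, 0))
   | Query e1 \<Rightarrow>
       bind_spmf (eval P \<O> env e1) (\<lambda>(v, t, q).
       return_spmf (tree_of_bool (v \<in> \<O>), t + 1, q + 1)))"

definition run :: "program \<Rightarrow> btree set \<Rightarrow> btree \<Rightarrow> (btree \<times> nat \<times> nat) spmf" where
  "run P \<O> x = eval P \<O> [x] (Call 0 (Var 0))"


section \<open>The class NP\<close>

primrec deterministic :: "expr \<Rightarrow> bool" where
  "deterministic (Var k) = True"
| "deterministic Empty = True"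
| "deterministic (Join e1 e2) = (deterministic e1 \<and> deterministic e2)"
| "deterministic (First e) = deterministic e"
| "deterministic (Second e) = deterministic e"
| "deterministic (Cond e1 e2 e3) = (deterministic e1 \<and> deterministic e2 \<and> deterministic e3)"
| "deterministic (Bind e1 e2) = (deterministic e1 \<and> deterministic e2)"
| "deterministic (Call f e) = deterministic e"
| "deterministic Flip = False"
| "deterministic (Query e) = False"

(* Deterministic programs never consult the oracle, for which the empty set is a dummy here. *)
definition polytime_decides :: "program \<Rightarrow> btree set \<Rightarrow> bool" where
  "polytime_decides V R \<longleftrightarrow>
     list_all deterministic V \<and>
     (\<exists>p :: nat poly. \<forall>x. \<exists>v t. run V {} x = return_spmf (v, t, 0) \<and>
        t \<le> poly p (size x) \<and> (v \<noteq> Tip \<longleftrightarrow> x \<in> R))"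

definition NP :: "btree set set" where
  "NP = {A. \<exists>R V. polytime_decides V R \<and>
     (\<exists>p :: nat poly. \<forall>x. x \<in> A \<longleftrightarrow> (\<exists>w. size w \<le> poly p (size x) \<and> Fork x w \<in> R))}"


section \<open>Representation of inputs and outputs as trees\<close>

primrec tree_of_nat :: "nat \<Rightarrow> btree" where
  "tree_of_nat 0 = Tip"
| "tree_of_nat (Suc k) = Fork Tip (tree_of_nat k)"

primrec tree_of_list :: "btree list \<Rightarrow> btree" where
  "tree_of_list [] = Tip"
| "tree_of_list (x # xs) = Fork x (tree_of_list xs)"

primrec tree_of_var :: "var \<Rightarrow> btree" where
  "tree_of_var (X j) = Fork (tree_of_nat 0) (tree_of_nat j)"
| "tree_of_var (Y j) = Fork (tree_of_nat 1) (tree_of_nat j)"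

primrec tree_of_formula :: "formula \<Rightarrow> btree" where
  "tree_of_formula (Const b) = Fork (tree_of_nat 0) (tree_of_bool b)"
| "tree_of_formula (Atom v) = Fork (tree_of_nat 1) (tree_of_var v)"
| "tree_of_formula (Neg f) = Fork (tree_of_nat 2) (tree_of_formula f)"
| "tree_of_formula (Conj f g) =
     Fork (tree_of_nat 3) (Fork (tree_of_formula f) (tree_of_formula g))"
| "tree_of_formula (Disj f g) =
     Fork (tree_of_nat 4) (Fork (tree_of_formula f) (tree_of_formula g))"

primrec tree_of_wire :: "wire \<Rightarrow> btree" where
  "tree_of_wire (Input v) = Fork (tree_of_nat 0) (tree_of_var v)"
| "tree_of_wire (Wire k) = Fork (tree_of_nat 1) (tree_of_nat k)"

primrec tree_of_gate :: "gate \<Rightarrow> btree" where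
  "tree_of_gate (Const_Gate b) = Fork (tree_of_nat 0) (tree_of_bool b)"
| "tree_of_gate (Not_Gate u) = Fork (tree_of_nat 1) (tree_of_wire u)"
| "tree_of_gate (And_Gate u w) =
     Fork (tree_of_nat 2) (Fork (tree_of_wire u) (tree_of_wire w))"
| "tree_of_gate (Or_Gate u w) =
     Fork (tree_of_nat 3) (Fork (tree_of_wire u) (tree_of_wire w))"

definition tree_of_circuit :: "circuit \<Rightarrow> btree" where
  "tree_of_circuit C =
     Fork (tree_of_list (map tree_of_gate (gates C))) (tree_of_wire (out_wire C))"

(* Indices are represented in unary, so the size of the input is polynomial in formula_size F, n, m. *)
definition learner_input :: "nat \<Rightarrow> nat \<Rightarrow> formula \<Rightarrow> nat \<Rightarrow> btree" where
  "learner_input n m F i =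
     tree_of_list [tree_of_nat n, tree_of_nat m, tree_of_formula F, tree_of_nat i]"

end

(* The learner tries s = 0, 1, 2, ... and searches for circuits of size s as bit strings w. Given the
   models of F seen so far, let V be the set of the strings consistent with them. For each level j it
   draws many random affine hash functions with j output bits, takes one element of V from the zero
   cell of each (found bit by bit with the NP oracle), and lets the elements vote. At the level with
   2^j about |V|, pairwise independence makes each cell contain an element of V with constant
   probability, but rarely one from a small subset of V. So if fewer than 1/32 of V err on an input,
   the majority errs on it with exponentially small probability. The oracle either certifies one of
   the majorities or supplies a counterexample for each; one of these removes a constant fraction
   of V. All hash functions are drawn beforehand, and a union bound over all possible lists of
   counterexamples shows that they are good for every run; the rest of the round is deterministic. *)

theory Submission
  imports Defs
begin

section \<open>Polynomial-time functions on encodable types\<close>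

text \<open>The obstacle is adaptivity: the examples of later rounds depend on the hash functions,
  so a bound for one fixed list of examples says nothing about the list that arises. With all bits
  drawn first, the possible lists form a fixed finite set. Its size depends on the number of rounds,
  the number of levels and the length of an example, but not on the number of trials; the trials can
  therefore be chosen afterwards, large enough for the union bound, without circularity. The learner
  does not know the size of V, so it tries every level. Wrong levels are harmless because only
  certified majorities are output; for the same reason a stage whose s is too small yields a correct
  circuit or nothing at all. Since everything but the drawing of bits is deterministic, the program
  is linked from polynomial-time functions on HOL types, and probabilistic semantics appears only in
  the outer loop.\<close>

class encodable =
  fixes enc :: "'a \<Rightarrow> btree"

abbreviation esize :: "'a::encodable \<Rightarrow> nat" where
  "esize x \<equiv> size (enc x)"

instantiation btree :: encodable begin
definition enc_btree :: "btree \<Rightarrow> btree" where [simp]: "enc_btree x = x"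
instance ..
end

instantiation unit :: encodable begin
definition enc_unit :: "unit \<Rightarrow> btree" where [simp]: "enc_unit x = Tip"
instance ..
end

instantiation bool :: encodable begin
definition enc_bool :: "bool \<Rightarrow> btree" where "enc_bool = tree_of_bool"
instance ..
end

instantiation nat :: encodable begin
definition enc_nat :: "nat \<Rightarrow> btree" where "enc_nat = tree_of_nat"
instance ..
end

instantiation prod :: (encodable, encodable) encodable begin
definition enc_prod :: "'a \<times> 'b \<Rightarrow> btree" where "enc_prod z = Fork (enc (fst z)) (enc (snd z))"
instance ..
end

instantiation list :: (encodable) encodable begin
definition enc_list :: "'a list \<Rightarrow> btree" where "enc_list xs = tree_of_list (map enc xs)"
instance ..
end

instantiation var :: encodable begin
definition enc_var :: "var \<Rightarrow> btree" where "enc_var = tree_of_var"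
instance ..
end

instantiation formula :: encodable begin
definition enc_formula :: "formula \<Rightarrow> btree" where "enc_formula = tree_of_formula"
instance ..
end

instantiation wire :: encodable begin
definition enc_wire :: "wire \<Rightarrow> btree" where "enc_wire = tree_of_wire"
instance ..
end

instantiation gate :: encodable begin
definition enc_gate :: "gate \<Rightarrow> btree" where "enc_gate = tree_of_gate"
instance ..
end

instantiation circuit :: encodable begin
definition enc_circuit :: "circuit \<Rightarrow> btree" where "enc_circuit = tree_of_circuit"
instance ..
end

lemma enc_simps [simp]:
  "enc True = Fork Tip Tip" "enc False = Tip"
  "enc (0::nat) = Tip" "enc (Suc k) = Fork Tip (enc k)"
  "enc (x, y) = Fork (enc x) (enc y)"
  "enc [] = Tip" "enc (a # as) = Fork (enc a) (enc as)"
  by (simp_all add: enc_bool_def enc_nat_def enc_prod_def enc_list_def tree_of_bool_def)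

lemma enc_bool_eq_Tip [simp]: "enc b = Tip \<longleftrightarrow> \<not> b"
  by (cases b) auto

lemma enc_list_eq_Tip [simp]: "enc xs = Tip \<longleftrightarrow> xs = []"
  by (cases xs) auto

lemma enc_nat_eq_Tip [simp]: "enc n = Tip \<longleftrightarrow> n = (0::nat)"
  by (cases n) auto

lemma enc_replicate_unit: "enc (replicate n ()) = enc n"
  by (induction n) auto

lemma esize_nat [simp]: "esize (n::nat) = n"
  by (induction n) auto

lemma esize_bool: "esize (b::bool) \<le> 1"
  by (cases b) auto

lemma esize_append: "esize (xs @ ys) = esize xs + esize ys"
  by (induction xs) auto

lemma esize_prod: "esize z = Suc (esize (fst z) + esize (snd z))"
  by (cases z) auto

lemma esize_mem: "a \<in> set xs \<Longrightarrow> esize a < esize xs"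
  by (induction xs) (auto simp: less_Suc_eq_le trans_le_add1)

lemma length_le_esize: "length xs \<le> esize xs"
  by (induction xs) auto

lemma esize_list_le:
  assumes "\<And>a. a \<in> set xs \<Longrightarrow> esize a \<le> W"
  shows "esize xs \<le> length xs * (W + 1)"
  using assms by (induction xs) (fastforce simp: algebra_simps)+

subsection \<open>Polynomial bounds\<close>

text \<open>Natural coefficients make polynomials monotone, which is what allows a size bound to be
  substituted into a time bound.\<close>

lemma poly_mono_nat: "x \<le> y \<Longrightarrow> poly p x \<le> poly p y" for p :: "nat poly"
  by (induction p) (auto intro: add_mono mult_mono)

definition pbounded :: "('a::encodable \<Rightarrow> nat) \<Rightarrow> bool" where
  "pbounded g \<longleftrightarrow> (\<exists>p :: nat poly. \<forall>x. g x \<le> poly p (esize x))"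

lemma pbounded_le: "pbounded g \<Longrightarrow> (\<And>x. f x \<le> g x) \<Longrightarrow> pbounded f"
  unfolding pbounded_def by (meson le_trans)

lemma pbounded_const: "pbounded (\<lambda>x. c)"
  unfolding pbounded_def by (rule exI[of _ "[:c:]"]) auto

lemma pbounded_esize_id: "pbounded (\<lambda>x. esize x)"
  unfolding pbounded_def by (rule exI[of _ "[:0, 1:]"]) auto

lemma pbounded_add: "pbounded f \<Longrightarrow> pbounded g \<Longrightarrow> pbounded (\<lambda>x. f x + g x)"
  unfolding pbounded_def
proof (elim exE)
  fix p q :: "nat poly" assume "\<forall>x. f x \<le> poly p (esize x)" "\<forall>x. g x \<le> poly q (esize x)"
  then show "\<exists>p. \<forall>x. f x + g x \<le> poly p (esize x)"
    by (intro exI[of _ "p + q"]) (auto intro: add_mono)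
qed

lemma pbounded_mult: "pbounded f \<Longrightarrow> pbounded g \<Longrightarrow> pbounded (\<lambda>x. f x * g x)"
  unfolding pbounded_def
proof (elim exE)
  fix p q :: "nat poly" assume "\<forall>x. f x \<le> poly p (esize x)" "\<forall>x. g x \<le> poly q (esize x)"
  then show "\<exists>p. \<forall>x. f x * g x \<le> poly p (esize x)"
    by (intro exI[of _ "p * q"]) (auto intro: mult_mono)
qed

lemma pbounded_Suc: "pbounded f \<Longrightarrow> pbounded (\<lambda>x. Suc (f x))"
  using pbounded_add[OF pbounded_const[of 1], of f] by simp

lemma pbounded_poly: "pbounded f \<Longrightarrow> pbounded (\<lambda>x. poly p (f x))"
  unfolding pbounded_def
proof (elim exE)
  fix q :: "nat poly" assume "\<forall>x. f x \<le> poly q (esize x)"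
  then show "\<exists>r. \<forall>x. poly p (f x) \<le> poly r (esize x)"
    by (intro exI[of _ "pcompose p q"]) (auto simp: poly_pcompose intro: poly_mono_nat)
qed

lemmas pbounded_intros = pbounded_const pbounded_esize_id pbounded_add pbounded_mult
  pbounded_Suc pbounded_poly

subsection \<open>Deterministic evaluation\<close>

text \<open>Big-step semantics of the runs that flip no coin. A derivation is finite, so it yields
  termination, value and cost together, without fixed-point reasoning about \<open>eval\<close>.
  Out-of-range variables and functions have no rule.\<close>

inductive evals ::
  "program \<Rightarrow> btree set \<Rightarrow> btree list \<Rightarrow> expr \<Rightarrow> btree \<Rightarrow> nat \<Rightarrow> nat \<Rightarrow> bool" for P A where
  evals_Var: "k < length env \<Longrightarrow> evals P A env (Var k) (env ! k) 1 0"
| evals_Empty: "evals P A env Empty Tip 1 0"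
| evals_Join: "evals P A env e1 v1 t1 q1 \<Longrightarrow> evals P A env e2 v2 t2 q2 \<Longrightarrow>
    evals P A env (Join e1 e2) (Fork v1 v2) (t1 + t2 + size (Fork v1 v2)) (q1 + q2)"
| evals_First: "evals P A env e v t q \<Longrightarrow> evals P A env (First e) (first v) (t + 1) q"
| evals_Second: "evals P A env e v t q \<Longrightarrow> evals P A env (Second e) (second v) (t + 1) q"
| evals_Cond: "evals P A env e1 v1 t1 q1 \<Longrightarrow>
    evals P A env (if v1 \<noteq> Tip then e2 else e3) v2 t2 q2 \<Longrightarrow>
    evals P A env (Cond e1 e2 e3) v2 (t1 + t2 + 1) (q1 + q2)"
| evals_Bind: "evals P A env e1 v1 t1 q1 \<Longrightarrow> evals P A (v1 # env) e2 v2 t2 q2 \<Longrightarrow>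
    evals P A env (Bind e1 e2) v2 (t1 + t2 + 1) (q1 + q2)"
| evals_Call: "evals P A env e v1 t1 q1 \<Longrightarrow> f < length P \<Longrightarrow>
    evals P A [v1] (P ! f) v2 t2 q2 \<Longrightarrow>
    evals P A env (Call f e) v2 (t1 + t2 + 1) (q1 + q2)"
| evals_Query: "evals P A env e v t q \<Longrightarrow>
    evals P A env (Query e) (tree_of_bool (v \<in> A)) (t + 1) (q + 1)"

lemma eval_simps:
  "eval P A env (Var k) = return_spmf (if k < length env then env ! k else Tip, 1, 0)"
  "eval P A env Empty = return_spmf (Tip, 1, 0)"
  "eval P A env (Join e1 e2) =
     bind_spmf (eval P A env e1) (\<lambda>(v1, t1, q1).
     bind_spmf (eval P A env e2) (\<lambda>(v2, t2, q2).
     return_spmf (Fork v1 v2, t1 + t2 + size (Fork v1 v2), q1 + q2)))"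
  "eval P A env (First e) =
     bind_spmf (eval P A env e) (\<lambda>(v, t, q). return_spmf (first v, t + 1, q))"
  "eval P A env (Second e) =
     bind_spmf (eval P A env e) (\<lambda>(v, t, q). return_spmf (second v, t + 1, q))"
  "eval P A env (Cond e1 e2 e3) =
     bind_spmf (eval P A env e1) (\<lambda>(v1, t1, q1).
     bind_spmf (eval P A env (if v1 \<noteq> Tip then e2 else e3)) (\<lambda>(v2, t2, q2).
     return_spmf (v2, t1 + t2 + 1, q1 + q2)))"
  "eval P A env (Bind e1 e2) =
     bind_spmf (eval P A env e1) (\<lambda>(v1, t1, q1).
     bind_spmf (eval P A (v1 # env) e2) (\<lambda>(v2, t2, q2).
     return_spmf (v2, t1 + t2 + 1, q1 + q2)))"
  "eval P A env (Call f e) =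
     bind_spmf (eval P A env e) (\<lambda>(v1, t1, q1).
     bind_spmf (if f < length P then eval P A [v1] (P ! f) else return_spmf (Tip, 1, 0))
       (\<lambda>(v2, t2, q2). return_spmf (v2, t1 + t2 + 1, q1 + q2)))"
  "eval P A env Flip = bind_spmf coin_spmf (\<lambda>b. return_spmf (tree_of_bool b, 1, 0))"
  "eval P A env (Query e) =
     bind_spmf (eval P A env e) (\<lambda>(v, t, q). return_spmf (tree_of_bool (v \<in> A), t + 1, q + 1))"
  by (subst eval.simps, simp)+

lemma eval_evals: "evals P A env e v t q \<Longrightarrow> eval P A env e = return_spmf (v, t, q)"
  by (induction rule: evals.induct) (simp_all add: eval_simps)

text \<open>Each query is charged one unit of time, so the bounds on oracle calls are later read off
  from time bounds.\<close>

lemma evals_queries_le: "evals P A env e v t q \<Longrightarrow> q \<le> t"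
  by (induction rule: evals.induct) auto

lemma evals_deterministic:
  "evals P A env e v t q \<Longrightarrow> list_all deterministic P \<Longrightarrow> deterministic e \<Longrightarrow> q = 0"
  by (induction rule: evals.induct) (auto simp: list_all_length split: if_splits)

text \<open>Building a tree costs its size, so a result exceeds the available trees by at most the
  running time.\<close>

lemma evals_size:
  "evals P A env e v t q \<Longrightarrow> \<forall>u\<in>set env. size u \<le> M \<Longrightarrow> size v \<le> M + t"
proof (induction arbitrary: M rule: evals.induct)
  case (evals_First env e v t q)
  then have "size v \<le> M + t" by blast
  then show ?case by (cases v) auto
next
  case (evals_Second env e v t q)
  then have "size v \<le> M + t" by blast
  then show ?case by (cases v) auto
next
  case (evals_Bind env e1 v1 t1 q1 e2 v2 t2 q2)
  then have "size v1 \<le> M + t1" by blast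
  with evals_Bind.prems have "\<forall>u\<in>set (v1 # env). size u \<le> M + t1"
    by (auto intro: trans_le_add1)
  from evals_Bind.IH(2)[OF this] show ?case by simp
next
  case (evals_Call env e v1 t1 q1 f v2 t2 q2)
  then have "size v1 \<le> M + t1" by blast
  then have "\<forall>u\<in>set [v1]. size u \<le> M + t1" by simp
  from evals_Call.IH(2)[OF this] show ?case by simp
next
  case (evals_Cond env e1 v1 t1 q1 e2 e3 v2 t2 q2)
  then have "size v2 \<le> M + t2" by blast
  then show ?case by simp
next
  case (evals_Var k env)
  then show ?case using nth_mem trans_le_add1 by blast
qed (auto simp: tree_of_bool_def trans_le_add1)

text \<open>Functions are addressed by their position in the program; placing a program behind
  others therefore means relocating its calls.\<close>

primrec shift_calls :: "nat \<Rightarrow> expr \<Rightarrow> expr" where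
  "shift_calls k (Var i) = Var i"
| "shift_calls k Empty = Empty"
| "shift_calls k (Join e1 e2) = Join (shift_calls k e1) (shift_calls k e2)"
| "shift_calls k (First e) = First (shift_calls k e)"
| "shift_calls k (Second e) = Second (shift_calls k e)"
| "shift_calls k (Cond e1 e2 e3) = Cond (shift_calls k e1) (shift_calls k e2) (shift_calls k e3)"
| "shift_calls k (Bind e1 e2) = Bind (shift_calls k e1) (shift_calls k e2)"
| "shift_calls k (Call f e) = Call (k + f) (shift_calls k e)"
| "shift_calls k Flip = Flip"
| "shift_calls k (Query e) = Query (shift_calls k e)"

lemma deterministic_shift_calls [simp]: "deterministic (shift_calls k e) = deterministic e"
  by (induction e) auto

lemma evals_relocate:
  "evals P A env e v t q \<Longrightarrow>
   evals (P0 @ map (shift_calls (length P0)) P @ P1) A env (shift_calls (length P0) e) v t q"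
proof (induction rule: evals.induct)
  case (evals_Cond env e1 v1 t1 q1 e2 e3 v2 t2 q2)
  have "evals (P0 @ map (shift_calls (length P0)) P @ P1) A env (if v1 \<noteq> Tip
      then shift_calls (length P0) e2 else shift_calls (length P0) e3) v2 t2 q2"
    using evals_Cond.IH(2) by (simp split: if_splits)
  from evals.evals_Cond[OF evals_Cond.IH(1) this] show ?case by simp
next
  case (evals_Call env e v1 t1 q1 f v2 t2 q2)
  have "evals (P0 @ map (shift_calls (length P0)) P @ P1) A [v1]
      ((P0 @ map (shift_calls (length P0)) P @ P1) ! (length P0 + f)) v2 t2 q2"
    using evals_Call.IH(2) evals_Call.hyps by (simp add: nth_append)
  from evals.evals_Call[OF evals_Call.IH(1) _ this] show ?case using evals_Call.hyps by simp
next
  case (evals_Query env e v t q)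
  from evals.evals_Query[OF evals_Query.IH] show ?case by simp
next
  case (evals_Bind env e1 v1 t1 q1 e2 v2 t2 q2)
  from evals.evals_Bind[OF evals_Bind.IH] show ?case by simp
next
  case (evals_First env e v t q)
  from evals.evals_First[OF evals_First.IH] show ?case by simp
next
  case (evals_Second env e v t q)
  from evals.evals_Second[OF evals_Second.IH] show ?case by simp
next
  case (evals_Join env e1 v1 t1 q1 e2 v2 t2 q2)
  from evals.evals_Join[OF evals_Join.IH] show ?case by simp
next
  case (evals_Var k env)
  from evals.evals_Var[OF this] show ?case by simp
next
  case (evals_Empty env)
  show ?case using evals.evals_Empty by simp
qed

lemma shift_calls_0 [simp]: "shift_calls 0 e = e"
  by (induction e) auto

lemma evals_append: "evals P A env e v t q \<Longrightarrow> evals (P @ P1) A env e v t q"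
proof -
  have "map (shift_calls 0) P = P" by (induction P) auto
  then show "evals P A env e v t q \<Longrightarrow> evals (P @ P1) A env e v t q"
    using evals_relocate[of P A env e v t q "[]" P1] by simp
qed

subsection \<open>Linking programs\<close>

definition implements :: "program \<Rightarrow> btree set \<Rightarrow> nat \<Rightarrow> nat poly \<Rightarrow> ('a::encodable \<Rightarrow> 'b::encodable) \<Rightarrow> bool"
  where "implements P A k p f \<longleftrightarrow> k < length P \<and>
    (\<forall>x. \<exists>t q. evals P A [enc x] (P ! k) (enc (f x)) t q \<and> t \<le> poly p (esize x))"

text \<open>The flag \<open>d\<close> asks for a program without coins and queries, as required for verifiers.\<close>

definition ptime :: "bool \<Rightarrow> btree set \<Rightarrow> ('a::encodable \<Rightarrow> 'b::encodable) \<Rightarrow> bool" where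
  "ptime d A f \<longleftrightarrow> (\<exists>P k p. (d \<longrightarrow> list_all deterministic P) \<and> implements P A k p f)"

lemma implements_append: "implements P A k p f \<Longrightarrow> implements (P @ P1) A k p f"
  unfolding implements_def by (auto simp: nth_append intro: evals_append) (meson evals_append)

text \<open>Programs are extended only at the end, so indices and time bounds of functions linked
  earlier stay valid. This is how one program comes to contain several given functions.\<close>

lemma ptime_link:
  assumes "ptime d A f" and "d \<longrightarrow> list_all deterministic P0"
  shows "\<exists>P1 k p. (d \<longrightarrow> list_all deterministic (P0 @ P1)) \<and> implements (P0 @ P1) A k p f"
proof -
  obtain P k p where P: "d \<longrightarrow> list_all deterministic P" "implements P A k p f"
    using assms(1) unfolding ptime_def by blast
  let ?Q = "map (shift_calls (length P0)) P"
  have "implements (P0 @ ?Q) A (length P0 + k) p f"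
    unfolding implements_def
  proof (intro conjI allI)
    show "length P0 + k < length (P0 @ ?Q)" using P(2) by (simp add: implements_def)
    fix x
    obtain t q where tq: "evals P A [enc x] (P ! k) (enc (f x)) t q" "t \<le> poly p (esize x)"
      using P(2) unfolding implements_def by blast
    have "(P0 @ ?Q) ! (length P0 + k) = shift_calls (length P0) (P ! k)"
      using P(2) by (simp add: implements_def nth_append)
    then show "\<exists>t q. evals (P0 @ ?Q) A [enc x] ((P0 @ ?Q) ! (length P0 + k)) (enc (f x)) t q \<and>
        t \<le> poly p (esize x)"
      using evals_relocate[OF tq(1), of P0 "[]"] tq(2) by (intro exI[of _ t] exI[of _ q]) simp
  qed
  moreover have "d \<longrightarrow> list_all deterministic (P0 @ ?Q)"
    using P(1) assms(2) by (auto simp: list_all_iff)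
  ultimately show ?thesis by blast
qed

lemma implements_call:
  assumes "implements P A k p f" and "evals P A env e (enc x) t0 q0"
  shows "\<exists>t q. evals P A env (Call k e) (enc (f x)) t q \<and> t \<le> t0 + poly p (esize x) + 1"
proof -
  obtain t q where tq: "evals P A [enc x] (P ! k) (enc (f x)) t q" "t \<le> poly p (esize x)"
    using assms(1) unfolding implements_def by blast
  have "evals P A env (Call k e) (enc (f x)) (t0 + t + 1) (q0 + q)"
    using assms tq unfolding implements_def by (blast intro: evals_Call)
  then show ?thesis using tq(2) by (intro exI conjI) auto
qed

text \<open>A new function body may call itself, as function \<open>length P\<close>.\<close>

lemma ptime_body:
  assumes "d \<longrightarrow> list_all deterministic P" and "d \<longrightarrow> deterministic e"
    and "pbounded T"
    and "\<And>x. \<exists>t q. evals (P @ [e]) A [enc x] e (enc (f x)) t q \<and> t \<le> T x"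
  shows "ptime d A f"
proof -
  obtain p where p: "\<forall>x. T x \<le> poly p (esize x)" using assms(3) unfolding pbounded_def by blast
  have "implements (P @ [e]) A (length P) p f"
    unfolding implements_def using assms(4) p by simp (meson order_trans)
  then show ?thesis unfolding ptime_def using assms(1,2)
    by (intro exI[of _ "P @ [e]"] exI[of _ "length P"] exI[of _ p]) auto
qed

text \<open>Makes composition possible: the second function is timed on an input that is itself of
  polynomial size.\<close>

lemma ptime_esize: assumes "ptime d A f" shows "pbounded (\<lambda>x. esize (f x))"
proof -
  obtain P k p where P: "implements P A k p f" using assms unfolding ptime_def by blast
  have "esize (f x) \<le> esize x + poly p (esize x)" for x
  proof -
    obtain t q where "evals P A [enc x] (P ! k) (enc (f x)) t q" "t \<le> poly p (esize x)"
      using P unfolding implements_def by blast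
    with evals_size[of P A "[enc x]" "P ! k" "enc (f x)" t q "esize x"] show ?thesis by simp
  qed
  then show ?thesis by (rule pbounded_le[rotated]) (intro pbounded_intros)
qed

subsection \<open>Closure properties\<close>

text \<open>Codes of different types may coincide: \<open>x # xs\<close> has the tree of the pair
  \<open>(x, xs)\<close>, a number that of a list of units. Moving between such types is
  free.\<close>

lemma ptime_recode:
  assumes "ptime d A g" and "\<And>x. enc (f x) = enc (g x)"
  shows "ptime d A f"
  using assms unfolding ptime_def implements_def by simp

lemma ptime_constant_time:
  assumes "d \<longrightarrow> deterministic e" and "\<And>x. evals [e] A [enc x] e (enc (f x)) t q"
  shows "ptime d A f"
  by (rule ptime_body[where P = "[]" and e = e and T = "\<lambda>_. t"])
    (use assms in \<open>auto intro: pbounded_const\<close>)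

lemma evals_Var0: "evals P A [v] (Var 0) v 1 0"
  using evals_Var[of 0 "[v]" P A] by simp

lemma evals_First0: "evals P A [v] (First (Var 0)) (first v) 2 0"
  using evals_First[OF evals_Var0] by (simp add: numeral_2_eq_2)

lemma evals_Second0: "evals P A [v] (Second (Var 0)) (second v) 2 0"
  using evals_Second[OF evals_Var0] by (simp add: numeral_2_eq_2)

lemma ptime_id: "ptime d A (\<lambda>x. x)"
  by (rule ptime_constant_time) (auto intro: evals_Var0)

lemma ptime_const: "ptime d A (\<lambda>x. c)"
proof -
  have "\<exists>e t. deterministic e \<and> (\<forall>P A env. evals P A env e v t 0)" for v
  proof (induction v)
    case Tip
    then show ?case by (intro exI[of _ Empty] exI) (auto intro: evals_Empty)
  next
    case (Fork v1 v2)
    then obtain e1 t1 e2 t2 where "deterministic e1 \<and> (\<forall>P A env. evals P A env e1 v1 t1 0)"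
      "deterministic e2 \<and> (\<forall>P A env. evals P A env e2 v2 t2 0)" by blast
    then show ?case using evals_Join[of _ _ _ e1 v1 t1 0 e2 v2 t2 0]
      by (intro exI[of _ "Join e1 e2"] exI[of _ "t1 + t2 + size (Fork v1 v2)"]) simp
  qed
  then obtain e t where "deterministic e" "\<And>P A env. evals P A env e (enc c) t 0" by metis
  then show ?thesis
    by (intro ptime_constant_time) auto
qed

lemma ptime_comp:
  fixes f :: "'a::encodable \<Rightarrow> 'b::encodable" and g :: "'b \<Rightarrow> 'c::encodable"
  assumes g: "ptime d A g" and f: "ptime d A f"
  shows "ptime d A (\<lambda>x. g (f x))"
proof -
  obtain P1 k1 p1 where 1: "d \<longrightarrow> list_all deterministic P1" "implements P1 A k1 p1 f"
    using f unfolding ptime_def by blast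
  obtain P2 k2 p2 where 2: "d \<longrightarrow> list_all deterministic (P1 @ P2)" "implements (P1 @ P2) A k2 p2 g"
    using ptime_link[OF g 1(1)] by blast
  let ?e = "Call k2 (Call k1 (Var 0))"
  let ?Q = "(P1 @ P2) @ [?e]"
  have i1: "implements ?Q A k1 p1 f" using implements_append[OF 1(2), of "P2 @ [?e]"] by simp
  have i2: "implements ?Q A k2 p2 g" by (rule implements_append[OF 2(2)])
  show ?thesis
  proof (rule ptime_body[where P = "P1 @ P2" and e = ?e and T = "\<lambda>x. poly p1 (esize x) + poly p2 (esize (f x)) + 3"])
    show "pbounded (\<lambda>x. poly p1 (esize x) + poly p2 (esize (f x)) + 3)"
      by (intro pbounded_intros ptime_esize[OF f])
    fix x :: 'a
    have "evals ?Q A [enc x] (Var 0) (enc x) 1 0" by (rule evals_Var0)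
    from implements_call[OF i1 this] obtain t q where
      tq: "evals ?Q A [enc x] (Call k1 (Var 0)) (enc (f x)) t q" "t \<le> 1 + poly p1 (esize x) + 1" by blast
    from implements_call[OF i2 tq(1)] tq(2)
    show "\<exists>t q. evals ?Q A [enc x] ?e (enc (g (f x))) t q \<and> t \<le> poly p1 (esize x) + poly p2 (esize (f x)) + 3"
      by fastforce
  qed (use 2 in auto)
qed

lemma ptime_pair:
  fixes f :: "'a::encodable \<Rightarrow> 'b::encodable" and g :: "'a \<Rightarrow> 'c::encodable"
  assumes f: "ptime d A f" and g: "ptime d A g"
  shows "ptime d A (\<lambda>x. (f x, g x))"
proof -
  obtain P1 k1 p1 where 1: "d \<longrightarrow> list_all deterministic P1" "implements P1 A k1 p1 f"
    using f unfolding ptime_def by blast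
  obtain P2 k2 p2 where 2: "d \<longrightarrow> list_all deterministic (P1 @ P2)" "implements (P1 @ P2) A k2 p2 g"
    using ptime_link[OF g 1(1)] by blast
  let ?e = "Join (Call k1 (Var 0)) (Call k2 (Var 0))"
  let ?Q = "(P1 @ P2) @ [?e]"
  have i1: "implements ?Q A k1 p1 f" using implements_append[OF 1(2), of "P2 @ [?e]"] by simp
  have i2: "implements ?Q A k2 p2 g" by (rule implements_append[OF 2(2)])
  let ?T = "\<lambda>x. poly p1 (esize x) + poly p2 (esize x) + (esize (f x) + esize (g x)) + 5"
  show ?thesis
  proof (rule ptime_body[where P = "P1 @ P2" and e = ?e and T = ?T])
    show "pbounded ?T" by (intro pbounded_intros ptime_esize[OF f] ptime_esize[OF g])
    fix x :: 'a
    have v: "evals ?Q A [enc x] (Var 0) (enc x) 1 0" by (rule evals_Var0)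
    from implements_call[OF i1 v] implements_call[OF i2 v] obtain t q t' q' where
      "evals ?Q A [enc x] (Call k1 (Var 0)) (enc (f x)) t q" "t \<le> 1 + poly p1 (esize x) + 1"
      "evals ?Q A [enc x] (Call k2 (Var 0)) (enc (g x)) t' q'" "t' \<le> 1 + poly p2 (esize x) + 1" by blast
    then show "\<exists>t q. evals ?Q A [enc x] ?e (enc (f x, g x)) t q \<and> t \<le> ?T x"
      using evals_Join[of ?Q A "[enc x]" "Call k1 (Var 0)" "enc (f x)" t q "Call k2 (Var 0)" "enc (g x)" t' q']
      by (intro exI[of _ "t + t' + size (Fork (enc (f x)) (enc (g x)))"] exI[of _ "q + q'"]) simp
  qed (use 2 in auto)
qed

lemma ptime_first: "ptime d A f \<Longrightarrow> ptime d A (\<lambda>x. first (enc (f x)))"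
proof (rule ptime_comp[where g = "\<lambda>x. first (enc x)"])
  show "ptime d A (\<lambda>x. first (enc x))"
    by (rule ptime_constant_time[where e = "First (Var 0)"])
      (simp, unfold enc_btree_def, rule evals_First[OF evals_Var0])
qed

lemma ptime_second: "ptime d A f \<Longrightarrow> ptime d A (\<lambda>x. second (enc (f x)))"
proof (rule ptime_comp[where g = "\<lambda>x. second (enc x)"])
  show "ptime d A (\<lambda>x. second (enc x))"
    by (rule ptime_constant_time[where e = "Second (Var 0)"])
      (simp, unfold enc_btree_def, rule evals_Second[OF evals_Var0])
qed

lemma ptime_fst: "ptime d A f \<Longrightarrow> ptime d A (\<lambda>x. fst (f x))"
  by (rule ptime_recode[OF ptime_first]) (auto simp: enc_prod_def)

lemma ptime_snd: "ptime d A f \<Longrightarrow> ptime d A (\<lambda>x. snd (f x))"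
  by (rule ptime_recode[OF ptime_second]) (auto simp: enc_prod_def)

lemma ptime_if:
  fixes f :: "'a::encodable \<Rightarrow> 'b::encodable"
  assumes b: "ptime d A b" and f: "ptime d A f" and g: "ptime d A g"
  shows "ptime d A (\<lambda>x. if b x then f x else g x)"
proof -
  obtain P1 k1 p1 where 1: "d \<longrightarrow> list_all deterministic P1" "implements P1 A k1 p1 b"
    using b unfolding ptime_def by blast
  obtain P2 k2 p2 where 2: "d \<longrightarrow> list_all deterministic (P1 @ P2)" "implements (P1 @ P2) A k2 p2 f"
    using ptime_link[OF f 1(1)] by blast
  obtain P3 k3 p3 where 3: "d \<longrightarrow> list_all deterministic ((P1 @ P2) @ P3)" "implements ((P1 @ P2) @ P3) A k3 p3 g"
    using ptime_link[OF g 2(1)] by blast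
  let ?e = "Cond (Call k1 (Var 0)) (Call k2 (Var 0)) (Call k3 (Var 0))"
  let ?Q = "((P1 @ P2) @ P3) @ [?e]"
  have i1: "implements ?Q A k1 p1 b" using implements_append[OF 1(2), of "P2 @ P3 @ [?e]"] by simp
  have i2: "implements ?Q A k2 p2 f" using implements_append[OF 2(2), of "P3 @ [?e]"] by simp
  have i3: "implements ?Q A k3 p3 g" by (rule implements_append[OF 3(2)])
  let ?T = "\<lambda>x. poly p1 (esize x) + poly p2 (esize x) + poly p3 (esize x) + 5"
  show ?thesis
  proof (rule ptime_body[where P = "(P1 @ P2) @ P3" and e = ?e and T = ?T])
    show "pbounded ?T" by (intro pbounded_intros)
    fix x :: 'a
    have v: "evals ?Q A [enc x] (Var 0) (enc x) 1 0" by (rule evals_Var0)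
    from implements_call[OF i1 v] implements_call[OF i2 v] implements_call[OF i3 v]
    obtain t q t' q' t'' q'' where
      t: "evals ?Q A [enc x] (Call k1 (Var 0)) (enc (b x)) t q" "t \<le> 1 + poly p1 (esize x) + 1"
      "evals ?Q A [enc x] (Call k2 (Var 0)) (enc (f x)) t' q'" "t' \<le> 1 + poly p2 (esize x) + 1"
      "evals ?Q A [enc x] (Call k3 (Var 0)) (enc (g x)) t'' q''" "t'' \<le> 1 + poly p3 (esize x) + 1" by blast
    show "\<exists>t q. evals ?Q A [enc x] ?e (enc (if b x then f x else g x)) t q \<and> t \<le> ?T x"
    proof (cases "b x")
      case True
      then show ?thesis using t evals_Cond[OF t(1), of "Call k2 (Var 0)" "Call k3 (Var 0)" "enc (f x)" t' q']
        by (intro exI[of _ "t + t' + 1"] exI[of _ "q + q'"]) simp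
    next
      case False
      then show ?thesis using t evals_Cond[OF t(1), of "Call k2 (Var 0)" "Call k3 (Var 0)" "enc (g x)" t'' q'']
        by (intro exI[of _ "t + t'' + 1"] exI[of _ "q + q''"]) simp
    qed
  qed (use 3 in auto)
qed

lemma ptime_query: "ptime False A f \<Longrightarrow> ptime False A (\<lambda>x. enc (f x) \<in> A)"
proof (rule ptime_comp[where g = "\<lambda>x. enc x \<in> A"])
  show "ptime False A (\<lambda>x. enc x \<in> A)"
    by (rule ptime_constant_time[where e = "Query (Var 0)"])
      (simp, unfold enc_bool_def, rule evals_Query[OF evals_Var0])
qed

lemma evals_weaken:
  "evals P A env e v t q \<Longrightarrow> v = v' \<Longrightarrow> t \<le> T \<Longrightarrow> \<exists>t q. evals P A env e v' t q \<and> t \<le> T"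
  by blast

text \<open>The general loop from which nearly all others are derived. Polynomially many cheap steps
  could still blow up the accumulator, for instance by repeated doubling; hence the bound on every
  intermediate value, as in Cobham's limited recursion.\<close>

lemma ptime_foldl_bounded:
  fixes S :: "'c::encodable \<Rightarrow> 'b::encodable \<Rightarrow> 'a::encodable \<Rightarrow> 'b"
  assumes S: "ptime d A (\<lambda>z. S (fst z) (fst (snd z)) (snd (snd z)))"
    and l: "ptime d A l" and i: "ptime d A i" and B: "pbounded B"
    and bound: "\<And>x ys zs. l x = ys @ zs \<Longrightarrow> esize (foldl (S x) (i x) ys) \<le> B x"
  shows "ptime d A (\<lambda>x. foldl (S x) (i x) (l x))"
proof -
  obtain P1 k1 p1 where 1: "d \<longrightarrow> list_all deterministic P1"
    "implements P1 A k1 p1 (\<lambda>z. S (fst z) (fst (snd z)) (snd (snd z)))"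
    using S unfolding ptime_def by blast
  obtain P2 k2 p2 where 2: "d \<longrightarrow> list_all deterministic (P1 @ P2)" "implements (P1 @ P2) A k2 p2 l"
    using ptime_link[OF l 1(1)] by blast
  obtain P3 k3 p3 where 3: "d \<longrightarrow> list_all deterministic ((P1 @ P2) @ P3)" "implements ((P1 @ P2) @ P3) A k3 p3 i"
    using ptime_link[OF i 2(1)] by blast
  let ?P = "(P1 @ P2) @ P3"
  \<comment> \<open>The loop state is the triple of parameter, accumulator and remaining list. The
    body \<open>?e1\<close> calls itself at position \<open>length ?P\<close>; \<open>?e2\<close>
    builds the initial state.\<close>
  let ?l = "Second (Second (Var 0))"
  let ?s = "Join (First (Var 0)) (Join (First (Second (Var 0))) (First ?l))"
  let ?r = "Join (First (Var 0)) (Join (Call k1 ?s) (Second ?l))"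
  let ?e1 = "Cond ?l (Call (length ?P) ?r) (First (Second (Var 0)))"
  let ?m = "Join (Var 0) (Join (Call k3 (Var 0)) (Call k2 (Var 0)))"
  let ?e2 = "Call (length ?P) ?m"
  define Q where "Q = (?P @ [?e1]) @ [?e2]"
  have i1: "implements Q A k1 p1 (\<lambda>z. S (fst z) (fst (snd z)) (snd (snd z)))"
    using implements_append[OF 1(2), of "P2 @ P3 @ [?e1] @ [?e2]"] by (simp add: Q_def)
  have i2: "implements Q A k2 p2 l" using implements_append[OF 2(2), of "P3 @ [?e1] @ [?e2]"] by (simp add: Q_def)
  have i3: "implements Q A k3 p3 i" using implements_append[OF 3(2), of "[?e1] @ [?e2]"] by (simp add: Q_def)
  have Qr: "length ?P < length Q" "Q ! length ?P = ?e1" by (auto simp: nth_append Q_def)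
  \<comment> \<open>\<open>N\<close> bounds each component of the loop state and \<open>K\<close>
    the cost of one iteration, with slack in the constants.\<close>
  define N where "N x = esize x + B x + esize (l x) + 2" for x
  define K where "K x = 60 + 6 * N x + poly p1 (N x)" for x
  have loop: "\<exists>t q. evals Q A [enc (x, foldl (S x) (i x) ys, zs)] ?e1 (enc (foldl (S x) (i x) (l x))) t q \<and>
      t \<le> (length zs + 1) * K x" if "l x = ys @ zs" for x ys zs
    using that
  proof (induction zs arbitrary: ys)
    case Nil
    let ?b = "foldl (S x) (i x) ys"
    let ?env = "[enc (x, ?b, [] :: 'a list)]"
    have b: "evals Q A ?env (Second (Var 0)) (enc (?b, [] :: 'a list)) 2 0"
      using evals_Second0[of Q A "enc (x, ?b, [] :: 'a list)"] by simp
    have c: "evals Q A ?env ?l Tip 3 0" using evals_Second[OF b] by simp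
    have d: "evals Q A ?env (First (Second (Var 0))) (enc ?b) 3 0" using evals_First[OF b] by simp
    have "evals Q A ?env ?e1 (enc ?b) (3 + 3 + 1) (0 + 0)"
      by (rule evals_Cond[OF c]) (use d in simp)
    moreover have "3 + 3 + 1 \<le> (length ([] :: 'a list) + 1) * K x" by (simp add: K_def)
    moreover have "foldl (S x) (i x) (l x) = ?b" using Nil by simp
    ultimately show ?case by (metis (no_types))
  next
    case (Cons a zs)
    let ?b = "foldl (S x) (i x) ys"
    let ?b' = "S x ?b a"
    let ?env = "[enc (x, ?b, a # zs)]"
    have x: "evals Q A ?env (First (Var 0)) (enc x) 2 0"
      using evals_First0[of Q A "enc (x, ?b, a # zs)"] by simp
    have b: "evals Q A ?env (Second (Var 0)) (enc (?b, a # zs)) 2 0"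
      using evals_Second0[of Q A "enc (x, ?b, a # zs)"] by simp
    have c: "evals Q A ?env ?l (enc (a # zs)) 3 0" using evals_Second[OF b] by simp
    have d: "evals Q A ?env (First (Second (Var 0))) (enc ?b) 3 0" using evals_First[OF b] by simp
    have e: "evals Q A ?env (First ?l) (enc a) 4 0" "evals Q A ?env (Second ?l) (enc zs) 4 0"
      using evals_First[OF c] evals_Second[OF c] by simp_all
    have "\<exists>ts qs. evals Q A ?env ?s (enc (x, ?b, a)) ts qs \<and> ts \<le> 12 + 2 * esize ?b + 2 * esize a + esize x"
      by (rule evals_weaken[OF evals_Join[OF x evals_Join[OF d e(1)]]]) auto
    then obtain ts qs where s: "evals Q A ?env ?s (enc (x, ?b, a)) ts qs"
      "ts \<le> 12 + 2 * esize ?b + 2 * esize a + esize x" by blast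
    have len: "esize a + esize zs + 1 \<le> esize (l x)" using Cons.prems by (simp add: esize_append)
    have bb: "esize ?b \<le> B x" "esize ?b' \<le> B x"
      using bound[of x ys "a # zs"] bound[of x "ys @ [a]" zs] Cons.prems by auto
    obtain tc qc where c': "evals Q A ?env (Call k1 ?s) (enc ?b') tc qc"
      "tc \<le> ts + poly p1 (esize (x, ?b, a)) + 1"
      using implements_call[OF i1 s(1)] unfolding fst_conv snd_conv by blast
    have "poly p1 (esize (x, ?b, a)) \<le> poly p1 (N x)"
      by (rule poly_mono_nat) (use bb len in \<open>auto simp: N_def\<close>)
    with c' s(2) bb len have tc: "tc \<le> 20 + 3 * N x + poly p1 (N x)" by (simp add: N_def)
    have "\<exists>tr qr. evals Q A ?env ?r (enc (x, ?b', zs)) tr qr \<and>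
        tr \<le> tc + 9 + 2 * esize ?b' + 2 * esize zs + esize x"
      by (rule evals_weaken[OF evals_Join[OF x evals_Join[OF c'(1) e(2)]]]) auto
    then obtain tr qr where r: "evals Q A ?env ?r (enc (x, ?b', zs)) tr qr"
      "tr \<le> tc + 9 + 2 * esize ?b' + 2 * esize zs + esize x" by blast
    have fl: "foldl (S x) (i x) (ys @ [a]) = ?b'" by simp
    obtain t q where IH: "evals Q A [enc (x, ?b', zs)] ?e1 (enc (foldl (S x) (i x) (l x))) t q"
      "t \<le> (length zs + 1) * K x"
      using Cons.IH[of "ys @ [a]", unfolded fl] Cons.prems by (metis append.assoc append_Cons append_Nil)
    have call: "evals Q A ?env (Call (length ?P) ?r) (enc (foldl (S x) (i x) (l x))) (tr + t + 1) (qr + q)"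
      by (rule evals_Call[OF r(1) Qr(1)]) (use IH(1) Qr(2) in simp)
    have "evals Q A ?env ?e1 (enc (foldl (S x) (i x) (l x))) (3 + (tr + t + 1) + 1) (0 + (qr + q))"
      by (rule evals_Cond[OF c]) (use call in simp)
    moreover have "3 + (tr + t + 1) + 1 \<le> (length (a # zs) + 1) * K x"
    proof -
      have "esize (l x) \<le> N x" "B x \<le> N x" "esize x + esize ?b' + esize zs \<le> N x"
        using bb len by (auto simp: N_def)
      then have "tr + 5 \<le> K x" using r(2) tc len unfolding K_def by linarith
      then show ?thesis using IH(2) by (simp add: algebra_simps)
    qed
    ultimately show ?case by blast
  qed
  let ?T = "\<lambda>x. 20 + esize x + poly p3 (esize x) + poly p2 (esize x) + 2 * B x + 3 * esize (l x)
    + esize x + (esize (l x) + 1) * K x"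
  show ?thesis
  proof (rule ptime_body[where P = "?P @ [?e1]" and e = ?e2 and T = ?T])
    show "pbounded ?T" unfolding K_def N_def by (intro pbounded_intros B ptime_esize[OF l])
    fix x :: 'c
    have v: "evals Q A [enc x] (Var 0) (enc x) 1 0" by (rule evals_Var0)
    from implements_call[OF i2 v] implements_call[OF i3 v] obtain tl ql ti qi where
      t: "evals Q A [enc x] (Call k2 (Var 0)) (enc (l x)) tl ql" "tl \<le> 1 + poly p2 (esize x) + 1"
      "evals Q A [enc x] (Call k3 (Var 0)) (enc (i x)) ti qi" "ti \<le> 1 + poly p3 (esize x) + 1" by blast
    have "\<exists>tm qm. evals Q A [enc x] ?m (enc (x, i x, l x)) tm qm \<and>
        tm \<le> ti + tl + 4 + 2 * esize (i x) + 2 * esize (l x) + esize x"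
      by (rule evals_weaken[OF evals_Join[OF v evals_Join[OF t(3,1)]]]) auto
    then obtain tm qm where m: "evals Q A [enc x] ?m (enc (x, i x, l x)) tm qm"
      "tm \<le> ti + tl + 4 + 2 * esize (i x) + 2 * esize (l x) + esize x" by blast
    obtain t0 q0 where lo: "evals Q A [enc (x, i x, l x)] ?e1 (enc (foldl (S x) (i x) (l x))) t0 q0"
      "t0 \<le> (length (l x) + 1) * K x"
      using loop[of x "[]" "l x"] by auto
    have e: "evals Q A [enc x] ?e2 (enc (foldl (S x) (i x) (l x))) (tm + t0 + 1) (qm + q0)"
      by (rule evals_Call[OF m(1) Qr(1)]) (use lo(1) Qr(2) in simp)
    have "esize (i x) \<le> B x" using bound[of x "[]" "l x"] by simp
    moreover have "(length (l x) + 1) * K x \<le> (esize (l x) + 1) * K x"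
      using length_le_esize[of "l x"] by (intro mult_right_mono) auto
    ultimately have "tm + t0 + 1 \<le> ?T x" using m(2) t(2,4) lo(2) by linarith
    with e show "\<exists>t q. evals ((?P @ [?e1]) @ [?e2]) A [enc x] ?e2 (enc (foldl (S x) (i x) (l x))) t q \<and> t \<le> ?T x"
      unfolding Q_def[symmetric] by blast
  qed (use 3(1) in auto)
qed

text \<open>If a step adds at most \<open>G x\<close>, whatever the accumulator is, intermediate
  sizes grow linearly with the number of steps. The bounded version remains for folds whose growth
  depends on the position, such as lists of gates.\<close>

lemma ptime_foldl:
  assumes S: "ptime d A (\<lambda>z. S (fst z) (fst (snd z)) (snd (snd z)))"
    and l: "ptime d A l" and i: "ptime d A i" and G: "pbounded G"
    and growth: "\<And>x b a. a \<in> set (l x) \<Longrightarrow> esize (S x b a) \<le> esize b + G x"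
  shows "ptime d A (\<lambda>x. foldl (S x) (i x) (l x))"
proof (rule ptime_foldl_bounded[OF S l i])
  show "pbounded (\<lambda>x. esize (i x) + esize (l x) * G x)"
    by (intro pbounded_intros ptime_esize[OF i] ptime_esize[OF l] G)
  have "esize (foldl (S x) b ys) \<le> esize b + length ys * G x" if "set ys \<subseteq> set (l x)" for x b ys
    using that
  proof (induction ys arbitrary: b)
    case (Cons a ys)
    then have "esize (foldl (S x) (S x b a) ys) \<le> esize (S x b a) + length ys * G x" by simp
    also have "esize (S x b a) \<le> esize b + G x" using growth Cons.prems by simp
    finally show ?case by simp
  qed simp
  moreover have "length ys * G x \<le> esize (l x) * G x" if "l x = ys @ zs" for x ys zs
    using length_le_esize[of "l x"] that by (intro mult_right_mono) auto
  ultimately show "esize (foldl (S x) (i x) ys) \<le> esize (i x) + esize (l x) * G x"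
    if "l x = ys @ zs" for x ys zs
    using that by (metis add_left_mono order_trans set_append sup_ge1)
qed

section \<open>Formulas as token lists\<close>

text \<open>In prefix order a formula can be evaluated by a fold with a stack, so that branching
  recursion over syntax trees is programmed only once, in \<open>ptime_tokens\<close>. The token of
  an atom has the same tree as the atom.\<close>

primrec tokens :: "formula \<Rightarrow> (nat \<times> nat \<times> nat) list" where
  "tokens (Const b) = [(0, of_bool b, 0)]"
| "tokens (Atom v) = [case v of X j \<Rightarrow> (1, 0, j) | Y j \<Rightarrow> (1, 1, j)]"
| "tokens (Neg f) = (2, 0, 0) # tokens f"
| "tokens (Conj f g) = (3, 0, 0) # tokens f @ tokens g"
| "tokens (Disj f g) = (4, 0, 0) # tokens f @ tokens g"

lemma enc_numerals: "enc (1::nat) = Fork Tip Tip" "enc (2::nat) = Fork Tip (Fork Tip Tip)"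
  "enc (3::nat) = Fork Tip (Fork Tip (Fork Tip Tip))"
  "enc (4::nat) = Fork Tip (Fork Tip (Fork Tip (Fork Tip Tip)))"
  by (simp_all add: numeral_eq_Suc)

lemma enc_var: "enc (X j) = enc (0::nat, j)" "enc (Y j) = enc (1::nat, j)"
  by (simp_all add: enc_var_def enc_nat_def enc_prod_def)

lemma enc_formula:
  "enc (Const b) = Fork Tip (enc b)"
  "enc (Atom v) = Fork (enc (1::nat)) (enc v)"
  "enc (Neg f) = Fork (enc (2::nat)) (enc f)"
  "enc (Conj f g) = Fork (enc (3::nat)) (Fork (enc f) (enc g))"
  "enc (Disj f g) = Fork (enc (4::nat)) (Fork (enc f) (enc g))"
  by (simp_all add: enc_formula_def enc_var_def enc_nat_def enc_bool_def numeral_eq_Suc)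

lemma esize_tokens: "esize (tokens f) \<le> 3 * esize f"
proof (induction f)
  case (Atom v)
  then show ?case by (cases v) (simp_all add: enc_formula enc_var)
qed (auto simp: enc_formula enc_numerals esize_append split: if_splits)

lemma formula_size_le_esize: "formula_size f \<le> esize f"
  by (induction f) (auto simp: enc_formula enc_numerals)

text \<open>Two recursive calls per node do not fit the fold scheme, hence a program by hand. The
  accumulator replaces every append by a single \<open>Join\<close>, which keeps the work per node
  linear in the size of the result.\<close>

lemma ptime_tokens:
  assumes "ptime d A f" shows "ptime d A (\<lambda>x. tokens (f x))"
proof -
  let ?f = "First (Var 0)" and ?acc = "Second (Var 0)"
  let ?tag = "First ?f" and ?c = "Second ?f"
  let ?tok = "Join ?tag (Join Empty Empty)"
  let ?const = "Join (Join Empty (Join ?c Empty)) ?acc"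
  let ?atom = "Join ?f ?acc"
  let ?rc = "Call 0 (Join ?c ?acc)"
  let ?neg = "Join ?tok ?rc"
  let ?r2 = "Call 0 (Join (Second ?c) ?acc)"
  let ?r1 = "Call 0 (Join (First ?c) ?r2)"
  let ?bin = "Join ?tok ?r1"
  \<comment> \<open>Tags are unary: a second component that is not \<open>Tip\<close> means at least
    2, one level deeper at least 3. \<open>Conj\<close> and \<open>Disj\<close> share a branch
    because the tag is copied.\<close>
  let ?e1 = "Cond (Second ?tag) (Cond (Second (Second ?tag)) ?bin ?neg) (Cond ?tag ?atom ?const)"
  let ?e2 = "Call 0 (Join (Var 0) Empty)"
  define Q where "Q = [?e1, ?e2]"
  have Q0: "0 < length Q" "Q ! 0 = ?e1" by (auto simp: Q_def)
  \<comment> \<open>\<open>M\<close> is one budget for all nested calls: \<open>tokens f\<close>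
    needs at most \<open>3 * esize f\<close>. The right operand is flattened first and its tokens
    join the accumulator of the left one.\<close>
  have loop: "\<exists>t q. evals Q A [enc (f, acc)] ?e1 (enc (tokens f @ acc)) t q \<and> t \<le> formula_size f * (60 + 20 * M)"
    if "3 * esize f + esize acc \<le> M" for f acc M
    using that
  proof (induction f arbitrary: acc)
    case (Const b)
    let ?env = "[enc (Const b, acc)]"
    have f: "evals Q A ?env ?f (enc (Const b)) 2 0" and acc: "evals Q A ?env ?acc (enc acc) 2 0"
      using evals_First0[of Q A "enc (Const b, acc)"]
        evals_Second0[of Q A "enc (Const b, acc)"] by simp_all
    have tag: "evals Q A ?env ?tag Tip 3 0" and c: "evals Q A ?env ?c (enc b) 3 0"
      using evals_First[OF f] evals_Second[OF f] by (simp_all add: enc_formula)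
    have tag': "evals Q A ?env (Second ?tag) Tip 4 0" using evals_Second[OF tag] by simp
    have "\<exists>t q. evals Q A ?env ?const (enc (tokens (Const b) @ acc)) t q \<and> t \<le> 30 + esize acc"
      by (rule evals_weaken[OF evals_Join[OF evals_Join[OF evals_Empty evals_Join[OF c evals_Empty]] acc]])
        (use esize_bool[of b] in \<open>auto simp: enc_numerals\<close>)
    then obtain t q where c': "evals Q A ?env ?const (enc (tokens (Const b) @ acc)) t q" "t \<le> 30 + esize acc" by blast
    have "evals Q A ?env (Cond ?tag ?atom ?const) (enc (tokens (Const b) @ acc)) (3 + t + 1) (0 + q)"
      by (rule evals_Cond[OF tag]) (use c' in simp)
    then have "evals Q A ?env ?e1 (enc (tokens (Const b) @ acc)) (4 + (3 + t + 1) + 1) (0 + (0 + q))"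
      by (intro evals_Cond[OF tag']) simp
    then show ?case using c'(2) Const by - (intro exI conjI, assumption, simp)
  next
    case (Atom v)
    let ?env = "[enc (Atom v, acc)]"
    have f: "evals Q A ?env ?f (enc (Atom v)) 2 0" and acc: "evals Q A ?env ?acc (enc acc) 2 0"
      using evals_First0[of Q A "enc (Atom v, acc)"]
        evals_Second0[of Q A "enc (Atom v, acc)"] by simp_all
    have tag: "evals Q A ?env ?tag (Fork Tip Tip) 3 0"
      using evals_First[OF f] by (simp_all add: enc_formula)
    have tag': "evals Q A ?env (Second ?tag) Tip 4 0" using evals_Second[OF tag] by simp
    have tok: "Fork (enc (Atom v)) (enc acc) = enc (tokens (Atom v) @ acc)"
      by (cases v) (simp_all add: enc_formula enc_var)
    have "\<exists>t q. evals Q A ?env ?atom (enc (tokens (Atom v) @ acc)) t q \<and> t \<le> 30 + esize (Atom v) + esize acc"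
      by (rule evals_weaken[OF evals_Join[OF f acc, unfolded tok]]) (use tok in \<open>auto simp: enc_numerals\<close>)
    then obtain t q where c': "evals Q A ?env ?atom (enc (tokens (Atom v) @ acc)) t q" "t \<le> 30 + esize (Atom v) + esize acc" by blast
    have "evals Q A ?env (Cond ?tag ?atom ?const) (enc (tokens (Atom v) @ acc)) (3 + t + 1) (0 + q)"
      by (rule evals_Cond[OF tag]) (use c' in simp)
    then have "evals Q A ?env ?e1 (enc (tokens (Atom v) @ acc)) (4 + (3 + t + 1) + 1) (0 + (0 + q))"
      by (intro evals_Cond[OF tag']) simp
    then show ?case using c'(2) Atom by - (intro exI conjI, assumption, simp)
  next
    case (Neg g)
    let ?env = "[enc (Neg g, acc)]"
    have f: "evals Q A ?env ?f (enc (Neg g)) 2 0" and acc: "evals Q A ?env ?acc (enc acc) 2 0"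
      using evals_First0[of Q A "enc (Neg g, acc)"]
        evals_Second0[of Q A "enc (Neg g, acc)"] by simp_all
    have tag: "evals Q A ?env ?tag (enc (2::nat)) 3 0" and c: "evals Q A ?env ?c (enc g) 3 0"
      using evals_First[OF f] evals_Second[OF f] by (simp_all add: enc_formula)
    have tag': "evals Q A ?env (Second ?tag) (Fork Tip Tip) 4 0"
      using evals_Second[OF tag] by (simp add: enc_numerals)
    have tag'': "evals Q A ?env (Second (Second ?tag)) Tip 5 0" using evals_Second[OF tag'] by simp
    obtain t q where IH: "evals Q A [enc (g, acc)] ?e1 (enc (tokens g @ acc)) t q"
      "t \<le> formula_size g * (60 + 20 * M)"
      using Neg.IH[of acc] Neg.prems by (auto simp: enc_formula)
    have arg: "evals Q A ?env (Join ?c ?acc) (enc (g, acc)) (3 + 2 + size (Fork (enc g) (enc acc))) (0 + 0)"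
      using evals_Join[OF c acc] by simp
    have rc: "evals Q A ?env ?rc (enc (tokens g @ acc)) (3 + 2 + size (Fork (enc g) (enc acc)) + t + 1) (0 + 0 + q)"
      by (rule evals_Call[OF arg Q0(1)]) (use IH Q0(2) in simp)
    have "\<exists>t' q'. evals Q A ?env ?neg (enc (tokens (Neg g) @ acc)) t' q' \<and> t' \<le> 40 + esize g + esize acc + esize (tokens g @ acc) + t"
      by (rule evals_weaken[OF evals_Join[OF evals_Join[OF tag evals_Join[OF evals_Empty evals_Empty]] rc]]) (auto simp: enc_numerals)
    then obtain t' q' where b: "evals Q A ?env ?neg (enc (tokens (Neg g) @ acc)) t' q'" "t' \<le> 40 + esize g + esize acc + esize (tokens g @ acc) + t" by blast
    have "evals Q A ?env (Cond (Second (Second ?tag)) ?bin ?neg) (enc (tokens (Neg g) @ acc)) (5 + t' + 1) (0 + q')"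
      by (rule evals_Cond[OF tag'']) (use b in simp)
    then have "evals Q A ?env ?e1 (enc (tokens (Neg g) @ acc)) (4 + (5 + t' + 1) + 1) (0 + (0 + q'))"
      by (intro evals_Cond[OF tag']) simp
    then show ?case using b(2) Neg.prems IH(2) esize_tokens[of g]
      by - (intro exI conjI, assumption, simp add: enc_formula esize_append)
  next
    case (Conj g h)
    let ?F = "Conj g h"
    let ?env = "[enc (?F, acc)]"
    have f: "evals Q A ?env ?f (enc ?F) 2 0" and acc: "evals Q A ?env ?acc (enc acc) 2 0"
      using evals_First0[of Q A "enc (?F, acc)"]
        evals_Second0[of Q A "enc (?F, acc)"] by simp_all
    have tag: "evals Q A ?env ?tag (enc (3::nat)) 3 0" and c: "evals Q A ?env ?c (Fork (enc g) (enc h)) 3 0"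
      using evals_First[OF f] evals_Second[OF f] by (simp_all add: enc_formula)
    have tag': "evals Q A ?env (Second ?tag) (Fork Tip (Fork Tip Tip)) 4 0"
      using evals_Second[OF tag] by (simp add: enc_numerals)
    have tag'': "evals Q A ?env (Second (Second ?tag)) (Fork Tip Tip) 5 0" using evals_Second[OF tag'] by simp
    obtain t q where IH: "evals Q A [enc (h, acc)] ?e1 (enc (tokens h @ acc)) t q"
      "t \<le> formula_size h * (60 + 20 * M)"
      using Conj.IH(2)[of acc] Conj.prems by (auto simp: enc_formula)
    have c2: "evals Q A ?env (Second ?c) (enc h) 4 0" using evals_Second[OF c] by simp
    have c1: "evals Q A ?env (First ?c) (enc g) 4 0" using evals_First[OF c] by simp
    have arg: "evals Q A ?env (Join (Second ?c) ?acc) (enc (h, acc)) (4 + 2 + size (Fork (enc h) (enc acc))) (0 + 0)"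
      using evals_Join[OF c2 acc] by simp
    have r2: "evals Q A ?env ?r2 (enc (tokens h @ acc)) (4 + 2 + size (Fork (enc h) (enc acc)) + t + 1) (0 + 0 + q)"
      by (rule evals_Call[OF arg Q0(1)]) (use IH Q0(2) in simp)
    obtain t1 q1 where IH1: "evals Q A [enc (g, tokens h @ acc)] ?e1 (enc (tokens g @ tokens h @ acc)) t1 q1"
      "t1 \<le> formula_size g * (60 + 20 * M)"
      using Conj.IH(1)[of "tokens h @ acc"] Conj.prems esize_tokens[of h] by (auto simp: enc_formula esize_append)
    have "\<exists>ta qa. evals Q A ?env (Join (First ?c) ?r2) (enc (g, tokens h @ acc)) ta qa \<and> ta \<le> 15 + esize h + esize acc + t + esize g + esize (tokens h @ acc)"
      by (rule evals_weaken[OF evals_Join[OF c1 r2]]) (auto simp: enc_numerals)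
    then obtain ta qa where arg1: "evals Q A ?env (Join (First ?c) ?r2) (enc (g, tokens h @ acc)) ta qa" "ta \<le> 15 + esize h + esize acc + t + esize g + esize (tokens h @ acc)" by blast
    have r1: "evals Q A ?env ?r1 (enc (tokens g @ tokens h @ acc)) (ta + t1 + 1) (qa + q1)"
      by (rule evals_Call[OF arg1(1) Q0(1)]) (use IH1 Q0(2) in simp)
    have "\<exists>t' q'. evals Q A ?env ?bin (enc (tokens ?F @ acc)) t' q' \<and> t' \<le> 20 + ta + t1 + esize (tokens g @ tokens h @ acc)"
      by (rule evals_weaken[OF evals_Join[OF evals_Join[OF tag evals_Join[OF evals_Empty evals_Empty]] r1]]) (auto simp: enc_numerals)
    then obtain t' q' where b: "evals Q A ?env ?bin (enc (tokens ?F @ acc)) t' q'" "t' \<le> 20 + ta + t1 + esize (tokens g @ tokens h @ acc)" by blast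
    have "evals Q A ?env (Cond (Second (Second ?tag)) ?bin ?neg) (enc (tokens ?F @ acc)) (5 + t' + 1) (0 + q')"
      by (rule evals_Cond[OF tag'']) (use b in simp)
    then have "evals Q A ?env ?e1 (enc (tokens ?F @ acc)) (4 + (5 + t' + 1) + 1) (0 + (0 + q'))"
      by (intro evals_Cond[OF tag']) simp
    then show ?case using b(2) arg1(2) Conj.prems IH(2) IH1(2) esize_tokens[of g] esize_tokens[of h]
      by - (intro exI conjI, assumption, simp add: enc_formula esize_append algebra_simps)
  next
    case (Disj g h)
    let ?F = "Disj g h"
    let ?env = "[enc (?F, acc)]"
    have f: "evals Q A ?env ?f (enc ?F) 2 0" and acc: "evals Q A ?env ?acc (enc acc) 2 0"
      using evals_First0[of Q A "enc (?F, acc)"]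
        evals_Second0[of Q A "enc (?F, acc)"] by simp_all
    have tag: "evals Q A ?env ?tag (enc (4::nat)) 3 0" and c: "evals Q A ?env ?c (Fork (enc g) (enc h)) 3 0"
      using evals_First[OF f] evals_Second[OF f] by (simp_all add: enc_formula)
    have tag': "evals Q A ?env (Second ?tag) (Fork Tip (Fork Tip (Fork Tip Tip))) 4 0"
      using evals_Second[OF tag] by (simp add: enc_numerals)
    have tag'': "evals Q A ?env (Second (Second ?tag)) (Fork Tip (Fork Tip Tip)) 5 0"
      using evals_Second[OF tag'] by simp
    obtain t q where IH: "evals Q A [enc (h, acc)] ?e1 (enc (tokens h @ acc)) t q"
      "t \<le> formula_size h * (60 + 20 * M)"
      using Disj.IH(2)[of acc] Disj.prems by (auto simp: enc_formula)
    have c2: "evals Q A ?env (Second ?c) (enc h) 4 0" using evals_Second[OF c] by simp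
    have c1: "evals Q A ?env (First ?c) (enc g) 4 0" using evals_First[OF c] by simp
    have arg: "evals Q A ?env (Join (Second ?c) ?acc) (enc (h, acc)) (4 + 2 + size (Fork (enc h) (enc acc))) (0 + 0)"
      using evals_Join[OF c2 acc] by simp
    have r2: "evals Q A ?env ?r2 (enc (tokens h @ acc)) (4 + 2 + size (Fork (enc h) (enc acc)) + t + 1) (0 + 0 + q)"
      by (rule evals_Call[OF arg Q0(1)]) (use IH Q0(2) in simp)
    obtain t1 q1 where IH1: "evals Q A [enc (g, tokens h @ acc)] ?e1 (enc (tokens g @ tokens h @ acc)) t1 q1"
      "t1 \<le> formula_size g * (60 + 20 * M)"
      using Disj.IH(1)[of "tokens h @ acc"] Disj.prems esize_tokens[of h] by (auto simp: enc_formula esize_append)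
    have "\<exists>ta qa. evals Q A ?env (Join (First ?c) ?r2) (enc (g, tokens h @ acc)) ta qa \<and> ta \<le> 15 + esize h + esize acc + t + esize g + esize (tokens h @ acc)"
      by (rule evals_weaken[OF evals_Join[OF c1 r2]]) (auto simp: enc_numerals)
    then obtain ta qa where arg1: "evals Q A ?env (Join (First ?c) ?r2) (enc (g, tokens h @ acc)) ta qa" "ta \<le> 15 + esize h + esize acc + t + esize g + esize (tokens h @ acc)" by blast
    have r1: "evals Q A ?env ?r1 (enc (tokens g @ tokens h @ acc)) (ta + t1 + 1) (qa + q1)"
      by (rule evals_Call[OF arg1(1) Q0(1)]) (use IH1 Q0(2) in simp)
    have "\<exists>t' q'. evals Q A ?env ?bin (enc (tokens ?F @ acc)) t' q' \<and> t' \<le> 22 + ta + t1 + esize (tokens g @ tokens h @ acc)"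
      by (rule evals_weaken[OF evals_Join[OF evals_Join[OF tag evals_Join[OF evals_Empty evals_Empty]] r1]]) (auto simp: enc_numerals)
    then obtain t' q' where b: "evals Q A ?env ?bin (enc (tokens ?F @ acc)) t' q'" "t' \<le> 22 + ta + t1 + esize (tokens g @ tokens h @ acc)" by blast
    have "evals Q A ?env (Cond (Second (Second ?tag)) ?bin ?neg) (enc (tokens ?F @ acc)) (5 + t' + 1) (0 + q')"
      by (rule evals_Cond[OF tag'']) (use b in simp)
    then have "evals Q A ?env ?e1 (enc (tokens ?F @ acc)) (4 + (5 + t' + 1) + 1) (0 + (0 + q'))"
      by (intro evals_Cond[OF tag']) simp
    then show ?case using b(2) arg1(2) Disj.prems IH(2) IH1(2) esize_tokens[of g] esize_tokens[of h]
      by - (intro exI conjI, assumption, simp add: enc_formula esize_append algebra_simps)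
  qed
  let ?T = "\<lambda>f. 10 + esize f + esize f * (60 + 20 * (3 * esize f))"
  have "ptime d A tokens"
  proof (rule ptime_body[where P = "[?e1]" and e = ?e2 and T = ?T])
    show "pbounded ?T" by (intro pbounded_intros)
    fix f
    obtain t q where l: "evals Q A [enc (f, [] :: (nat \<times> nat \<times> nat) list)] ?e1 (enc (tokens f)) t q"
      "t \<le> formula_size f * (60 + 20 * (3 * esize f))"
      using loop[of f "[]" "3 * esize f"] by auto
    have j: "evals Q A [enc f] (Join (Var 0) Empty) (enc (f, [] :: (nat \<times> nat \<times> nat) list))
        (1 + 1 + size (Fork (enc f) Tip)) (0 + 0)"
      using evals_Join[OF evals_Var0 evals_Empty, of Q A "enc f"] by simp
    have e: "evals Q A [enc f] ?e2 (enc (tokens f)) (1 + 1 + size (Fork (enc f) Tip) + t + 1) (0 + 0 + q)"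
      by (rule evals_Call[OF j Q0(1)]) (use l Q0(2) in simp)
    have "formula_size f * (60 + 20 * (3 * esize f)) \<le> esize f * (60 + 20 * (3 * esize f))"
      using formula_size_le_esize by (intro mult_right_mono) auto
    with l(2) have "t \<le> esize f * (60 + 20 * (3 * esize f))" by (rule order_trans)
    then have "1 + 1 + size (Fork (enc f) Tip) + t + 1 \<le> ?T f" by simp
    with e show "\<exists>t q. evals ([?e1] @ [?e2]) A [enc f] ?e2 (enc (tokens f)) t q \<and> t \<le> ?T f"
      unfolding Q_def append_Cons append_Nil by blast
  qed auto
  then show ?thesis using ptime_comp assms by blast
qed

subsection \<open>Booleans, numbers and lists\<close>

named_theorems ptime_intros

declare ptime_id [ptime_intros] ptime_const [ptime_intros] ptime_pair [ptime_intros]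
  ptime_fst [ptime_intros] ptime_snd [ptime_intros] ptime_if [ptime_intros]
  ptime_tokens [ptime_intros]

lemma ptime_compose2:
  fixes f :: "'a::encodable \<Rightarrow> 'b::encodable \<Rightarrow> 'c::encodable"
  assumes f: "ptime d A (\<lambda>z. f (fst z) (snd z))" and g: "ptime d A g"
  shows "ptime d A (\<lambda>x. f x (g x))"
proof -
  have "ptime d A (\<lambda>x. (\<lambda>z. f (fst z) (snd z)) (x, g x))"
    by (rule ptime_comp[OF f ptime_pair[OF ptime_id g]])
  then show ?thesis by (simp only: fst_conv snd_conv)
qed

lemma ptime_Let [ptime_intros]:
  "ptime d A (\<lambda>z. f (fst z) (snd z)) \<Longrightarrow> ptime d A g \<Longrightarrow> ptime d A (\<lambda>x. let y = g x in f x y)"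
  unfolding Let_def by (rule ptime_compose2[of d A f g])

lemma ptime_not_Tip: "ptime d A f \<Longrightarrow> ptime d A (\<lambda>x. enc (f x) \<noteq> Tip)"
proof (rule ptime_comp[where g = "\<lambda>x. enc x \<noteq> Tip"])
  let ?e = "Cond (Var 0) (Join Empty Empty) Empty"
  have "\<exists>t q. evals [?e] A [enc x] ?e (enc (enc x \<noteq> Tip)) t q \<and> t \<le> 10" for x :: 'b
  proof (cases "enc x = Tip")
    case True
    have "evals [?e] A [enc x] (if enc x \<noteq> Tip then Join Empty Empty else Empty) Tip 1 0"
      using True evals_Empty by simp
    from evals_weaken[OF evals_Cond[OF evals_Var0 this]] show ?thesis using True by simp
  next
    case False
    have "evals [?e] A [enc x] (if enc x \<noteq> Tip then Join Empty Empty else Empty)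
        (Fork Tip Tip) (1 + 1 + size (Fork Tip Tip)) (0 + 0)"
      using False evals_Join[OF evals_Empty evals_Empty] by auto
    from evals_weaken[OF evals_Cond[OF evals_Var0 this]] show ?thesis using False by simp
  qed
  then show "ptime d A (\<lambda>x::'b. enc x \<noteq> Tip)"
    by (intro ptime_body[where P = "[]" and e = ?e and T = "\<lambda>_. 10"] pbounded_const) auto
qed

lemma ptime_Not [ptime_intros]: "ptime d A f \<Longrightarrow> ptime d A (\<lambda>x. \<not> f x)"
  by (rule ptime_recode[where g = "\<lambda>x. if f x then False else True"])
    (intro ptime_intros, assumption, simp)

lemma ptime_conj [ptime_intros]: "ptime d A f \<Longrightarrow> ptime d A g \<Longrightarrow> ptime d A (\<lambda>x. f x \<and> g x)"
  by (rule ptime_recode[where g = "\<lambda>x. if f x then g x else False"])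
    (intro ptime_intros, assumption+, simp)

lemma ptime_disj [ptime_intros]: "ptime d A f \<Longrightarrow> ptime d A g \<Longrightarrow> ptime d A (\<lambda>x. f x \<or> g x)"
  using ptime_Not[OF ptime_conj[OF ptime_Not ptime_Not], of d A f g] by simp

lemma ptime_imp [ptime_intros]: "ptime d A f \<Longrightarrow> ptime d A g \<Longrightarrow> ptime d A (\<lambda>x. f x \<longrightarrow> g x)"
  using ptime_disj[OF ptime_Not, of d A f g] by simp

lemma ptime_iff [ptime_intros]:
  "ptime d A f \<Longrightarrow> ptime d A g \<Longrightarrow> ptime d A (\<lambda>x. f x = (g x :: bool))"
  unfolding iff_conv_conj_imp by (intro ptime_intros)

lemma ptime_null [ptime_intros]: "ptime d A f \<Longrightarrow> ptime d A (\<lambda>x. f x = [])"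
  using ptime_Not[OF ptime_not_Tip, of d A f] by simp

lemma ptime_zero [ptime_intros]: "ptime d A f \<Longrightarrow> ptime d A (\<lambda>x. f x = (0::nat))"
  using ptime_Not[OF ptime_not_Tip, of d A f] by simp

lemma ptime_Suc [ptime_intros]: "ptime d A f \<Longrightarrow> ptime d A (\<lambda>x. Suc (f x))"
  by (rule ptime_recode[where g = "\<lambda>x. (Tip, f x)"]) (intro ptime_intros, assumption, simp)

lemma ptime_pred: "ptime d A f \<Longrightarrow> ptime d A (\<lambda>x. f x - Suc 0)"
proof (rule ptime_recode[OF ptime_second])
  show "enc (f x - Suc 0) = enc (second (enc (f x)))" for x by (cases "f x") auto
qed

lemma ptime_Cons [ptime_intros]: "ptime d A f \<Longrightarrow> ptime d A g \<Longrightarrow> ptime d A (\<lambda>x. f x # g x)"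
  by (rule ptime_recode[where g = "\<lambda>x. (f x, g x)"]) (intro ptime_intros, assumption+, simp)

lemma ptime_tl [ptime_intros]: "ptime d A f \<Longrightarrow> ptime d A (\<lambda>x. tl (f x))"
proof (rule ptime_recode[OF ptime_second])
  show "enc (tl (f x)) = enc (second (enc (f x)))" for x by (cases "f x") auto
qed

text \<open>Unlike \<open>hd\<close>, this is specified on the empty list and so can be
  computed.\<close>

definition hd_default :: "'a \<Rightarrow> 'a list \<Rightarrow> 'a" where
  "hd_default d xs = (case xs of [] \<Rightarrow> d | x # _ \<Rightarrow> x)"

lemma hd_default_simps [simp]: "hd_default d [] = d" "hd_default d (x # xs) = x"
  by (simp_all add: hd_default_def)

lemma ptime_hd_default [ptime_intros]:
  assumes "ptime d A f" "ptime d A g"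
  shows "ptime d A (\<lambda>x. hd_default (f x) (g x))"
proof (rule ptime_recode)
  have "ptime d A (\<lambda>x. enc (f x))" by (rule ptime_recode[OF assms(1)]) simp
  then show "ptime d A (\<lambda>x. if g x = [] then enc (f x) else first (enc (g x)))"
    by (intro ptime_intros ptime_first assms)
  show "enc (hd_default (f x) (g x)) = enc (if g x = [] then enc (f x) else first (enc (g x)))" for x
    by (cases "g x") auto
qed

lemma pbounded_mem:
  assumes g: "pbounded (\<lambda>z. g (fst z) (snd z))" and l: "ptime d A l"
  shows "\<exists>G. pbounded G \<and> (\<forall>x. \<forall>a \<in> set (l x). g x a \<le> G x)"
proof -
  obtain p where p: "\<forall>z. g (fst z) (snd z) \<le> poly p (esize z)" using g unfolding pbounded_def by blast
  have "g x a \<le> poly p (esize x + esize (l x) + 1)" if "a \<in> set (l x)" for x a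
  proof -
    have "g x a \<le> poly p (esize (x, a))" using p[rule_format, of "(x, a)"] by simp
    also have "\<dots> \<le> poly p (esize x + esize (l x) + 1)"
      using esize_mem[OF that] by (intro poly_mono_nat) auto
    finally show ?thesis .
  qed
  moreover have "pbounded (\<lambda>x. poly p (esize x + esize (l x) + 1))"
    by (intro pbounded_intros ptime_esize[OF l])
  ultimately show ?thesis by blast
qed

lemma ptime_rev [ptime_intros]: "ptime d A l \<Longrightarrow> ptime d A (\<lambda>x. rev (l x))"
proof -
  assume l: "ptime d A l"
  have "ptime d A (\<lambda>x. foldl (\<lambda>ys y. y # ys) [] (l x))"
    by (rule ptime_foldl[where G = "\<lambda>x. esize (l x) + 1"],
      (intro ptime_intros pbounded_intros ptime_esize[OF l] l)+) (auto dest: esize_mem)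
  moreover have "foldl (\<lambda>ys y. y # ys) zs xs = rev xs @ zs" for xs zs :: "'b list"
    by (induction xs arbitrary: zs) auto
  ultimately show ?thesis by simp
qed

lemma ptime_append [ptime_intros]:
  assumes "ptime d A f" "ptime d A g" shows "ptime d A (\<lambda>x. f x @ g x)"
proof -
  have "ptime d A (\<lambda>x. foldl (\<lambda>ys y. y # ys) (g x) (rev (f x)))"
    by (rule ptime_foldl[where G = "\<lambda>x. esize (f x) + 1"],
      (intro ptime_intros pbounded_intros ptime_esize[OF assms(1)] assms)+) (auto dest: esize_mem)
  moreover have "foldl (\<lambda>ys y. y # ys) zs xs = rev xs @ zs" for xs zs :: "'b list"
    by (induction xs arbitrary: zs) auto
  ultimately show ?thesis by simp
qed

lemma ptime_map [ptime_intros]: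
  assumes f: "ptime d A (\<lambda>z. f (fst z) (snd z))" and l: "ptime d A l"
  shows "ptime d A (\<lambda>x. map (f x) (l x))"
proof -
  obtain G where G: "pbounded G" "\<forall>x. \<forall>a \<in> set (l x). esize (f x a) \<le> G x"
    using pbounded_mem[OF ptime_esize[OF f] l] by blast
  have "ptime d A (\<lambda>x. foldl (\<lambda>ys y. f x y # ys) [] (rev (l x)))"
  proof (rule ptime_foldl[where G = "\<lambda>x. G x + 1"])
    show "pbounded (\<lambda>x. G x + 1)" by (intro pbounded_intros G)
    have "ptime d A (\<lambda>z::'a \<times> 'c list \<times> 'b. f (fst (fst z, snd (snd z))) (snd (fst z, snd (snd z))))"
      by (rule ptime_comp[OF f]) (intro ptime_intros)
    then show "ptime d A (\<lambda>z. f (fst z) (snd (snd z)) # fst (snd z))" by (intro ptime_intros) simp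
  qed ((intro ptime_intros l)+, use G in auto)
  moreover have "foldl (\<lambda>ys y. f x y # ys) zs xs = rev (map (f x) xs) @ zs" for xs zs x
    by (induction xs arbitrary: zs) auto
  ultimately show ?thesis by (simp add: rev_map)
qed

lemma ptime_filter [ptime_intros]:
  assumes f: "ptime d A (\<lambda>z. f (fst z) (snd z))" and l: "ptime d A l"
  shows "ptime d A (\<lambda>x. filter (f x) (l x))"
proof -
  have "ptime d A (\<lambda>x. foldl (\<lambda>ys y. if f x y then y # ys else ys) [] (rev (l x)))"
  proof (rule ptime_foldl[where G = "\<lambda>x. esize (l x) + 1"])
    show "pbounded (\<lambda>x. esize (l x) + 1)" by (intro pbounded_intros ptime_esize[OF l])
    have "ptime d A (\<lambda>z::'a \<times> 'b list \<times> 'b. f (fst (fst z, snd (snd z))) (snd (fst z, snd (snd z))))"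
      by (rule ptime_comp[OF f]) (intro ptime_intros)
    then show "ptime d A (\<lambda>z. if f (fst z) (snd (snd z)) then snd (snd z) # fst (snd z) else fst (snd z))"
      by (intro ptime_intros) simp
  qed ((intro ptime_intros l)+, auto dest: esize_mem)
  moreover have "foldl (\<lambda>ys y. if f x y then y # ys else ys) zs xs = rev (filter (f x) xs) @ zs" for xs zs x
    by (induction xs arbitrary: zs) auto
  ultimately show ?thesis by (simp add: rev_filter)
qed

lemma ptime_concat [ptime_intros]:
  assumes l: "ptime d A l" shows "ptime d A (\<lambda>x. concat (l x))"
proof -
  have "ptime d A (\<lambda>x. foldl (@) [] (l x))"
    by (rule ptime_foldl[where G = "\<lambda>x. esize (l x)"],
      (intro ptime_intros pbounded_intros ptime_esize[OF l] l)+) (auto simp: esize_append dest: esize_mem)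
  moreover have "foldl (@) zs xs = zs @ concat xs" for xs and zs :: "'b list"
    by (induction xs arbitrary: zs) auto
  ultimately show ?thesis by simp
qed

lemma ptime_list_all [ptime_intros]:
  assumes f: "ptime d A (\<lambda>z. f (fst z) (snd z))" and l: "ptime d A l"
  shows "ptime d A (\<lambda>x. \<forall>a \<in> set (l x). f x a)"
proof -
  have "ptime d A (\<lambda>x. filter (\<lambda>a. \<not> f x a) (l x) = [])" by (intro ptime_intros f l)
  then show ?thesis by (simp add: filter_empty_conv)
qed

lemma ptime_length [ptime_intros]:
  assumes l: "ptime d A l" shows "ptime d A (\<lambda>x. length (l x))"
proof -
  have "ptime d A (\<lambda>x. foldl (\<lambda>n _. Suc n) 0 (l x))"
    by (rule ptime_foldl[where G = "\<lambda>x. 1"], (intro ptime_intros l pbounded_const)+) simp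
  moreover have "foldl (\<lambda>n _. Suc n) m xs = m + length xs" for m and xs :: "'b list"
    by (induction xs arbitrary: m) auto
  ultimately show ?thesis by simp
qed

lemma ptime_units: "ptime d A n \<Longrightarrow> ptime d A (\<lambda>x. replicate (n x) ())"
  by (erule ptime_recode) (rule enc_replicate_unit)

lemma foldl_replicate: "foldl (\<lambda>a _. f a) b (replicate n u) = (f ^^ n) b"
  by (induction n arbitrary: b) (auto simp: funpow_swap1)

text \<open>A unary number has the tree of a list of units, so iteration is a fold over that
  list.\<close>

lemma ptime_funpow_bounded:
  fixes f :: "'a::encodable \<Rightarrow> 'b::encodable \<Rightarrow> 'b"
  assumes f: "ptime d A (\<lambda>z. f (fst z) (snd z))" and n: "ptime d A n" and i: "ptime d A i"
    and B: "pbounded B" and bound: "\<And>x k. k \<le> n x \<Longrightarrow> esize ((f x ^^ k) (i x)) \<le> B x"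
  shows "ptime d A (\<lambda>x. (f x ^^ n x) (i x))"
proof -
  have "ptime d A (\<lambda>x. foldl (\<lambda>a _. f x a) (i x) (replicate (n x) ()))"
  proof (rule ptime_foldl_bounded[OF _ ptime_units[OF n] i B])
    have "ptime d A (\<lambda>z::'a \<times> 'b \<times> unit. f (fst (fst z, fst (snd z))) (snd (fst z, fst (snd z))))"
      by (rule ptime_comp[OF f]) (intro ptime_intros)
    then show "ptime d A (\<lambda>z::'a \<times> 'b \<times> unit. f (fst z) (fst (snd z)))" by simp
    fix x and ys zs :: "unit list" assume e: "replicate (n x) () = ys @ zs"
    then have "ys = replicate (length ys) ()" by (metis replicate_eqI unit.exhaust)
    moreover have "length ys \<le> n x" using arg_cong[OF e, of length] by simp
    ultimately show "esize (foldl (\<lambda>a _. f x a) (i x) ys) \<le> B x"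
      using bound foldl_replicate by metis
  qed
  then show ?thesis by (simp add: foldl_replicate)
qed

lemma ptime_funpow:
  fixes f :: "'a::encodable \<Rightarrow> 'b::encodable \<Rightarrow> 'b"
  assumes f: "ptime d A (\<lambda>z. f (fst z) (snd z))" and n: "ptime d A n" and i: "ptime d A i"
    and G: "pbounded G" and growth: "\<And>x b. esize (f x b) \<le> esize b + G x"
  shows "ptime d A (\<lambda>x. (f x ^^ n x) (i x))"
proof (rule ptime_funpow_bounded[OF f n i])
  show "pbounded (\<lambda>x. esize (i x) + n x * G x)"
    using ptime_esize[OF n] by (intro pbounded_intros ptime_esize[OF i] G) simp
  have "esize ((f x ^^ k) b) \<le> esize b + k * G x" for x k b
  proof (induction k)
    case (Suc k)
    have "esize ((f x ^^ Suc k) b) \<le> esize ((f x ^^ k) b) + G x" using growth by simp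
    then show ?case using Suc by simp
  qed simp
  then show "k \<le> n x \<Longrightarrow> esize ((f x ^^ k) (i x)) \<le> esize (i x) + n x * G x" for x k
    by (meson add_left_mono le_trans mult_right_mono zero_le)
qed

lemma ptime_drop [ptime_intros]:
  assumes n: "ptime d A n" and l: "ptime d A l" shows "ptime d A (\<lambda>x. drop (n x) (l x))"
proof -
  have "esize (tl b) \<le> esize b" for b :: "'b list" by (cases b) auto
  then have "ptime d A (\<lambda>x. (tl ^^ n x) (l x))"
    by (intro ptime_funpow[where G = "\<lambda>_. 0"] n l pbounded_const ptime_intros) simp
  moreover have "(tl ^^ k) xs = drop k xs" for k and xs :: "'b list"
    by (induction k arbitrary: xs) (auto simp: funpow_swap1 drop_Suc simp del: funpow.simps(2) simp add: funpow_Suc_right)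
  ultimately show ?thesis by simp
qed

lemma ptime_diff [ptime_intros]:
  assumes "ptime d A m" and "ptime d A n" shows "ptime d A (\<lambda>x. m x - n x :: nat)"
proof -
  have "ptime d A (\<lambda>x. ((\<lambda>a. a - Suc 0) ^^ n x) (m x))"
    by (intro ptime_funpow[where G = "\<lambda>_. 0"] assms pbounded_const ptime_intros ptime_pred) simp
  moreover have "((\<lambda>a. a - Suc 0) ^^ k) m = m - k" for k m :: nat
    by (induction k) auto
  ultimately show ?thesis by simp
qed

lemma ptime_add [ptime_intros]:
  assumes "ptime d A m" and "ptime d A n" shows "ptime d A (\<lambda>x. m x + n x :: nat)"
proof -
  have "ptime d A (\<lambda>x. (Suc ^^ n x) (m x))"
    by (intro ptime_funpow[where G = "\<lambda>_. 1"] assms pbounded_const ptime_intros) simp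
  moreover have "(Suc ^^ k) m = m + k" for k m :: nat by (induction k) auto
  ultimately show ?thesis by (simp only:)
qed

lemma ptime_mult [ptime_intros]:
  assumes m: "ptime d A m" and n: "ptime d A n" shows "ptime d A (\<lambda>x. m x * n x :: nat)"
proof -
  have "ptime d A (\<lambda>x. ((\<lambda>a. a + m x) ^^ n x) 0)"
  proof (rule ptime_funpow[where G = m])
    show "pbounded m" using ptime_esize[OF m] by simp
    show "esize (b + m x) \<le> esize b + m x" for x b by simp
    show "ptime d A (\<lambda>z. snd z + m (fst z))" by (intro ptime_intros ptime_comp[OF m])
  qed (intro ptime_intros n)+
  moreover have "((\<lambda>a. a + m) ^^ k) 0 = m * k" for k m :: nat by (induction k) auto
  ultimately show ?thesis by simp
qed

lemma ptime_le [ptime_intros]: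
  "ptime d A m \<Longrightarrow> ptime d A n \<Longrightarrow> ptime d A (\<lambda>x. m x \<le> (n x :: nat))"
  using ptime_zero[OF ptime_diff, of d A m n] by simp

lemma ptime_less [ptime_intros]:
  "ptime d A m \<Longrightarrow> ptime d A n \<Longrightarrow> ptime d A (\<lambda>x. m x < (n x :: nat))"
  unfolding not_le[symmetric] by (intro ptime_intros)

lemma ptime_nat_eq [ptime_intros]:
  "ptime d A m \<Longrightarrow> ptime d A n \<Longrightarrow> ptime d A (\<lambda>x. m x = (n x :: nat))"
  unfolding eq_iff by (intro ptime_intros)

lemma ptime_take [ptime_intros]:
  assumes n: "ptime d A n" and l: "ptime d A l" shows "ptime d A (\<lambda>x. take (n x) (l x))"
proof -
  have "ptime d A (\<lambda>x. rev (drop (length (l x) - n x) (rev (l x))))" by (intro ptime_intros n l)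
  moreover have "rev (drop (length xs - k) (rev xs)) = take k xs" for xs :: "'b list" and k
    by (cases "k \<le> length xs") (simp_all add: drop_rev)
  ultimately show ?thesis by simp
qed

lemma ptime_zip [ptime_intros]:
  fixes f :: "'a::encodable \<Rightarrow> 'b::encodable list" and g :: "'a \<Rightarrow> 'c::encodable list"
  assumes f: "ptime d A f" and g: "ptime d A g"
  shows "ptime d A (\<lambda>x. zip (f x) (g x))"
proof (rule ptime_recode)
  \<comment> \<open>The fold runs over the first list and consumes the second. Heads of the second
    list are kept as raw trees since an arbitrary type \<open>'c\<close> offers no default
    element.\<close>
  define S ::"'c list \<times> ('b \<times> btree) list \<Rightarrow> 'b \<Rightarrow> 'c list \<times> ('b \<times> btree) list" where
    "S b a = (if fst b = [] then b else (tl (fst b), (a, first (enc (fst b))) # snd b))" for b a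
  have "ptime d A (\<lambda>x. foldl S (g x, []) (f x))"
  proof (rule ptime_foldl[where G = "\<lambda>x. esize (f x) + 3"])
    show "ptime d A (\<lambda>z::'a \<times> _ \<times> _. S (fst (snd z)) (snd (snd z)))"
      unfolding S_def by (intro ptime_intros ptime_first)
    show "esize (S b a) \<le> esize b + (esize (f x) + 3)" if "a \<in> set (f x)" for x b a
      using esize_mem[OF that] by (cases b; cases "fst b") (auto simp: S_def)
  qed (intro ptime_intros f g pbounded_intros ptime_esize[OF f])+
  then show "ptime d A (\<lambda>x. rev (snd (foldl S (g x, []) (f x))))" by (intro ptime_intros)
  have "snd (foldl S (ys, out) xs) = rev (map (\<lambda>(a, b). (a, enc b)) (zip xs ys)) @ out" for xs ys out
  proof (induction xs arbitrary: ys out)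
    case (Cons a xs)
    have "foldl S ([], zs) as = ([], zs)" for zs as by (induction as) (auto simp: S_def)
    then show ?case by (cases ys) (use Cons in \<open>auto simp: S_def\<close>)
  qed simp
  moreover have "enc (map (\<lambda>(a, b). (a, enc b)) l) = enc l" for l :: "('b \<times> 'c) list"
    by (induction l) auto
  ultimately show "enc (zip (f x) (g x)) = enc (rev (snd (foldl S (g x, []) (f x))))" for x by simp
qed

section \<open>The learner as a function with oracle\<close>

abbreviation "hd_bit \<equiv> hd_default False"

definition nth_bit :: "bool list \<Rightarrow> nat \<Rightarrow> bool" where
  "nth_bit xs k = hd_bit (drop k xs)"

definition token_step :: "bool list \<Rightarrow> bool list \<Rightarrow> nat \<times> nat \<Rightarrow> bool list" where
  "token_step a st t =
    (if fst t = 0 then (snd t \<noteq> 0) # st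
     else if fst t = 1 then nth_bit a (snd t) # st
     else if fst t = 2 then (\<not> hd_bit st) # tl st
     else if fst t = 3 then (hd_bit st \<and> hd_bit (tl st)) # tl (tl st)
     else (hd_bit st \<or> hd_bit (tl st)) # tl (tl st))"

text \<open>Prefix notation read from the right: the operands are on the stack when their connective
  arrives. The defaults give a value to malformed lists too, which occur because the oracle's
  language ranges over all trees.\<close>

definition eval_tokens :: "(nat \<times> nat) list \<Rightarrow> bool list \<Rightarrow> bool" where
  "eval_tokens tk a = hd_bit (foldl (token_step a) [] (rev tk))"

text \<open>A position hidden by its flag contributes two \<open>False\<close> literals, so the
  positions of all others do not shift. The two constants in front stand in for circuit inputs that
  do not occur in the formula.\<close>

definition literals :: "bool list \<Rightarrow> bool list \<Rightarrow> bool list" where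
  "literals pre a = True # False # concat (map (\<lambda>z. [fst z \<and> snd z, fst z \<and> \<not> snd z]) (zip pre a))"

text \<open>A hypothesis is a bit string, consumed from left to right. Each mask has one bit for every
  current literal; the conjunction of the selected literals and its negation become new literals
  in front of the others. Likewise every row of a hash function consumes a constant bit and one bit for every
  bit of the hashed string.\<close>

definition read_mask :: "bool list \<Rightarrow> bool list \<Rightarrow> bool \<times> bool list" where
  "read_mask ls w = foldl (\<lambda>s l. (fst s \<and> (hd_bit (snd s) \<longrightarrow> l), tl (snd s))) (True, w) ls"

definition hyp_step :: "bool list \<times> bool list \<Rightarrow> bool list \<times> bool list" where
  "hyp_step s = (let r = read_mask (fst s) (snd s) in (fst r # (\<not> fst r) # fst s, snd r))"

definition hyp_value :: "nat \<Rightarrow> bool list \<Rightarrow> bool list \<Rightarrow> bool" where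
  "hyp_value g ls w = hd_bit (fst ((hyp_step ^^ g) (ls, w)))"

definition read_row :: "bool list \<Rightarrow> bool list \<Rightarrow> bool \<times> bool list" where
  "read_row w u = foldl (\<lambda>s b. (fst s \<noteq> (b \<and> hd_bit (snd s)), tl (snd s))) (hd_bit u, tl u) w"

definition cell_step :: "bool list \<Rightarrow> bool \<times> bool list \<Rightarrow> bool \<times> bool list" where
  "cell_step w s = (let r = read_row w (snd s) in (fst s \<and> \<not> fst r, snd r))"

definition in_cell :: "nat \<Rightarrow> bool list \<Rightarrow> bool list \<Rightarrow> bool" where
  "in_cell j u w = fst ((cell_step w ^^ j) (True, u))"

definition majority :: "bool list \<Rightarrow> bool" where
  "majority bs \<longleftrightarrow> length (filter Not bs) < length (filter (\<lambda>b. b) bs)"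

type_synonym config = "(nat \<times> nat) list \<times> nat \<times> bool list \<times> nat"
abbreviation target_index :: "config \<Rightarrow> nat" where "target_index cfg \<equiv> fst (snd cfg)"
abbreviation input_flags :: "config \<Rightarrow> bool list" where "input_flags cfg \<equiv> fst (snd (snd cfg))"
abbreviation num_masks :: "config \<Rightarrow> nat" where "num_masks cfg \<equiv> snd (snd (snd cfg))"

type_synonym problem = "bool \<times> nat \<times> config \<times> bool list list \<times> nat \<times> bool list"

definition consistent :: "config \<Rightarrow> bool list \<Rightarrow> bool list \<Rightarrow> bool" where
  "consistent cfg w a \<longleftrightarrow>
    hyp_value (num_masks cfg) (literals (input_flags cfg) a) w = nth_bit a (target_index cfg)"

definition counterexample :: "config \<Rightarrow> bool list list \<Rightarrow> bool list \<Rightarrow> bool" where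
  "counterexample cfg ws a \<longleftrightarrow> eval_tokens (fst cfg) a \<and>
    majority (map (hyp_value (num_masks cfg) (literals (input_flags cfg) a)) ws) \<noteq> nth_bit a (target_index cfg)"

text \<open>A problem asks either for a counterexample to the majority of the given hypotheses or for a
  hypothesis in a hash cell that is consistent with the given examples.\<close>

definition solution :: "problem \<Rightarrow> bool list \<Rightarrow> bool" where
  "solution p l \<longleftrightarrow> length l = fst (snd p) \<and>
    (if fst p then counterexample (fst (snd (snd p))) (fst (snd (snd (snd p)))) l
     else (\<forall>a \<in> set (fst (snd (snd (snd p)))). consistent (fst (snd (snd p))) l a) \<and>
       in_cell (fst (snd (snd (snd (snd p))))) (snd (snd (snd (snd (snd p))))) l)"

section \<open>Total decoders, as a language in NP has to classify every tree\<close>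

primrec spine :: "btree \<Rightarrow> btree list" where
  "spine Tip = []"
| "spine (Fork l r) = l # spine r"

definition dec_bool :: "btree \<Rightarrow> bool" where "dec_bool t \<longleftrightarrow> t \<noteq> Tip"
definition dec_nat :: "btree \<Rightarrow> nat" where "dec_nat t = length (spine t)"
definition dec_list :: "(btree \<Rightarrow> 'a) \<Rightarrow> btree \<Rightarrow> 'a list" where "dec_list f t = map f (spine t)"
definition dec_pair :: "(btree \<Rightarrow> 'a) \<Rightarrow> (btree \<Rightarrow> 'b) \<Rightarrow> btree \<Rightarrow> 'a \<times> 'b" where
  "dec_pair f g t = (f (first t), g (second t))"

abbreviation "dec_bits \<equiv> dec_list dec_bool"

definition dec_config :: "btree \<Rightarrow> config" where
  "dec_config = dec_pair (dec_list (dec_pair dec_nat dec_nat)) (dec_pair dec_nat (dec_pair dec_bits dec_nat))"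

definition dec_problem :: "btree \<Rightarrow> problem" where
  "dec_problem = dec_pair dec_bool (dec_pair dec_nat (dec_pair dec_config
    (dec_pair (dec_list dec_bits) (dec_pair dec_nat dec_bits))))"

lemma dec_enc [simp]: "dec_bool (enc b) = b" "dec_nat (enc n) = n"
  by (simp add: dec_bool_def) (induction n, auto simp: dec_nat_def)

lemma dec_list_enc: "(\<And>x. f (enc x) = x) \<Longrightarrow> dec_list f (enc xs) = xs"
  by (induction xs) (auto simp: dec_list_def)

lemma dec_bits_enc [simp]: "dec_bits (enc xs) = xs"
  by (rule dec_list_enc) simp

lemma dec_config_enc: "dec_config (enc x) = x"
proof -
  have "dec_list (dec_pair dec_nat dec_nat) (enc xs) = xs" for xs :: "(nat \<times> nat) list"
    by (rule dec_list_enc) (auto simp: dec_pair_def)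
  then show ?thesis by (cases x) (simp add: dec_config_def dec_pair_def)
qed

lemma dec_problem_enc [simp]: "dec_problem (enc x) = x"
proof -
  have "dec_list dec_bits (enc xs) = xs" for xs :: "bool list list"
    by (rule dec_list_enc) simp
  then show ?thesis by (cases x) (simp add: dec_problem_def dec_pair_def dec_config_enc)
qed

lemma ptime_spine [ptime_intros]: "ptime d A f \<Longrightarrow> ptime d A (\<lambda>x. spine (f x))"
proof (erule ptime_recode)
  have "enc (spine t) = t" for t by (induction t) auto
  then show "enc (spine (f x)) = enc (f x)" for x by simp
qed

lemma ptime_first' [ptime_intros]: "ptime d A f \<Longrightarrow> ptime d A (\<lambda>x. first (f x))"
  using ptime_first[of d A f] by simp

lemma ptime_second' [ptime_intros]: "ptime d A f \<Longrightarrow> ptime d A (\<lambda>x. second (f x))"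
  using ptime_second[of d A f] by simp

lemma ptime_dec_bool [ptime_intros]: "ptime d A f \<Longrightarrow> ptime d A (\<lambda>x. dec_bool (f x))"
  using ptime_not_Tip[of d A f] by (simp add: dec_bool_def)

lemma ptime_dec_nat [ptime_intros]: "ptime d A f \<Longrightarrow> ptime d A (\<lambda>x. dec_nat (f x))"
  unfolding dec_nat_def by (intro ptime_intros)

lemma ptime_dec_bits [ptime_intros]: "ptime d A f \<Longrightarrow> ptime d A (\<lambda>x. dec_bits (f x))"
  unfolding dec_list_def by (intro ptime_intros)

lemma ptime_dec_problem [ptime_intros]: "ptime d A f \<Longrightarrow> ptime d A (\<lambda>x. dec_problem (f x))"
  unfolding dec_problem_def dec_config_def dec_pair_def dec_list_def[of dec_bits]
    dec_list_def[of "\<lambda>t. (dec_nat (first t), dec_nat (second t))"]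
  by (intro ptime_intros)

section \<open>Polynomial time of the verifier\<close>

lemma ptime_nth_bit [ptime_intros]: "ptime d A f \<Longrightarrow> ptime d A n \<Longrightarrow> ptime d A (\<lambda>x. nth_bit (f x) (n x))"
  unfolding nth_bit_def by (intro ptime_intros)

lemma esize_bool_add: "n \<le> m \<Longrightarrow> esize (b::bool) + n \<le> Suc m"
  using add_mono[OF esize_bool, of n m b] by simp

lemma esize_bits: "esize (xs :: bool list) \<le> 2 * length xs"
  by (induction xs) (auto intro: esize_bool_add)

lemma esize_tl: "esize (tl xs) \<le> esize xs"
  by (cases xs) auto

lemma ptime_eval_tokens [ptime_intros]:
  assumes "ptime d A tk" "ptime d A a" shows "ptime d A (\<lambda>x. eval_tokens (tk x) (a x))"
proof -
  have "ptime d A (\<lambda>x. foldl (token_step (a x)) [] (rev (tk x)))"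
  proof (rule ptime_foldl[where G = "\<lambda>_. 2"])
    show "ptime d A (\<lambda>z. token_step (a (fst z)) (fst (snd z)) (snd (snd z)))"
      unfolding token_step_def by (intro ptime_intros ptime_comp[OF assms(2)])
    show "esize (token_step (a x) st t) \<le> esize st + 2" for x st t
      using esize_tl[of st] esize_tl[of "tl st"]
      by (auto simp: token_step_def intro!: esize_bool_add esize_bool[unfolded One_nat_def])
  qed (intro ptime_intros assms pbounded_const)+
  then show ?thesis unfolding eval_tokens_def by (intro ptime_intros)
qed

lemma ptime_literals [ptime_intros]:
  "ptime d A p \<Longrightarrow> ptime d A a \<Longrightarrow> ptime d A (\<lambda>x. literals (p x) (a x))"
  unfolding literals_def by (intro ptime_intros)

lemma snd_read_mask: "snd (read_mask ls w) = drop (length ls) w"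
proof -
  have "snd (foldl (\<lambda>s l. (fst s \<and> (hd_bit (snd s) \<longrightarrow> l), tl (snd s))) (b, w) ls) = drop (length ls) w" for b
    by (induction ls arbitrary: b w) (auto simp: drop_Suc)
  then show ?thesis by (simp add: read_mask_def)
qed

lemma snd_read_row: "snd (read_row w u) = drop (Suc (length w)) u"
proof -
  have "snd (foldl (\<lambda>s b. (fst s \<noteq> (b \<and> hd_bit (snd s)), tl (snd s))) (b, u) w) = drop (length w) u" for b u
    by (induction w arbitrary: b u) (auto simp: drop_Suc)
  then show ?thesis by (simp add: read_row_def drop_Suc)
qed

lemma esize_drop: "esize (drop n xs) \<le> esize xs"
  by (metis append_take_drop_id esize_append le_add2)

lemma ptime_read_mask [ptime_intros]:
  assumes "ptime d A ls" "ptime d A w" shows "ptime d A (\<lambda>x. read_mask (ls x) (w x))"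
  unfolding read_mask_def
proof (rule ptime_foldl[where G = "\<lambda>_. 2"])
  show "esize (fst s \<and> (hd_bit (snd s) \<longrightarrow> l), tl (snd s)) \<le> esize s + 2" for s :: "bool \<times> bool list" and l
    using esize_tl[of "snd s"] esize_bool[of "fst s \<and> (hd_bit (snd s) \<longrightarrow> l)"] by (simp add: esize_prod)
qed (intro ptime_intros assms pbounded_const)+

lemma ptime_read_row [ptime_intros]:
  assumes "ptime d A u" "ptime d A w" shows "ptime d A (\<lambda>x. read_row (w x) (u x))"
  unfolding read_row_def
proof (rule ptime_foldl[where G = "\<lambda>_. 2"])
  show "esize (fst s \<noteq> (l \<and> hd_bit (snd s)), tl (snd s)) \<le> esize s + 2" for s :: "bool \<times> bool list" and l
    using esize_tl[of "snd s"] esize_bool[of "fst s \<noteq> (l \<and> hd_bit (snd s))"] by (simp add: esize_prod)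
qed (intro ptime_intros assms pbounded_const)+

lemma ptime_hyp_value [ptime_intros]:
  assumes "ptime d A g" "ptime d A ls" "ptime d A w"
  shows "ptime d A (\<lambda>x. hyp_value (g x) (ls x) (w x))"
proof -
  have "ptime d A (\<lambda>x. (hyp_step ^^ g x) (ls x, w x))"
  proof (rule ptime_funpow[where G = "\<lambda>_. 4"])
    show "ptime d A (\<lambda>z::'a \<times> _. hyp_step (snd z))"
      unfolding hyp_step_def by (intro ptime_intros)
    show "esize (hyp_step s) \<le> esize s + 4" for s
      using esize_drop[of "length (fst s)" "snd s"] esize_bool[of "fst (read_mask (fst s) (snd s))"]
        esize_bool[of "\<not> fst (read_mask (fst s) (snd s))"]
      by (simp add: hyp_step_def Let_def esize_prod snd_read_mask)
  qed (intro ptime_intros assms pbounded_const)+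
  then show ?thesis unfolding hyp_value_def by (intro ptime_intros)
qed

lemma ptime_in_cell [ptime_intros]:
  assumes "ptime d A j" "ptime d A u" "ptime d A w"
  shows "ptime d A (\<lambda>x. in_cell (j x) (u x) (w x))"
proof -
  have "ptime d A (\<lambda>x. (cell_step (w x) ^^ j x) (True, u x))"
  proof (rule ptime_funpow[where G = "\<lambda>_. 1"])
    show "ptime d A (\<lambda>z. cell_step (w (fst z)) (snd z))"
      unfolding cell_step_def by (intro ptime_intros ptime_comp[OF assms(3)])
    show "esize (cell_step (w x) s) \<le> esize s + 1" for x s
      using esize_drop[of "Suc (length (w x))" "snd s"]
        esize_bool[of "fst s \<and> \<not> fst (read_row (w x) (snd s))"]
      by (simp add: cell_step_def Let_def esize_prod snd_read_row del: drop_Suc)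
  qed (intro ptime_intros assms pbounded_const)+
  then show ?thesis unfolding in_cell_def by (intro ptime_intros)
qed

lemma ptime_solution [ptime_intros]:
  assumes "ptime d A p" "ptime d A l" shows "ptime d A (\<lambda>x. solution (p x) (l x))"
  unfolding solution_def consistent_def counterexample_def majority_def
  by (intro ptime_intros assms ptime_comp[OF assms(1)] ptime_comp[OF assms(2)])

subsection \<open>The NP oracle\<close>

text \<open>Asks whether a prefix extends to a solution, which is the form needed for bitwise
  search; one language serves both kinds of problem. The length of a solution is written in unary
  inside the problem and a bit takes at most two nodes, whence the witness bound.\<close>

definition solvable :: "btree set" where
  "solvable = {y. \<exists>w. size w \<le> 2 * size y \<and>
    solution (dec_problem (first y)) (dec_bits (second y) @ dec_bits w)}"

lemma solvable_enc: "enc (p, xs) \<in> solvable \<longleftrightarrow> (\<exists>ys. solution p (xs @ ys))"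
proof
  assume "enc (p, xs) \<in> solvable"
  then show "\<exists>ys. solution p (xs @ ys)" by (auto simp: solvable_def)
next
  assume "\<exists>ys. solution p (xs @ ys)"
  then obtain ys where ys: "solution p (xs @ ys)" ..
  then have "length ys \<le> fst (snd p)" by (auto simp: solution_def)
  also have "\<dots> \<le> esize p" by (simp add: esize_prod)
  finally have "esize ys \<le> 2 * size (enc (p, xs))" using esize_bits[of ys] by simp
  then show "enc (p, xs) \<in> solvable" using ys by (auto simp: solvable_def intro!: exI[of _ "enc ys"])
qed

text \<open>\<open>run\<close> enters at function 0, so a jump to the desired function is put in
  front. The flag \<open>d\<close> yields the absence of queries that
  \<open>polytime_decides\<close> demands.\<close>

lemma ptime_run:
  assumes "ptime d A f"
  shows "\<exists>P p. (d \<longrightarrow> list_all deterministic P) \<and>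
    (\<forall>x. \<exists>t q. run P A (enc x) = return_spmf (enc (f x), t, q) \<and> t \<le> poly p (esize x) \<and> q \<le> t \<and> (d \<longrightarrow> q = 0))"
proof -
  obtain P k p where P: "d \<longrightarrow> list_all deterministic P" "implements P A k p f"
    using assms unfolding ptime_def by blast
  let ?e = "Call (Suc k) (Var 0)"
  let ?Q = "[?e] @ map (shift_calls 1) P"
  have det: "d \<longrightarrow> list_all deterministic ?Q" using P(1) by (auto simp: list_all_iff)
  have "\<exists>t q. run ?Q A (enc x) = return_spmf (enc (f x), t, q) \<and> t \<le> poly (p + [:5:]) (esize x) \<and> q \<le> t \<and> (d \<longrightarrow> q = 0)" for x
  proof -
    obtain t q where tq: "evals P A [enc x] (P ! k) (enc (f x)) t q" "t \<le> poly p (esize x)"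
      using P(2) unfolding implements_def by blast
    have "evals ?Q A [enc x] (?Q ! Suc k) (enc (f x)) t q"
      using evals_relocate[OF tq(1), of "[?e]" "[]"] P(2) by (simp add: implements_def)
    then have "evals ?Q A [enc x] ?e (enc (f x)) (1 + t + 1) (0 + q)"
      using P(2) by (intro evals_Call[OF evals_Var0]) (auto simp: implements_def)
    then have e: "evals ?Q A [enc x] (Call 0 (Var 0)) (enc (f x)) (1 + (1 + t + 1) + 1) (0 + (0 + q))"
      by (intro evals_Call[OF evals_Var0]) auto
    have "run ?Q A (enc x) = return_spmf (enc (f x), 1 + (1 + t + 1) + 1, 0 + (0 + q))"
      unfolding run_def by (rule eval_evals[OF e])
    then show ?thesis using evals_queries_le[OF e] evals_deterministic[OF e] det tq(2)
      by (intro exI[of _ "1 + (1 + t + 1) + 1"] exI[of _ "0 + (0 + q)"]) simp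
  qed
  then show ?thesis using det by blast
qed

lemma solvable_NP: "solvable \<in> NP"
proof -
  define f where "f y = solution (dec_problem (first (first y))) (dec_bits (second (first y)) @ dec_bits (second y))" for y
  have "ptime True {} f" unfolding f_def by (intro ptime_intros)
  then obtain P p where P: "list_all deterministic P"
    "\<forall>x. \<exists>t q. run P {} (enc x) = return_spmf (enc (f x), t, q) \<and> t \<le> poly p (esize x) \<and> q = 0"
    using ptime_run[of True "{}" f] by blast
  have "polytime_decides P {y. f y}"
    unfolding polytime_decides_def using P by (intro conjI exI[of _ p]) fastforce+
  moreover have "\<forall>y. y \<in> solvable \<longleftrightarrow> (\<exists>w. size w \<le> poly [:0, 2:] (size y) \<and> Fork y w \<in> {y. f y})"
    by (auto simp: solvable_def f_def mult.commute)
  ultimately show ?thesis unfolding NP_def by blast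
qed

subsection \<open>The learning procedure\<close>

text \<open>Self-reduction with one query per bit. The result is a list of length at most one in
  place of an option, so that results can be concatenated. It is a function of the problem alone,
  without coins.\<close>

definition search :: "btree set \<Rightarrow> problem \<Rightarrow> bool list list" where
  "search A p = (if enc (p, [] :: bool list) \<in> A
     then [((\<lambda>xs. xs @ [enc (p, xs @ [True]) \<in> A]) ^^ fst (snd p)) []] else [])"

text \<open>There are two constants and two literals per position at the start, and two more after
  each mask; the bound grants every mask the final number of literals. This is the estimate of
  \<open>length_masks\<close>.\<close>

definition hyp_bits :: "config \<Rightarrow> nat" where
  "hyp_bits cfg = num_masks cfg * (2 + 2 * length (input_flags cfg) + 2 * num_masks cfg)"

text \<open>Since \<open>(31/32)^22 < 1/2\<close>, the version space would be empty after all rounds. Since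
  \<open>(7/8)^6 < 1/2\<close>, six trials halve the probability that a majority is wrong.\<close>

definition rounds :: "config \<Rightarrow> nat" where "rounds cfg = 22 * hyp_bits cfg"

definition trials :: "nat \<Rightarrow> config \<Rightarrow> nat" where
  "trials c cfg = 6 * (length (fst cfg) * (rounds cfg * (hyp_bits cfg + 1) + 1 + c) + rounds cfg)"

text \<open>The highest level has \<open>hyp_bits\<close> rows, each with a constant bit and one bit
  per bit of the hypothesis. Lower levels read a prefix.\<close>

definition trial_bits :: "config \<Rightarrow> nat" where
  "trial_bits cfg = hyp_bits cfg * (hyp_bits cfg + 1)"

definition random_bits :: "nat \<Rightarrow> config \<Rightarrow> nat" where
  "random_bits c cfg = trials c cfg * trial_bits cfg"

text \<open>The same bits \<open>u\<close> serve all levels and all rounds: only the trials within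
  one sample have to be independent, since everything else is handled by the union bound.\<close>

definition sampled_hyps :: "nat \<Rightarrow> btree set \<Rightarrow> config \<Rightarrow> bool list \<Rightarrow> bool list list \<Rightarrow> nat \<Rightarrow> bool list list" where
  "sampled_hyps c A cfg u S j = concat (map (\<lambda>i. search A (False, hyp_bits cfg, cfg, S, j,
     take (trial_bits cfg) (drop (i * trial_bits cfg) u))) [0..<trials c cfg])"

definition level_results ::
  "nat \<Rightarrow> btree set \<Rightarrow> config \<Rightarrow> bool list \<Rightarrow> bool list list \<Rightarrow> (bool list list \<times> bool list list) list" where
  "level_results c A cfg u S = map (\<lambda>j. let ws = sampled_hyps c A cfg u S j in
     (ws, search A (True, length (input_flags cfg), cfg, ws, 0, []))) [0..<hyp_bits cfg + 1]"

text \<open>Success freezes the state, so a fixed number of iterations replaces an early exit. A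
  fruitless round adds exactly one example per level, which fixes the length of the example list
  after each round.\<close>

definition round_step ::
  "nat \<Rightarrow> btree set \<Rightarrow> config \<Rightarrow> bool list \<Rightarrow> bool list list list \<times> bool list list \<Rightarrow> bool list list list \<times> bool list list" where
  "round_step c A cfg u s = (if fst s \<noteq> [] then s else
     let rs = level_results c A cfg u (snd s)
     in (map fst (filter (\<lambda>r. snd r = []) rs), concat (map snd rs) @ snd s))"

definition learn :: "nat \<Rightarrow> btree set \<Rightarrow> config \<Rightarrow> bool list \<Rightarrow> bool list list list" where
  "learn c A cfg u = fst ((round_step c A cfg u ^^ rounds cfg) ([], []))"

section \<open>Polynomial time of the learning procedure\<close>

lemma ptime_upt [ptime_intros]:
  assumes n: "ptime d A n" shows "ptime d A (\<lambda>x. [0..<n x])"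
proof -
  let ?f = "\<lambda>s :: nat \<times> nat list. (Suc (fst s), snd s @ [fst s])"
  have e: "(?f ^^ k) (0, []) = (k, [0..<k])" for k by (induction k) auto
  have "ptime d A (\<lambda>x. (?f ^^ n x) (0, []))"
  proof (rule ptime_funpow_bounded[where B = "\<lambda>x. n x + n x * (n x + 1) + 1"])
    have "pbounded n" using ptime_esize[OF n] by simp
    then show "pbounded (\<lambda>x. n x + n x * (n x + 1) + 1)" by (intro pbounded_intros)
    show "esize ((?f ^^ k) (0, [])) \<le> n x + n x * (n x + 1) + 1" if "k \<le> n x" for x k
    proof -
      have "esize [0..<k] \<le> length [0..<k] * (n x + 1)" by (rule esize_list_le) (use that in auto)
      also have "\<dots> \<le> n x * (n x + 1)" using that by (intro mult_right_mono) auto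
      finally show ?thesis using that unfolding e by simp
    qed
  qed (intro ptime_intros n)+
  then have "ptime d A (\<lambda>x. snd ((?f ^^ n x) (0, [])))" by (intro ptime_intros)
  then show ?thesis by (simp only: e snd_conv)
qed

lemma length_search: "l \<in> set (search A p) \<Longrightarrow> length l = fst (snd p)"
proof -
  have "length (((\<lambda>xs. xs @ [f xs]) ^^ n) []) = n" for f :: "bool list \<Rightarrow> bool" and n
    by (induction n) auto
  then show "l \<in> set (search A p) \<Longrightarrow> length l = fst (snd p)"
    by (simp add: search_def split: if_splits)
qed

lemma length_search_le: "length (search A p) \<le> 1"
  by (simp add: search_def)

lemma ptime_search [ptime_intros]:
  assumes p: "ptime False A p" shows "ptime False A (\<lambda>x. search A (p x))"
proof -
  have "ptime False A (\<lambda>x. ((\<lambda>xs. xs @ [enc (p x, xs @ [True]) \<in> A]) ^^ fst (snd (p x))) [])"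
  proof (rule ptime_funpow[where G = "\<lambda>_. 2"])
    show "ptime False A (\<lambda>z. snd z @ [enc (p (fst z), snd z @ [True]) \<in> A])"
      by (intro ptime_intros ptime_query ptime_comp[OF p])
    show "esize (xs @ [enc (p x, xs @ [True]) \<in> A]) \<le> esize xs + 2" for x xs
      using esize_bool[of "enc (p x, xs @ [True]) \<in> A"] by (simp add: esize_append del: enc_simps(5))
  qed (intro ptime_intros p pbounded_const)+
  then show ?thesis unfolding search_def by (intro ptime_intros ptime_query p)
qed

lemma ptime_params [ptime_intros]:
  assumes f: "ptime d A f"
  shows "ptime d A (\<lambda>x. hyp_bits (f x))" "ptime d A (\<lambda>x. rounds (f x))"
    "ptime d A (\<lambda>x. trials c (f x))" "ptime d A (\<lambda>x. trial_bits (f x))"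
    "ptime d A (\<lambda>x. random_bits c (f x))"
  unfolding random_bits_def trials_def rounds_def trial_bits_def hyp_bits_def
  by (intro ptime_intros f)+

lemma ptime_level_results [ptime_intros]:
  assumes f: "ptime False A cfg" and u: "ptime False A u" and S: "ptime False A S"
  shows "ptime False A (\<lambda>x. level_results c A (cfg x) (u x) (S x))"
  unfolding level_results_def sampled_hyps_def
  by (intro ptime_intros f S u ptime_comp[OF f] ptime_comp[OF S] ptime_comp[OF u])

lemma length_concat_le: "(\<And>x. x \<in> set xs \<Longrightarrow> length (f x) \<le> 1) \<Longrightarrow> length (concat (map f xs)) \<le> length xs"
proof (induction xs)
  case (Cons a xs)
  then have "length (f a) \<le> 1" "length (concat (map f xs)) \<le> length xs" by auto
  then show ?case by simp
qed simp

lemma esize_sampled_hyps: "esize (sampled_hyps c A cfg u S j) \<le> trials c cfg * (2 * hyp_bits cfg + 1)"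
proof -
  let ?ws = "sampled_hyps c A cfg u S j"
  have "length w = hyp_bits cfg" if "w \<in> set ?ws" for w
    using that by (auto simp: sampled_hyps_def dest!: length_search)
  then have "esize ?ws \<le> length ?ws * (2 * hyp_bits cfg + 1)"
    by (intro esize_list_le) (metis esize_bits)
  also have "\<dots> \<le> trials c cfg * (2 * hyp_bits cfg + 1)"
    unfolding sampled_hyps_def
    by (rule mult_right_mono, rule order_trans[OF length_concat_le]) (use length_search_le in auto)
  finally show ?thesis .
qed

definition level_bound :: "nat \<Rightarrow> config \<Rightarrow> nat" where
  "level_bound c cfg = (hyp_bits cfg + 1) * (trials c cfg * (2 * hyp_bits cfg + 1) +
     2 * length (input_flags cfg) + 2 + 1)"

lemma esize_search: "esize (search A p) \<le> 2 * fst (snd p) + 1"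
proof (cases "search A p")
  case (Cons l ls)
  then have "ls = []" using length_search_le[of A p] by (cases ls) auto
  then show ?thesis using Cons esize_bits[of l] length_search[of l A p] by simp
qed simp

lemma esize_level_results:
  "esize (map fst (filter P (level_results c A cfg u S))) \<le> level_bound c cfg"
  "esize (concat (map snd (level_results c A cfg u S))) \<le> level_bound c cfg"
proof -
  let ?rs = "level_results c A cfg u S"
  let ?B = "trials c cfg * (2 * hyp_bits cfg + 1) + 2 * length (input_flags cfg) + 2"
  have r: "esize (fst r) \<le> ?B" "esize (snd r) \<le> ?B" if mem: "r \<in> set ?rs" for r
  proof -
    obtain j where j: "r = (sampled_hyps c A cfg u S j, search A (True, length (input_flags cfg), cfg,
        sampled_hyps c A cfg u S j, 0, []))"
      using mem unfolding level_results_def Let_def set_map by blast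
    show "esize (fst r) \<le> ?B" unfolding j fst_conv
      using esize_sampled_hyps[of c A cfg u S j] by linarith
    show "esize (snd r) \<le> ?B" unfolding j snd_conv
      by (rule order_trans[OF esize_search]) simp
  qed
  have "esize (map fst (filter P ?rs)) \<le> length (map fst (filter P ?rs)) * (?B + 1)"
    by (rule esize_list_le) (use r in auto)
  also have "\<dots> \<le> (hyp_bits cfg + 1) * (?B + 1)"
    by (rule mult_right_mono) (use length_filter_le[of P ?rs] in \<open>auto simp: level_results_def\<close>)
  finally show "esize (map fst (filter P ?rs)) \<le> level_bound c cfg" unfolding level_bound_def .
  have "esize (concat (map snd rs)) \<le> length rs * (?B + 1)" if "set rs \<subseteq> set ?rs" for rs
    using that
  proof (induction rs)
    case (Cons r rs)
    then show ?case using r(2)[of r] by (simp add: esize_append)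
  qed simp
  from this[of ?rs] have "esize (concat (map snd ?rs)) \<le> length ?rs * (?B + 1)" by simp
  also have "length ?rs = hyp_bits cfg + 1" by (simp add: level_results_def)
  finally show "esize (concat (map snd ?rs)) \<le> level_bound c cfg" unfolding level_bound_def .
qed

lemma ptime_learn [ptime_intros]:
  assumes f: "ptime False A cfg" and u: "ptime False A u"
  shows "ptime False A (\<lambda>x. learn c A (cfg x) (u x))"
proof -
  have "ptime False A (\<lambda>x. (round_step c A (cfg x) (u x) ^^ rounds (cfg x)) ([], []))"
  \<comment> \<open>A round adds at most the hypotheses and the counterexamples of all levels. Both
    are bounded in terms of the configuration, independently of the examples collected so
    far.\<close>
  proof (rule ptime_funpow[where G = "\<lambda>x. 2 * level_bound c (cfg x)"])
    show "ptime False A (\<lambda>z. round_step c A (cfg (fst z)) (u (fst z)) (snd z))"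
      unfolding round_step_def by (intro ptime_intros ptime_comp[OF f] ptime_comp[OF u])
    have "ptime False A (\<lambda>x. 2 * level_bound c (cfg x))"
      unfolding level_bound_def by (intro ptime_intros f)
    from ptime_esize[OF this] show "pbounded (\<lambda>x. 2 * level_bound c (cfg x))" by simp
    show "esize (round_step c A (cfg x) (u x) s) \<le> esize s + 2 * level_bound c (cfg x)" for x s
      using esize_level_results(1)[of "\<lambda>r. snd r = []" c A "cfg x" "u x" "snd s"]
        esize_level_results(2)[of c A "cfg x" "u x" "snd s"]
      by (simp add: round_step_def Let_def esize_prod esize_append)
  qed (intro ptime_intros f)+
  then show ?thesis unfolding learn_def by (intro ptime_intros)
qed

section \<open>Averages over bit strings\<close>

definition bit_lists :: "nat \<Rightarrow> bool list set" where "bit_lists n = {u. length u = n}"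

text \<open>Expectation over uniform bit strings as a finite sum, which keeps the analysis of the
  sampling free of measure theory; \<open>measure_bind_spmf_of_set\<close> makes the link to
  programs.\<close>

definition avg :: "nat \<Rightarrow> (bool list \<Rightarrow> real) \<Rightarrow> real" where
  "avg n f = (\<Sum>u\<in>bit_lists n. f u) / 2 ^ n"

lemma finite_bit_lists [simp]: "finite (bit_lists n)"
  using finite_lists_length_eq[of "UNIV :: bool set" n] by (simp add: bit_lists_def)

lemma card_bit_lists [simp]: "card (bit_lists n) = 2 ^ n"
  using card_lists_length_eq[of "UNIV :: bool set" n] by (simp add: bit_lists_def)

lemma avg_const [simp]: "avg n (\<lambda>_. c) = c"
  by (simp add: avg_def)

lemma avg_mono: "(\<And>u. length u = n \<Longrightarrow> f u \<le> g u) \<Longrightarrow> avg n f \<le> avg n g"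
  unfolding avg_def by (intro divide_right_mono sum_mono) (auto simp: bit_lists_def)

lemma avg_cong: "(\<And>u. length u = n \<Longrightarrow> f u = g u) \<Longrightarrow> avg n f = avg n g"
  unfolding avg_def by (rule arg_cong2[where f = "(/)"], rule sum.cong) (auto simp: bit_lists_def)

lemma avg_add: "avg n (\<lambda>u. f u + g u) = avg n f + avg n g"
  by (simp add: avg_def sum.distrib add_divide_distrib)

lemma avg_diff: "avg n (\<lambda>u. f u - g u) = avg n f - avg n g"
  by (simp add: avg_def sum_subtractf diff_divide_distrib)

lemma avg_cmult: "avg n (\<lambda>u. c * f u) = c * avg n f"
  by (simp add: avg_def sum_distrib_left)

lemma avg_sum: "avg n (\<lambda>u. \<Sum>x\<in>I. f x u) = (\<Sum>x\<in>I. avg n (f x))"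
  unfolding avg_def sum_divide_distrib by (rule sum.swap)

lemma avg_split: "avg (m + n) f = avg m (\<lambda>x. avg n (\<lambda>y. f (x @ y)))"
proof -
  have "bij_betw (\<lambda>(x, y). x @ y) (bit_lists m \<times> bit_lists n) (bit_lists (m + n))"
    by (rule bij_betw_byWitness[where f' = "\<lambda>u. (take m u, drop m u)"]) (auto simp: bit_lists_def)
  then have "(\<Sum>u\<in>bit_lists (m + n). f u) = (\<Sum>(x, y)\<in>bit_lists m \<times> bit_lists n. f (x @ y))"
    by (simp add: sum.reindex_bij_betw[symmetric] case_prod_unfold)
  then show ?thesis
    by (simp add: avg_def sum.cartesian_product[symmetric] sum_divide_distrib[symmetric] power_add mult.commute)
qed

lemma avg_Suc: "avg (Suc n) f = (avg n (\<lambda>u. f (True # u)) + avg n (\<lambda>u. f (False # u))) / 2"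
proof -
  have "bit_lists (Suc 0) = {[True], [False]}" by (auto simp: bit_lists_def length_Suc_conv)
  then show ?thesis using avg_split[of "Suc 0" n f] by (simp add: avg_def[of "Suc 0"])
qed

lemma avg_ex_le:
  "finite I \<Longrightarrow> avg n (\<lambda>u. of_bool (\<exists>x\<in>I. P x u)) \<le> (\<Sum>x\<in>I. avg n (\<lambda>u. of_bool (P x u)))"
proof -
  assume fin: "finite I"
  have "of_bool (\<exists>x\<in>I. P x u) \<le> (\<Sum>x\<in>I. of_bool (P x u) :: real)" for u
  proof (cases "\<exists>x\<in>I. P x u")
    case True
    then obtain x where x: "x \<in> I" "P x u" by blast
    have "of_bool (P x u) \<le> (\<Sum>x\<in>I. of_bool (P x u) :: real)"
      by (rule member_le_sum) (use x fin in auto)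
    then show ?thesis using x True by simp
  qed (simp add: sum_nonneg)
  then show ?thesis unfolding avg_sum[symmetric] by (rule avg_mono)
qed

text \<open>Disjoint blocks of a uniform string are independent, so the expectation of the product
  factors.\<close>

lemma avg_prod_chunks:
  "avg (t * m) (\<lambda>u. \<Prod>i<t. f (take m (drop (i * m) u))) = avg m f ^ t"
proof (induction t)
  case (Suc t)
  have "avg (Suc t * m) (\<lambda>u. \<Prod>i<Suc t. f (take m (drop (i * m) u))) =
    avg m (\<lambda>x. avg (t * m) (\<lambda>y. \<Prod>i<Suc t. f (take m (drop (i * m) (x @ y)))))"
    using avg_split[of m "t * m"] by simp
  also have "\<dots> = avg m (\<lambda>x. avg (t * m) (\<lambda>y. f x * (\<Prod>i<t. f (take m (drop (i * m) y)))))"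
    by (intro avg_cong) (simp add: prod.lessThan_Suc_shift del: prod.lessThan_Suc)
  also have "\<dots> = avg m (\<lambda>x. avg m f ^ t * f x)"
    by (simp only: avg_cmult Suc.IH mult.commute[of _ "avg m f ^ t"])
  finally show ?case by (simp add: avg_cmult)
qed simp

section \<open>Hash cells\<close>

text \<open>The inner product over GF(2).\<close>

primrec dot :: "bool list \<Rightarrow> bool list \<Rightarrow> bool" where
  "dot [] r = False"
| "dot (x # w) r = ((x \<and> hd_bit r) \<noteq> dot w (tl r))"

lemma fst_read_row: "fst (read_row w u) = (hd_bit u \<noteq> dot w (tl u))"
proof -
  have "fst (foldl (\<lambda>s b. (fst s \<noteq> (b \<and> hd_bit (snd s)), tl (snd s))) (b, r) w) = (b \<noteq> dot w r)" for b r
    by (induction w arbitrary: b r) auto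
  then show ?thesis by (simp add: read_row_def)
qed

lemma dot_append: "length r = length w \<Longrightarrow> dot w (r @ r') = dot w r"
  by (induction r w rule: list_induct2) auto

lemma fst_cell_steps: "fst ((cell_step w ^^ j) s) \<longleftrightarrow> fst s \<and> in_cell j (snd s) w"
proof (induction j arbitrary: s)
  case (Suc j)
  show ?case
    unfolding in_cell_def[of "Suc j"] funpow_Suc_right o_apply Suc by (auto simp: cell_step_def Let_def)
qed (simp add: in_cell_def)

lemma in_cell_Suc: "in_cell (Suc j) u w \<longleftrightarrow>
  \<not> fst (read_row w u) \<and> in_cell j (drop (Suc (length w)) u) w"
  unfolding in_cell_def[of "Suc j"] funpow_Suc_right o_apply fst_cell_steps
  by (simp add: cell_step_def Let_def snd_read_row del: drop_Suc)

lemma in_cell_0 [simp]: "in_cell 0 u w" by (simp add: in_cell_def)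

text \<open>At a position where the strings differ, the random bit enters exactly one of the two
  inner products and so flips the comparison.\<close>

lemma avg_dot_eq:
  "length w = n \<Longrightarrow> length w' = n \<Longrightarrow> w \<noteq> w' \<Longrightarrow> avg n (\<lambda>r. of_bool (dot w r = dot w' r)) = 1 / 2"
proof (induction n arbitrary: w w')
  case (Suc n)
  then obtain x v y v' where w: "w = x # v" "w' = y # v'" "length v = n" "length v' = n"
    by (auto simp: length_Suc_conv)
  show ?case
  proof (cases "x = y")
    case True
    then show ?thesis using w Suc.prems Suc.IH[of v v'] by (cases x) (simp_all add: avg_Suc)
  next
    case False
    have "of_bool (dot v u = dot v' u) + of_bool ((\<not> dot v u) = dot v' u) = (1 :: real)"
      "of_bool (dot v u = dot v' u) + of_bool (dot v u = (\<not> dot v' u)) = (1 :: real)" for u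
      by (cases "dot v u"; cases "dot v' u"; simp)+
    then have "avg n (\<lambda>u. of_bool (dot v u = dot v' u)) + avg n (\<lambda>u. of_bool ((\<not> dot v u) = dot v' u)) = 1"
      "avg n (\<lambda>u. of_bool (dot v u = dot v' u)) + avg n (\<lambda>u. of_bool (dot v u = (\<not> dot v' u))) = 1"
      unfolding avg_add[symmetric] by simp_all
    then show ?thesis using w False by (cases x; cases y) (simp_all add: avg_Suc)
  qed
qed simp

lemma avg_row: "length w = n \<Longrightarrow> avg (Suc n) (\<lambda>u. of_bool (\<not> fst (read_row w u))) = 1 / 2"
proof -
  have "of_bool (dot w u) + of_bool (\<not> dot w u) = (1 :: real)" for u by simp
  then have "avg n (\<lambda>u. of_bool (dot w u)) + avg n (\<lambda>u. of_bool (\<not> dot w u)) = 1"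
    unfolding avg_add[symmetric] by simp
  then show ?thesis by (simp add: avg_Suc fst_read_row)
qed

text \<open>Both rows vanish iff both inner products equal the shared constant bit: they agree with
  probability 1/2, and the constant bit then matches with probability 1/2. Without this bit the zero
  string would lie in every cell.\<close>

lemma avg_row_pair:
  assumes "length w = n" "length w' = n" "w \<noteq> w'"
  shows "avg (Suc n) (\<lambda>u. of_bool (\<not> fst (read_row w u) \<and> \<not> fst (read_row w' u))) = 1 / 4"
proof -
  have "of_bool (dot w u \<and> dot w' u) + of_bool (\<not> dot w u \<and> \<not> dot w' u) = (of_bool (dot w u = dot w' u) :: real)"
    for u by simp
  then have "avg n (\<lambda>u. of_bool (dot w u \<and> dot w' u)) + avg n (\<lambda>u. of_bool (\<not> dot w u \<and> \<not> dot w' u)) = 1 / 2"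
    unfolding avg_add[symmetric] using avg_dot_eq[OF assms] by simp
  then show ?thesis by (simp add: avg_Suc fst_read_row)
qed

text \<open>Successive rows are independent. The test \<open>Q\<close> is abstract so that
  membership of one string and joint membership of two share this induction; surplus bits beyond the
  \<open>j\<close> rows are allowed because all levels use strings of one length.\<close>

lemma avg_rows:
  assumes C: "\<And>u. C 0 u" "\<And>j u. C (Suc j) u \<longleftrightarrow> Q u \<and> C j (drop (Suc n) u)"
    and Q: "\<And>r u. length r = Suc n \<Longrightarrow> Q (r @ u) = Q r"
    and p: "avg (Suc n) (\<lambda>u. of_bool (Q u)) = p"
    and m: "j * Suc n \<le> m"
  shows "avg m (\<lambda>u. of_bool (C j u)) = p ^ j"
  using m
proof (induction j arbitrary: m)
  case (Suc j)
  then have m: "m = Suc n + (m - Suc n)" "j * Suc n \<le> m - Suc n" by auto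
  have "avg m (\<lambda>u. of_bool (C (Suc j) u)) = avg (Suc n) (\<lambda>r. avg (m - Suc n) (\<lambda>u. of_bool (C (Suc j) (r @ u))))"
    by (subst m(1)) (rule avg_split)
  also have "\<dots> = avg (Suc n) (\<lambda>r. avg (m - Suc n) (\<lambda>u. of_bool (Q r) * of_bool (C j u)))"
    by (intro avg_cong) (simp add: C(2) Q del: drop_Suc)
  also have "\<dots> = avg (Suc n) (\<lambda>r. p ^ j * of_bool (Q r))"
    by (simp only: avg_cmult Suc.IH[OF m(2)] mult.commute)
  finally show ?case by (simp only: avg_cmult p) simp
qed (simp add: C)

lemma read_row_append: "length r = Suc (length w) \<Longrightarrow> fst (read_row w (r @ u)) = fst (read_row w r)"
  by (cases r) (auto simp: fst_read_row dot_append)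

lemma avg_in_cell:
  assumes "length w = n" "j * Suc n \<le> m"
  shows "avg m (\<lambda>u. of_bool (in_cell j u w)) = (1 / 2) ^ j"
  by (rule avg_rows[where C = "\<lambda>j u. in_cell j u w" and Q = "\<lambda>u. \<not> fst (read_row w u)" and n = n])
    (simp, unfold in_cell_Suc assms(1), rule refl, simp add: read_row_append assms(1),
     rule avg_row[OF assms(1)], rule assms(2))

lemma avg_in_cell_pair:
  assumes "length w = n" "length w' = n" "w \<noteq> w'" "j * Suc n \<le> m"
  shows "avg m (\<lambda>u. of_bool (in_cell j u w \<and> in_cell j u w')) = (1 / 4) ^ j"
  by (rule avg_rows[where C = "\<lambda>j u. in_cell j u w \<and> in_cell j u w'"
        and Q = "\<lambda>u. \<not> fst (read_row w u) \<and> \<not> fst (read_row w' u)" and n = n])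
    (simp, unfold in_cell_Suc assms(1,2), blast, simp add: read_row_append assms(1,2),
     rule avg_row_pair[OF assms(1-3)], rule assms(4))

lemma avg_cell_nonempty_le:
  assumes "B \<subseteq> bit_lists n" "j * Suc n \<le> m"
  shows "avg m (\<lambda>u. of_bool (\<exists>w\<in>B. in_cell j u w)) \<le> card B / 2 ^ j"
proof -
  have "finite B" using assms(1) finite_bit_lists finite_subset by blast
  then have "avg m (\<lambda>u. of_bool (\<exists>w\<in>B. in_cell j u w)) \<le> (\<Sum>w\<in>B. avg m (\<lambda>u. of_bool (in_cell j u w)))"
    by (rule avg_ex_le)
  also have "\<dots> = (\<Sum>w\<in>B. (1 / 2) ^ j)"
    by (intro sum.cong refl avg_in_cell[where n = n]) (use assms in \<open>auto simp: bit_lists_def\<close>)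
  finally show ?thesis by (simp add: power_divide)
qed

text \<open>The second Bonferroni inequality, with pairwise independence of the cells.\<close>

lemma avg_cell_nonempty_ge:
  assumes V: "V \<subseteq> bit_lists n" and m: "j * Suc n \<le> m" and x: "x = card V / 2 ^ j"
  shows "x - x\<^sup>2 / 2 \<le> avg m (\<lambda>u. of_bool (\<exists>w\<in>V. in_cell j u w))"
proof -
  have fin: "finite V" using V finite_bit_lists finite_subset by blast
  define Z where "Z u = (\<Sum>w\<in>V. of_bool (in_cell j u w) :: real)" for u
  have len: "length w = n" if "w \<in> V" for w using V that by (auto simp: bit_lists_def)
  \<comment> \<open>\<open>Z\<close> counts the elements of \<open>V\<close> in the cell. For a
    natural number k the left side is k minus the number of pairs, and it is at most 1 because (k -
    1)(k - 2) is never negative.\<close>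
  have "(3 * Z u - (Z u)\<^sup>2) / 2 \<le> of_bool (\<exists>w\<in>V. in_cell j u w)" for u
  proof -
    define k where "k = card {w \<in> V. in_cell j u w}"
    have k: "Z u = real k" unfolding Z_def k_def using fin by (simp add: of_bool_def sum.If_cases Int_def)
    have "k = 0 \<longleftrightarrow> \<not> (\<exists>w\<in>V. in_cell j u w)" unfolding k_def using fin by auto
    moreover have "3 * real k - (real k)\<^sup>2 \<le> 2"
    proof -
      have "(int k - 1) * (int k - 2) \<ge> 0" by (cases "k \<le> 1") (auto intro: mult_nonneg_nonneg mult_nonpos_nonpos)
      then have "3 * int k - (int k)\<^sup>2 \<le> 2" by (simp add: algebra_simps power2_eq_square)
      then show ?thesis by (metis (mono_tags) of_int_diff of_int_le_iff of_int_mult of_int_numeral of_int_of_nat_eq of_int_power)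
    qed
    ultimately show ?thesis using k by (cases "k = 0") auto
  qed
  then have le: "avg m (\<lambda>u. (3 * Z u - (Z u)\<^sup>2) / 2) \<le> avg m (\<lambda>u. of_bool (\<exists>w\<in>V. in_cell j u w))"
    by (intro avg_mono) blast
  have eq: "avg m (\<lambda>u. (3 * Z u - (Z u)\<^sup>2) / 2) = (3 * avg m Z - avg m (\<lambda>u. (Z u)\<^sup>2)) / 2"
    using avg_cmult[of m "1/2" "\<lambda>u. 3 * Z u - (Z u)\<^sup>2"] by (simp add: avg_diff avg_cmult)
  have EZ: "avg m Z = x"
  proof -
    have "avg m Z = (\<Sum>w\<in>V. avg m (\<lambda>u. of_bool (in_cell j u w)))" unfolding Z_def by (rule avg_sum)
    also have "\<dots> = (\<Sum>w\<in>V. (1 / 2) ^ j)" by (intro sum.cong refl avg_in_cell[where n = n] len m)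
    finally show ?thesis by (simp add: x power_divide)
  qed
  have "avg m (\<lambda>u. (Z u)\<^sup>2) \<le> x + x\<^sup>2"
  proof -
    have "avg m (\<lambda>u. (Z u)\<^sup>2) = avg m (\<lambda>u. \<Sum>w\<in>V. \<Sum>w'\<in>V. of_bool (in_cell j u w \<and> in_cell j u w'))"
      unfolding Z_def power2_eq_square sum_product of_bool_conj ..
    also have "\<dots> = (\<Sum>w\<in>V. \<Sum>w'\<in>V. avg m (\<lambda>u. of_bool (in_cell j u w \<and> in_cell j u w')))"
      by (simp only: avg_sum)
    \<comment> \<open>The off-diagonal value is granted on the diagonal as well; this small
      overcount completes the square.\<close>
    also have "\<dots> \<le> (\<Sum>w\<in>V. \<Sum>w'\<in>V. (if w' = w then (1 / 2) ^ j else 0) + (1 / 4) ^ j)"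
    proof (intro sum_mono)
      fix w w' assume w: "w \<in> V" "w' \<in> V"
      show "avg m (\<lambda>u. of_bool (in_cell j u w \<and> in_cell j u w')) \<le> (if w' = w then (1 / 2) ^ j else 0) + (1 / 4) ^ j"
      proof (cases "w' = w")
        case True
        then show ?thesis using avg_in_cell[OF len[OF w(1)] m] by simp
      next
        case False
        then show ?thesis using avg_in_cell_pair[OF len[OF w(1)] len[OF w(2)] _ m] by simp
      qed
    qed
    also have "\<dots> = card V * (1 / 2) ^ j + (real (card V))\<^sup>2 * (1 / 4) ^ j"
      using fin by (simp add: sum.distrib power2_eq_square algebra_simps)
    also have "\<dots> = x + x\<^sup>2"
      by (simp add: x power_divide power2_eq_square power_mult_distrib[symmetric])
    finally show ?thesis .
  qed
  moreover have "(3 * x - e) / 2 \<ge> x - x\<^sup>2 / 2" if "e \<le> x + x\<^sup>2" for e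
    using that by (simp add: field_simps)
  ultimately show ?thesis using le unfolding eq EZ by (meson order_trans)
qed

text \<open>The least \<open>j\<close> with \<open>k \<le> 2 ^ j\<close> works: its minimality gives
  the lower bound.\<close>

lemma ex_level:
  assumes "1 \<le> k" "k \<le> 2 ^ n"
  shows "\<exists>j\<le>n. 1 / 2 < real k / 2 ^ j \<and> real k / 2 ^ j \<le> 1"
proof -
  define j where "j = (LEAST j. k \<le> 2 ^ j)"
  have le: "k \<le> 2 ^ j" unfolding j_def using assms(2) by (rule LeastI)
  have "j \<le> n" unfolding j_def using assms(2) by (rule Least_le)
  moreover have "real k / 2 ^ j \<le> 1"
  proof -
    have "real k \<le> real (2 ^ j)" using le of_nat_le_iff by blast
    then show ?thesis by simp
  qed
  moreover have "1 / 2 < real k / 2 ^ j"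
  proof (cases j)
    case 0
    then show ?thesis using assms(1) by simp
  next
    case (Suc i)
    then have "\<not> k \<le> 2 ^ i" using not_less_Least[of i "\<lambda>j. k \<le> 2 ^ j"] j_def by simp
    then have "real (2 ^ i) < real k" using not_le of_nat_less_iff by blast
    then show ?thesis using Suc by (simp add: field_simps)
  qed
  ultimately show ?thesis by blast
qed

section \<open>Correctness of the learning procedure\<close>

lemma search_solvable:
  assumes "search solvable p = l # ls" shows "solution p l"
proof -
  let ?f = "\<lambda>xs. xs @ [enc (p, xs @ [True]) \<in> solvable]"
  define n where "n = fst (snd p)"
  have ex: "\<exists>ys. solution p ys" and l: "l = (?f ^^ n) []"
    using assms solvable_enc[of p "[]"] by (auto simp: search_def n_def split: if_splits)
  \<comment> \<open>Invariant: the current prefix extends to a solution. If it does not extend with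
    \<open>True\<close>, it must extend with \<open>False\<close>.\<close>
  have "k \<le> n \<Longrightarrow> length ((?f ^^ k) []) = k \<and> (\<exists>ys. solution p ((?f ^^ k) [] @ ys))" for k
  proof (induction k)
    case (Suc k)
    define xs where "xs = (?f ^^ k) []"
    obtain ys where ys: "length xs = k" "solution p (xs @ ys)" using Suc unfolding xs_def by auto
    then have "length (xs @ ys) = n" by (simp add: solution_def n_def)
    then obtain b zs where "ys = b # zs" using ys(1) Suc.prems by (cases ys) auto
    have "\<exists>ys. solution p ((xs @ [enc (p, xs @ [True]) \<in> solvable]) @ ys)"
    proof (cases "\<exists>ys. solution p ((xs @ [True]) @ ys)")
      case True
      then show ?thesis using solvable_enc[of p "xs @ [True]"] by simp
    next
      case False
      then have "\<not> b" using ys(2) \<open>ys = b # zs\<close> by (cases b) auto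
      then have "solution p ((xs @ [False]) @ zs)" using ys(2) \<open>ys = b # zs\<close> by simp
      then show ?thesis using False solvable_enc[of p "xs @ [True]"] by (metis (full_types))
    qed
    then show ?case using ys(1) by (simp add: xs_def)
  qed (use ex in simp)
  from this[of n] obtain ys where "length l = n" "solution p (l @ ys)" unfolding l by auto
  then show ?thesis by (auto simp: solution_def n_def)
qed

lemma search_solvable_Nil: "search solvable p = [] \<Longrightarrow> \<not> solution p l"
  using solvable_enc[of p "[]"] by (auto simp: search_def split: if_splits)

section \<open>Version spaces and the error of a sampled majority\<close>

definition version_space :: "config \<Rightarrow> bool list list \<Rightarrow> bool list set" where
  "version_space cfg S = {w \<in> bit_lists (hyp_bits cfg). \<forall>a\<in>set S. consistent cfg w a}"

definition errors :: "config \<Rightarrow> bool list list \<Rightarrow> bool list \<Rightarrow> bool list set" where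
  "errors cfg S a = {w \<in> version_space cfg S. \<not> consistent cfg w a}"

definition maj_wrong :: "config \<Rightarrow> bool list list \<Rightarrow> bool list \<Rightarrow> bool" where
  "maj_wrong cfg ws a \<longleftrightarrow>
    majority (map (hyp_value (num_masks cfg) (literals (input_flags cfg) a)) ws) \<noteq> nth_bit a (target_index cfg)"

lemma counterexample_iff: "counterexample cfg ws a \<longleftrightarrow> eval_tokens (fst cfg) a \<and> maj_wrong cfg ws a"
  by (simp add: counterexample_def maj_wrong_def)

lemma version_space_subset: "version_space cfg S \<subseteq> bit_lists (hyp_bits cfg)"
  by (auto simp: version_space_def)

lemma finite_version_space [simp]: "finite (version_space cfg S)"
  by (rule finite_subset[OF version_space_subset]) simp

text \<open>Twice the weight for every wrong vote and half the weight for every right one: the majority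
  can only be wrong if the total weight is at least 1.\<close>

definition weight :: "config \<Rightarrow> bool list \<Rightarrow> bool list list \<Rightarrow> real" where
  "weight cfg a ws = (\<Prod>w\<leftarrow>ws. if consistent cfg w a then 1 / 2 else 2)"

lemma weight_append: "weight cfg a (xs @ ys) = weight cfg a xs * weight cfg a ys"
  by (simp add: weight_def)

lemma weight_concat: "weight cfg a (concat (map g [0..<t])) = (\<Prod>i<t. weight cfg a (g i))"
  by (induction t) (auto simp: weight_append, simp add: weight_def)

lemma weight_eq: "weight cfg a ws =
  2 ^ length (filter (\<lambda>w. \<not> consistent cfg w a) ws) / 2 ^ length (filter (\<lambda>w. consistent cfg w a) ws)"
  by (induction ws) (auto simp: weight_def)

lemma maj_wrong_weight:
  assumes "maj_wrong cfg ws a" shows "1 \<le> weight cfg a ws"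
proof -
  let ?h = "hyp_value (num_masks cfg) (literals (input_flags cfg) a)"
  let ?y = "nth_bit a (target_index cfg)"
  have c: "consistent cfg w a \<longleftrightarrow> ?h w = ?y" for w by (simp add: consistent_def)
  \<comment> \<open>A tie counts as \<open>False\<close>, so this inequality is strict when the
    right answer is \<open>False\<close> and may be an equality when it is
    \<open>True\<close>.\<close>
  have "length (filter (\<lambda>w. ?h w = ?y) ws) \<le> length (filter (\<lambda>w. \<not> ?h w = ?y) ws)"
    using assms by (cases ?y) (auto simp: maj_wrong_def majority_def filter_map o_def)
  then have "(2::real) ^ length (filter (\<lambda>w. consistent cfg w a) ws) \<le> 2 ^ length (filter (\<lambda>w. \<not> consistent cfg w a) ws)"
    by (simp add: c)
  then show ?thesis by (simp add: weight_eq)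
qed

text \<open>A trial has weight 1 if the cell is empty, 1/2 for a right vote and 2 for a wrong one.
  The expectation is at most 1 - (1/2)(3/8) + (3/2)(1/32) = 55/64. Whichever element the search
  returns, a wrong vote means that an erring element lies in the cell, so the argument does not rest
  on uniform sampling from the version space.\<close>

lemma avg_weight_search:
  assumes x: "1 / 2 < real (card (version_space cfg S)) / 2 ^ j" "real (card (version_space cfg S)) / 2 ^ j \<le> 1"
    and j: "j \<le> hyp_bits cfg"
    and B: "32 * card (errors cfg S a) \<le> card (version_space cfg S)"
  shows "avg (trial_bits cfg) (\<lambda>u. weight cfg a (search solvable (False, hyp_bits cfg, cfg, S, j, u))) \<le> 7 / 8"
proof -
  let ?V = "version_space cfg S" and ?B = "errors cfg S a"
  let ?s = "\<lambda>u. search solvable (False, hyp_bits cfg, cfg, S, j, u)"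
  let ?m = "trial_bits cfg"
  define x where "x = real (card ?V) / 2 ^ j"
  have sol: "solution (False, hyp_bits cfg, cfg, S, j, u) w \<longleftrightarrow> w \<in> ?V \<and> in_cell j u w" for u w
    by (auto simp: solution_def version_space_def bit_lists_def)
  have m: "j * Suc (hyp_bits cfg) \<le> ?m" 
    using mult_right_mono[OF j, of "Suc (hyp_bits cfg)"] by (simp only: trial_bits_def Suc_eq_plus1)
  have "weight cfg a (?s u) \<le> (1 - (1/2) * of_bool (\<exists>w\<in>?V. in_cell j u w)) + (3/2) * of_bool (\<exists>w\<in>?B. in_cell j u w)" for u
  proof (cases "?s u")
    case Nil
    then have "\<not> (\<exists>w\<in>?V. in_cell j u w)" using search_solvable_Nil sol by blast
    moreover from this have "\<not> (\<exists>w\<in>?B. in_cell j u w)" by (auto simp: errors_def)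
    ultimately show ?thesis using Nil by (simp add: weight_def)
  next
    case (Cons w ws)
    then have w: "w \<in> ?V" "in_cell j u w" using search_solvable sol by blast+
    have "ws = []" using Cons length_search_le[of solvable "(False, hyp_bits cfg, cfg, S, j, u)"] by (cases ws) auto
    moreover have "(\<exists>w\<in>?V. in_cell j u w) = True" using w by blast
    moreover have "(\<exists>w\<in>?B. in_cell j u w) = True" if "\<not> consistent cfg w a" using w that by (auto simp: errors_def)
    ultimately show ?thesis using Cons by (simp add: weight_def)
  qed
  then have "avg ?m (\<lambda>u. weight cfg a (?s u)) \<le>
    avg ?m (\<lambda>u. (1 - (1/2) * of_bool (\<exists>w\<in>?V. in_cell j u w)) + (3/2) * of_bool (\<exists>w\<in>?B. in_cell j u w))"
    by (intro avg_mono) blast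
  also have "\<dots> = 1 - (1/2) * avg ?m (\<lambda>u. of_bool (\<exists>w\<in>?V. in_cell j u w)) + (3/2) * avg ?m (\<lambda>u. of_bool (\<exists>w\<in>?B. in_cell j u w))"
    by (simp only: avg_add avg_diff avg_cmult avg_const)
  also have "\<dots> \<le> 1 - (1/2) * (x - x\<^sup>2 / 2) + (3/2) * (card ?B / 2 ^ j)"
  proof -
    have "avg ?m (\<lambda>u. of_bool (\<exists>w\<in>?V. in_cell j u w)) \<ge> x - x\<^sup>2 / 2"
      by (rule avg_cell_nonempty_ge[OF version_space_subset m x_def])
    moreover have "avg ?m (\<lambda>u. of_bool (\<exists>w\<in>?B. in_cell j u w)) \<le> card ?B / 2 ^ j"
      by (rule avg_cell_nonempty_le[OF _ m]) (use version_space_subset[of cfg S] in \<open>auto simp: errors_def\<close>)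
    ultimately show ?thesis by (intro add_mono diff_mono mult_left_mono) auto
  qed
  also have "\<dots> \<le> 1 - (1/2) * (3 / 8) + (3/2) * (1 / 32)"
  proof -
    \<comment> \<open>This product is 8 times the difference of \<open>x - x\<^sup>2 / 2\<close> and
      3/8.\<close>
    have "(2 * x - 1) * (3 - 2 * x) \<ge> 0" using x unfolding x_def[symmetric] by (intro mult_nonneg_nonneg) auto
    then have "x - x\<^sup>2 / 2 \<ge> 3 / 8" by (simp add: power2_eq_square algebra_simps)
    moreover have "card ?B / 2 ^ j \<le> 1 / 32"
    proof -
      have "32 * real (card ?B) \<le> real (card ?V)" using B by (metis of_nat_le_iff of_nat_mult of_nat_numeral)
      then have "32 * real (card ?B) / 2 ^ j \<le> real (card ?V) / 2 ^ j" by (intro divide_right_mono) auto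
      then show ?thesis using x(2) by linarith
    qed
    ultimately show ?thesis by (intro add_mono diff_mono mult_left_mono) auto
  qed
  also have "\<dots> \<le> 7 / 8" by simp
  finally show ?thesis .
qed

text \<open>An exponential-moment argument as for Chernoff bounds: the indicator of a wrong majority
  is below the weight, and the weight is a product over independent blocks.\<close>

lemma avg_maj_wrong:
  assumes "1 / 2 < real (card (version_space cfg S)) / 2 ^ j" "real (card (version_space cfg S)) / 2 ^ j \<le> 1"
    and "j \<le> hyp_bits cfg" and "32 * card (errors cfg S a) \<le> card (version_space cfg S)"
  shows "avg (random_bits c cfg) (\<lambda>u. of_bool (maj_wrong cfg (sampled_hyps c solvable cfg u S j) a))
    \<le> (7 / 8) ^ trials c cfg"
proof -
  let ?f = "\<lambda>u. weight cfg a (search solvable (False, hyp_bits cfg, cfg, S, j, u))"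
  have nonneg: "0 \<le> weight cfg a ws" for ws by (simp add: weight_eq)
  have w: "weight cfg a (sampled_hyps c solvable cfg u S j) =
    (\<Prod>i<trials c cfg. ?f (take (trial_bits cfg) (drop (i * trial_bits cfg) u)))" for u
    unfolding sampled_hyps_def by (rule weight_concat)
  have "avg (random_bits c cfg) (\<lambda>u. of_bool (maj_wrong cfg (sampled_hyps c solvable cfg u S j) a))
    \<le> avg (random_bits c cfg) (\<lambda>u. weight cfg a (sampled_hyps c solvable cfg u S j))"
    by (rule avg_mono) (use maj_wrong_weight nonneg in \<open>simp add: of_bool_def\<close>)
  also have "\<dots> = avg (trial_bits cfg) ?f ^ trials c cfg"
    unfolding w random_bits_def by (rule avg_prod_chunks)
  also have "\<dots> \<le> (7 / 8) ^ trials c cfg"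
  proof (rule power_mono[OF avg_weight_search[OF assms]])
    have "avg (trial_bits cfg) (\<lambda>_. 0) \<le> avg (trial_bits cfg) ?f" by (rule avg_mono) (rule nonneg)
    then show "0 \<le> avg (trial_bits cfg) ?f" by simp
  qed
  finally show ?thesis .
qed

text \<open>Exists only in the analysis: the learner cannot count the version space and tries all
  levels.\<close>

definition level :: "config \<Rightarrow> bool list list \<Rightarrow> nat" where
  "level cfg S = (SOME j. j \<le> hyp_bits cfg \<and> 1 / 2 < real (card (version_space cfg S)) / 2 ^ j \<and>
     real (card (version_space cfg S)) / 2 ^ j \<le> 1)"

lemma level:
  assumes "version_space cfg S \<noteq> {}"
  shows "level cfg S \<le> hyp_bits cfg" "1 / 2 < real (card (version_space cfg S)) / 2 ^ level cfg S"
    "real (card (version_space cfg S)) / 2 ^ level cfg S \<le> 1"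
proof -
  have "1 \<le> card (version_space cfg S)" using assms by (simp add: Suc_le_eq card_gt_0_iff)
  moreover have "card (version_space cfg S) \<le> 2 ^ hyp_bits cfg"
    using card_mono[OF finite_bit_lists version_space_subset[of cfg S]] by simp
  ultimately have "level cfg S \<le> hyp_bits cfg \<and> 1 / 2 < real (card (version_space cfg S)) / 2 ^ level cfg S \<and>
    real (card (version_space cfg S)) / 2 ^ level cfg S \<le> 1"
    unfolding level_def by (rule someI_ex[OF ex_level])
  then show "level cfg S \<le> hyp_bits cfg" "1 / 2 < real (card (version_space cfg S)) / 2 ^ level cfg S"
    "real (card (version_space cfg S)) / 2 ^ level cfg S \<le> 1" by auto
qed

definition bad_example :: "nat \<Rightarrow> config \<Rightarrow> bool list \<Rightarrow> bool list list \<Rightarrow> bool list \<Rightarrow> bool" where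
  "bad_example c cfg u S a \<longleftrightarrow> version_space cfg S \<noteq> {} \<and>
     32 * card (errors cfg S a) \<le> card (version_space cfg S) \<and>
     maj_wrong cfg (sampled_hyps c solvable cfg u S (level cfg S)) a"

text \<open>All example lists conceivable after \<open>r\<close> fruitless rounds; actual
  counterexamples form only a part, but this set is independent of the random bits.\<close>

definition samples :: "config \<Rightarrow> nat \<Rightarrow> bool list list set" where
  "samples cfg r = {S. length S = r * (hyp_bits cfg + 1) \<and> set S \<subseteq> bit_lists (length (input_flags cfg))}"

definition bad_bits :: "nat \<Rightarrow> config \<Rightarrow> bool list \<Rightarrow> bool" where
  "bad_bits c cfg u \<longleftrightarrow> (\<exists>r\<in>{..<rounds cfg}. \<exists>S\<in>samples cfg r.
     \<exists>a\<in>bit_lists (length (input_flags cfg)). bad_example c cfg u S a)"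

text \<open>Union bound over the rounds, the example lists and the new example, with
  \<open>l\<close> bits per example. The number of rounds is itself estimated by a power of two, so
  that all factors add up in one exponent.\<close>

lemma avg_bad_bits:
  assumes L: "length (input_flags cfg) \<le> length (fst cfg)"
  shows "avg (random_bits c cfg) (\<lambda>u. of_bool (bad_bits c cfg u)) \<le> 1 / 2 ^ (c * length (fst cfg))"
proof -
  define l where "l = length (input_flags cfg)"
  define n where "n = hyp_bits cfg + 1"
  define e :: real where "e = (7 / 8) ^ trials c cfg"
  let ?M = "random_bits c cfg"
  have 1: "avg ?M (\<lambda>u. of_bool (bad_example c cfg u S a)) \<le> e" for S a
  proof (cases "version_space cfg S \<noteq> {} \<and> 32 * card (errors cfg S a) \<le> card (version_space cfg S)")
    case True
    then have "avg ?M (\<lambda>u. of_bool (bad_example c cfg u S a)) =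
        avg ?M (\<lambda>u. of_bool (maj_wrong cfg (sampled_hyps c solvable cfg u S (level cfg S)) a))"
      by (simp add: bad_example_def)
    also have "\<dots> \<le> e" unfolding e_def
      by (rule avg_maj_wrong[OF level(2,3,1)]) (use True in auto)
    finally show ?thesis .
  next
    case False
    then have "avg ?M (\<lambda>u. of_bool (bad_example c cfg u S a)) = avg ?M (\<lambda>_. 0)"
      by (intro avg_cong) (auto simp: bad_example_def)
    then show ?thesis by (simp add: e_def)
  qed
  have 2: "avg ?M (\<lambda>u. of_bool (\<exists>a\<in>bit_lists l. bad_example c cfg u S a)) \<le> 2 ^ l * e" for S
  proof -
    have "avg ?M (\<lambda>u. of_bool (\<exists>a\<in>bit_lists l. bad_example c cfg u S a)) \<le>
      (\<Sum>a\<in>bit_lists l. avg ?M (\<lambda>u. of_bool (bad_example c cfg u S a)))" by (rule avg_ex_le) simp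
    also have "\<dots> \<le> (\<Sum>a\<in>bit_lists l. e)" by (rule sum_mono) (rule 1)
    finally show ?thesis by simp
  qed
  have fin: "finite (samples cfg r)" and card: "card (samples cfg r) = (2 ^ l) ^ (r * n)" for r
    using finite_lists_length_eq[OF finite_bit_lists, of l "r * n"] card_lists_length_eq[OF finite_bit_lists, of l "r * n"]
    by (simp_all add: samples_def l_def n_def conj_commute)
  have 3: "avg ?M (\<lambda>u. of_bool (\<exists>S\<in>samples cfg r. \<exists>a\<in>bit_lists l. bad_example c cfg u S a))
      \<le> (2 ^ l) ^ (rounds cfg * n) * (2 ^ l * e)" if "r < rounds cfg" for r
  proof -
    have "avg ?M (\<lambda>u. of_bool (\<exists>S\<in>samples cfg r. \<exists>a\<in>bit_lists l. bad_example c cfg u S a)) \<le>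
      (\<Sum>S\<in>samples cfg r. avg ?M (\<lambda>u. of_bool (\<exists>a\<in>bit_lists l. bad_example c cfg u S a)))"
      by (rule avg_ex_le) (rule fin)
    also have "\<dots> \<le> (\<Sum>S\<in>samples cfg r. 2 ^ l * e)" by (rule sum_mono) (rule 2)
    also have "\<dots> = (2 ^ l) ^ (r * n) * (2 ^ l * e)" by (simp add: card)
    also have "\<dots> \<le> (2 ^ l) ^ (rounds cfg * n) * (2 ^ l * e)"
      using that by (intro mult_right_mono power_increasing) (auto simp: e_def)
    finally show ?thesis .
  qed
  have "avg ?M (\<lambda>u. of_bool (bad_bits c cfg u)) \<le>
    (\<Sum>r\<in>{..<rounds cfg}. avg ?M (\<lambda>u. of_bool (\<exists>S\<in>samples cfg r. \<exists>a\<in>bit_lists l. bad_example c cfg u S a)))"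
    unfolding bad_bits_def l_def by (rule avg_ex_le) simp
  also have "\<dots> \<le> (\<Sum>r\<in>{..<rounds cfg}. (2 ^ l) ^ (rounds cfg * n) * (2 ^ l * e))"
    by (rule sum_mono) (use 3 in simp)
  also have "\<dots> = real (rounds cfg) * 2 ^ (l * (rounds cfg * n) + l) * e"
    by (simp add: power_mult power_add)
  also have "\<dots> \<le> 2 ^ rounds cfg * 2 ^ (l * (rounds cfg * n) + l) * e"
    by (intro mult_right_mono less_imp_le[OF of_nat_less_two_power]) (auto simp: e_def)
  also have "\<dots> \<le> 2 ^ rounds cfg * 2 ^ (length (fst cfg) * (rounds cfg * n + 1)) * e"
    using L unfolding l_def[symmetric]
    by (intro mult_right_mono mult_left_mono power_increasing)
      (auto simp: e_def algebra_simps intro!: add_mono mult_right_mono)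
  \<comment> \<open>\<open>trials\<close> is six times this last exponent. It cancels both factors
    of the union bound and leaves \<open>c * length (fst cfg)\<close> halvings.\<close>
  also have "\<dots> \<le> 2 ^ rounds cfg * 2 ^ (length (fst cfg) * (rounds cfg * n + 1)) *
      (1 / 2) ^ (length (fst cfg) * (rounds cfg * n + 1 + c) + rounds cfg)"
  proof (rule mult_left_mono)
    have "(7 / 8 :: real) ^ 6 \<le> 1 / 2" by (simp add: power_divide)
    then have "((7 / 8 :: real) ^ 6) ^ k \<le> (1 / 2) ^ k" for k by (intro power_mono) auto
    then show "e \<le> (1 / 2) ^ (length (fst cfg) * (rounds cfg * n + 1 + c) + rounds cfg)"
      by (simp only: e_def trials_def n_def power_mult)
  qed simp
  also have "\<dots> = 1 / 2 ^ (c * length (fst cfg))"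
    by (simp add: power_add power_mult power_divide algebra_simps power_mult_distrib)
  finally show ?thesis .
qed

definition adequate :: "config \<Rightarrow> bool list list \<Rightarrow> bool" where
  "adequate cfg ws \<longleftrightarrow> (\<forall>a. length a = length (input_flags cfg) \<longrightarrow> \<not> counterexample cfg ws a)"

lemma level_results_adequate:
  assumes "r \<in> set (level_results c solvable cfg u S)" "snd r = []"
  shows "adequate cfg (fst r)"
proof -
  obtain j where j: "r = (sampled_hyps c solvable cfg u S j, search solvable (True, length (input_flags cfg), cfg,
      sampled_hyps c solvable cfg u S j, 0, []))"
    using assms(1) unfolding level_results_def Let_def set_map by blast
  then have "\<not> solution (True, length (input_flags cfg), cfg, fst r, 0, []) a" for a
    using assms(2) search_solvable_Nil by (metis fst_conv snd_conv)
  then show ?thesis by (auto simp: adequate_def solution_def)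
qed

text \<open>Holds for all bits: a list is output only after the oracle has denied a counterexample.
  Bad bits can thus only lead to empty output.\<close>

lemma learn_sound:
  assumes "ws \<in> set (learn c solvable cfg u)" shows "adequate cfg ws"
proof -
  have "\<forall>ws\<in>set (fst ((round_step c solvable cfg u ^^ k) ([], []))). adequate cfg ws" for k
  proof (induction k)
    case (Suc k)
    define s where "s = (round_step c solvable cfg u ^^ k) ([], [])"
    have "adequate cfg ws" if "ws \<in> set (fst (round_step c solvable cfg u s))" for ws
      using that Suc level_results_adequate[of "(ws, [])" c cfg u "snd s"] unfolding s_def[symmetric]
      by (cases "fst s = []") (auto simp: round_step_def Let_def)
    then show ?case by (simp add: s_def)
  qed simp
  then show ?thesis using assms by (simp add: learn_def)
qed

text \<open>If every round were fruitless, each would have a counterexample at the proper level, and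
  on good bits this costs more than 1/32 of the version space. The target survives all examples, so
  the space cannot shrink below one element.\<close>

lemma learn_complete:
  assumes target: "wt \<in> bit_lists (hyp_bits cfg)"
      "\<And>a. length a = length (input_flags cfg) \<Longrightarrow> eval_tokens (fst cfg) a \<Longrightarrow> consistent cfg wt a"
    and pos: "0 < hyp_bits cfg" and good: "\<not> bad_bits c cfg u"
  shows "learn c solvable cfg u \<noteq> []"
proof
  assume empty: "learn c solvable cfg u = []"
  let ?l = "length (input_flags cfg)"
  let ?st = "\<lambda>k. (round_step c solvable cfg u ^^ k) ([], [])"
  have mono: "fst (?st k) \<noteq> [] \<Longrightarrow> fst (?st (k + i)) \<noteq> []" for k i
    by (induction i) (auto simp: round_step_def)
  have nil: "fst (?st k) = []" if "k \<le> rounds cfg" for k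
    using mono[of k "rounds cfg - k"] empty that by (auto simp: learn_def)
  have inv: "k \<le> rounds cfg \<Longrightarrow> length (snd (?st k)) = k * (hyp_bits cfg + 1) \<and>
     (\<forall>a\<in>set (snd (?st k)). length a = ?l \<and> eval_tokens (fst cfg) a) \<and>
     real (card (version_space cfg (snd (?st k)))) \<le> (31 / 32) ^ k * 2 ^ hyp_bits cfg" for k
  proof (induction k)
    case 0
    have "card (version_space cfg []) \<le> 2 ^ hyp_bits cfg"
      using card_mono[OF finite_bit_lists version_space_subset[of cfg "[]"]] by simp
    then have "real (card (version_space cfg [])) \<le> real (2 ^ hyp_bits cfg)" using of_nat_le_iff by blast
    then show ?case by simp
  next
    case (Suc k)
    define S where "S = snd (?st k)"
    define rs where "rs = level_results c solvable cfg u S"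
    have S: "length S = k * (hyp_bits cfg + 1)" "\<forall>a\<in>set S. length a = ?l \<and> eval_tokens (fst cfg) a"
      "real (card (version_space cfg S)) \<le> (31 / 32) ^ k * 2 ^ hyp_bits cfg"
      using Suc unfolding S_def by auto
    have st: "?st (Suc k) = (map fst (filter (\<lambda>r. snd r = []) rs), concat (map snd rs) @ S)"
      using nil[of k] Suc.prems by (simp add: round_step_def Let_def rs_def S_def)
    have "filter (\<lambda>r. snd r = []) rs = []" using nil[OF Suc.prems] unfolding st by simp
    then have ne: "snd r \<noteq> []" if "r \<in> set rs" for r using that by (simp add: filter_empty_conv)
    have r: "\<exists>a. snd r = [a] \<and> length a = ?l \<and> counterexample cfg (fst r) a" if mem: "r \<in> set rs" for r
    proof -
      obtain j where j: "r = (sampled_hyps c solvable cfg u S j, search solvable (True, ?l, cfg,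
          sampled_hyps c solvable cfg u S j, 0, []))"
        using mem unfolding rs_def level_results_def Let_def set_map by blast
      obtain a as where a: "snd r = a # as" using ne[OF mem] by (cases "snd r") auto
      have "as = []" using a length_search_le[of solvable "(True, ?l, cfg, sampled_hyps c solvable cfg u S j, 0, [])"]
        unfolding j by (cases as) auto
      moreover have "solution (True, ?l, cfg, fst r, 0, []) a"
        using a unfolding j snd_conv fst_conv by (rule search_solvable)
      ultimately show ?thesis using a by (auto simp: solution_def)
    qed
    have "length (concat (map snd rs)) = length rs"
    proof -
      have "\<forall>r\<in>set rs. length (snd r) = 1" using r by fastforce
      then show ?thesis by (induction rs) auto
    qed
    then have len: "length (concat (map snd rs)) = hyp_bits cfg + 1"
      by (simp add: rs_def level_results_def)
    have ex: "\<forall>a\<in>set (concat (map snd rs)). length a = ?l \<and> eval_tokens (fst cfg) a"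
      using r by (fastforce simp: counterexample_iff)
    have wt: "wt \<in> version_space cfg S" using S(2) target by (auto simp: version_space_def)
    then have nonempty: "version_space cfg S \<noteq> {}" by blast
    let ?r = "(sampled_hyps c solvable cfg u S (level cfg S), search solvable (True, ?l, cfg,
      sampled_hyps c solvable cfg u S (level cfg S), 0, []))"
    have "level cfg S \<in> set [0..<hyp_bits cfg + 1]" using level(1)[OF nonempty]
      by (simp only: set_upt atLeastLessThan_iff) simp
    then have rin: "?r \<in> set rs" unfolding rs_def level_results_def Let_def set_map by blast
    obtain a where a: "snd ?r = [a]" "length a = ?l" "counterexample cfg (fst ?r) a" using r[OF rin] by blast
    have "S \<in> samples cfg k" "k \<in> {..<rounds cfg}" "a \<in> bit_lists ?l"
      using S(1,2) a(2) Suc.prems by (auto simp: samples_def bit_lists_def)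
    then have "\<not> bad_example c cfg u S a" using good unfolding bad_bits_def by blast
    \<comment> \<open>The majority at the proper level errs on \<open>a\<close>. On good bits this
      is impossible when at most 1/32 of the version space errs.\<close>
    then have large: "card (version_space cfg S) < 32 * card (errors cfg S a)"
      using nonempty a(3) by (auto simp: bad_example_def counterexample_iff)
    have "a \<in> set (concat (map snd rs))" using rin a(1) by (auto intro!: bexI[of _ ?r])
    then have sub: "version_space cfg (concat (map snd rs) @ S) \<subseteq> version_space cfg S - errors cfg S a"
      by (auto simp: version_space_def errors_def)
    have esub: "errors cfg S a \<subseteq> version_space cfg S" by (auto simp: errors_def)
    have "card (version_space cfg (concat (map snd rs) @ S)) \<le> card (version_space cfg S) - card (errors cfg S a)"
      using card_mono[OF _ sub] card_Diff_subset[OF finite_subset[OF esub] esub] by simp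
    then have "real (card (version_space cfg (concat (map snd rs) @ S))) \<le> (31 / 32) * real (card (version_space cfg S))"
      using large card_mono[OF finite_version_space esub] by linarith
    also have "\<dots> \<le> (31 / 32) * ((31 / 32) ^ k * 2 ^ hyp_bits cfg)" using S(3) by simp
    finally show ?case unfolding st using len S(1,2) ex by (auto simp: algebra_simps)
  qed
  let ?S = "snd (?st (rounds cfg))"
  have "wt \<in> version_space cfg ?S" using inv[of "rounds cfg"] target by (auto simp: version_space_def)
  then have "1 \<le> card (version_space cfg ?S)" by (metis Suc_leI card_gt_0_iff empty_iff finite_version_space One_nat_def)
  then have "1 \<le> real (card (version_space cfg ?S))" by simp
  also have "\<dots> \<le> (31 / 32) ^ rounds cfg * 2 ^ hyp_bits cfg" using inv[of "rounds cfg"] by simp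
  also have "\<dots> = ((31 / 32) ^ 22 * 2) ^ hyp_bits cfg"
    by (simp add: rounds_def power_mult power_mult_distrib)
  \<comment> \<open>The base is below 1; \<open>pos\<close> makes the power strictly smaller than
    1.\<close>
  also have "\<dots> < 1"
    using pos by (intro power_less_one_iff[THEN iffD2]) (auto simp: power_divide)
  finally show False by simp
qed

section \<open>Circuits as hypotheses\<close>

text \<open>The effect of one mask, with the selected literals given as a set of positions instead
  of bits.\<close>

definition add_conj :: "bool list \<Rightarrow> nat set \<Rightarrow> bool list" where
  "add_conj ls P = (let v = (\<forall>p\<in>P. p < length ls \<longrightarrow> ls ! p) in v # (\<not> v) # ls)"

primrec masks :: "nat \<Rightarrow> nat set list \<Rightarrow> bool list" where
  "masks k [] = []"
| "masks k (P # Ps) = map (\<lambda>p. p \<in> P) [0..<k] @ masks (k + 2) Ps"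

lemma fst_read_mask:
  assumes "length m = length ls"
  shows "fst (read_mask ls (m @ w)) = (\<forall>p<length ls. m ! p \<longrightarrow> ls ! p)"
proof -
  have "fst (foldl (\<lambda>s l. (fst s \<and> (hd_bit (snd s) \<longrightarrow> l), tl (snd s))) (b, m @ w) ls) =
      (b \<and> (\<forall>p<length ls. m ! p \<longrightarrow> ls ! p))" for b
    using assms
  proof (induction m ls arbitrary: b rule: list_induct2)
    case (Cons x xs y ys)
    have "(\<forall>p<Suc (length ys). (x # xs) ! p \<longrightarrow> (y # ys) ! p) \<longleftrightarrow> (x \<longrightarrow> y) \<and> (\<forall>p<length ys. xs ! p \<longrightarrow> ys ! p)"
      unfolding All_less_Suc2 by simp
    then show ?case using Cons.IH by simp
  qed simp
  then show ?thesis by (simp add: read_mask_def)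
qed

lemma hyp_step_mask:
  "hyp_step (ls, map (\<lambda>p. p \<in> P) [0..<length ls] @ w) = (add_conj ls P, w)"
proof -
  have "fst (read_mask ls (map (\<lambda>p. p \<in> P) [0..<length ls] @ w)) = (\<forall>p\<in>P. p < length ls \<longrightarrow> ls ! p)"
    by (subst fst_read_mask) auto
  then show ?thesis by (simp add: hyp_step_def add_conj_def Let_def snd_read_mask)
qed

lemma length_add_conj [simp]: "length (add_conj ls P) = length ls + 2"
  by (simp add: add_conj_def Let_def)

lemma hyp_steps_masks:
  "(hyp_step ^^ length Ps) (ls, masks (length ls) Ps @ w) = (foldl add_conj ls Ps, w)"
proof (induction Ps arbitrary: ls)
  case (Cons P Ps)
  have "(hyp_step ^^ length (P # Ps)) (ls, masks (length ls) (P # Ps) @ w) =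
      (hyp_step ^^ length Ps) (add_conj ls P, masks (length (add_conj ls P)) Ps @ w)"
    by (simp add: funpow_Suc_right hyp_step_mask del: funpow.simps)
  then show ?case by (simp only: Cons foldl_Cons)
qed simp

lemma length_masks: "length (masks k Ps) \<le> length Ps * (k + 2 * length Ps)"
proof (induction Ps arbitrary: k)
  case (Cons P Ps)
  have "length (masks k (P # Ps)) \<le> k + length Ps * (k + 2 + 2 * length Ps)"
    using Cons[of "k + 2"] by simp
  then show ?case by (simp add: algebra_simps)
qed simp

lemma gate_values_snoc:
  "gate_values a (gs @ [g]) = gate_values a gs @ [gate_value a (gate_values a gs) g]"
  by (simp add: gate_values_def)

lemma length_gate_values [simp]: "length (gate_values a gs) = length gs"
  by (induction gs rule: rev_induct) (simp_all add: gate_values_snoc, simp add: gate_values_def)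

lemma wire_value_append:
  "wire_ok Z (length vs) u \<Longrightarrow> wire_value a (vs @ ws) u = wire_value a vs u"
  by (cases u) (auto simp: nth_append)

lemma length_foldl_add_conj: "length (foldl add_conj ls Ps) = length ls + 2 * length Ps"
  by (induction Ps arbitrary: ls) auto

text \<open>Every wire of the circuit and its negation occur as literals at positions that do not depend
  on the input \<open>a\<close> taken from \<open>D\<close>.\<close>

lemma gates_masks:
  assumes lits: "\<And>a. a \<in> D \<Longrightarrow> length (lits a) = k"
    and inputs: "\<And>v. v \<in> Z \<Longrightarrow> \<exists>p<k. \<forall>a\<in>D. lits a ! p = asg a v"
      "\<And>v. v \<in> Z \<Longrightarrow> \<exists>p<k. \<forall>a\<in>D. lits a ! p = (\<not> asg a v)"
    and ok: "\<forall>j < length gs. gate_ok Z j (gs ! j)"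
  shows "\<exists>Ps. length Ps = length gs \<and> (\<forall>u. wire_ok Z (length gs) u \<longrightarrow>
    (\<exists>p<k + 2 * length gs. \<forall>a\<in>D. foldl add_conj (lits a) Ps ! p = wire_value (asg a) (gate_values (asg a) gs) u) \<and>
    (\<exists>p<k + 2 * length gs. \<forall>a\<in>D. foldl add_conj (lits a) Ps ! p = (\<not> wire_value (asg a) (gate_values (asg a) gs) u)))"
  using ok
proof (induction gs rule: rev_induct)
  case Nil
  have "(\<exists>p<k. \<forall>a\<in>D. lits a ! p = wire_value (asg a) (gate_values (asg a) []) u) \<and>
    (\<exists>p<k. \<forall>a\<in>D. lits a ! p = (\<not> wire_value (asg a) (gate_values (asg a) []) u))" if "wire_ok Z 0 u" for u
    using that inputs by (cases u) auto
  then show ?case by simp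
next
  case (snoc g gs)
  let ?n = "length gs"
  have "\<forall>j < ?n. gate_ok Z j (gs ! j)" using snoc.prems by (auto simp: nth_append less_Suc_eq split: if_splits)
  then obtain Ps where Ps: "length Ps = ?n" "\<And>u. wire_ok Z ?n u \<Longrightarrow>
      (\<exists>p<k + 2 * ?n. \<forall>a\<in>D. foldl add_conj (lits a) Ps ! p = wire_value (asg a) (gate_values (asg a) gs) u)"
      "\<And>u. wire_ok Z ?n u \<Longrightarrow>
      (\<exists>p<k + 2 * ?n. \<forall>a\<in>D. foldl add_conj (lits a) Ps ! p = (\<not> wire_value (asg a) (gate_values (asg a) gs) u))"
    using snoc.IH by blast
  define ls where "ls a = foldl add_conj (lits a) Ps" for a
  define val where "val a u = wire_value (asg a) (gate_values (asg a) gs) u" for a u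
  define gv where "gv a = gate_value (asg a) (gate_values (asg a) gs) g" for a
  have len: "length (ls a) = k + 2 * ?n" if "a \<in> D" for a
    using lits[OF that] Ps(1) by (simp add: ls_def length_foldl_add_conj)
  have pos: "\<exists>p<k + 2 * ?n. \<forall>a\<in>D. ls a ! p = val a u" "\<exists>p<k + 2 * ?n. \<forall>a\<in>D. ls a ! p = (\<not> val a u)"
    if "wire_ok Z ?n u" for u using Ps(2,3)[OF that] by (auto simp: ls_def val_def)
  have gok: "gate_ok Z ?n g" using snoc.prems by (auto simp: nth_append)
  \<comment> \<open>Up to the sign \<open>b\<close>, each gate is a conjunction of literals: a
    constant is the empty one, and \<open>Or_Gate\<close> becomes one by De Morgan, as negated wires
    are literals too. A mask adds both signs, so \<open>b\<close> only tells which of the two new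
    literals is the gate.\<close>
  have "\<exists>P b. \<forall>a\<in>D. (\<forall>p\<in>P. p < length (ls a) \<longrightarrow> ls a ! p) \<longleftrightarrow> gv a \<noteq> b"
  proof (cases g)
    case (Const_Gate b)
    then show ?thesis by (intro exI[of _ "{}"] exI[of _ "\<not> b"]) (auto simp: gv_def)
  next
    case (Not_Gate u)
    then have "wire_ok Z ?n u" using gok by simp
    then obtain p where "p < k + 2 * ?n" "\<forall>a\<in>D. ls a ! p = val a u" using pos(1) by blast
    then show ?thesis using Not_Gate len by (intro exI[of _ "{p}"] exI[of _ True]) (auto simp: gv_def val_def)
  next
    case (And_Gate u w)
    then have "wire_ok Z ?n u" "wire_ok Z ?n w" using gok by simp_all
    then obtain p q where "p < k + 2 * ?n" "\<forall>a\<in>D. ls a ! p = val a u" "q < k + 2 * ?n" "\<forall>a\<in>D. ls a ! q = val a w"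
      using pos(1) by meson
    then show ?thesis using And_Gate len by (intro exI[of _ "{p, q}"] exI[of _ False]) (auto simp: gv_def val_def)
  next
    case (Or_Gate u w)
    then have "wire_ok Z ?n u" "wire_ok Z ?n w" using gok by simp_all
    then obtain p q where "p < k + 2 * ?n" "\<forall>a\<in>D. ls a ! p = (\<not> val a u)" "q < k + 2 * ?n" "\<forall>a\<in>D. ls a ! q = (\<not> val a w)"
      using pos(2) by meson
    then show ?thesis using Or_Gate len by (intro exI[of _ "{p, q}"] exI[of _ True]) (auto simp: gv_def val_def)
  qed
  then obtain P b where P: "\<And>a. a \<in> D \<Longrightarrow> (\<forall>p\<in>P. p < length (ls a) \<longrightarrow> ls a ! p) \<longleftrightarrow> gv a \<noteq> b" by blast
  have step: "foldl add_conj (lits a) (Ps @ [P]) = (gv a \<noteq> b) # (gv a = b) # ls a" if "a \<in> D" for a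
    using P[OF that] by (simp add: add_conj_def Let_def ls_def)
  have wv: "wire_value (asg a) (gate_values (asg a) (gs @ [g])) u = (if u = Wire ?n then gv a else val a u)"
    if "wire_ok Z (Suc ?n) u" for a u
    using that by (cases u) (auto simp: gate_values_snoc nth_append gv_def val_def)
  have "(\<exists>p<k + 2 * Suc ?n. \<forall>a\<in>D. foldl add_conj (lits a) (Ps @ [P]) ! p =
        (wire_value (asg a) (gate_values (asg a) (gs @ [g])) u \<noteq> c))" if u: "wire_ok Z (Suc ?n) u" for u c
  proof (cases "u = Wire ?n")
    case True
    then show ?thesis using step wv[OF u]
      by (intro exI[of _ "if b = c then 0 else 1"]) auto
  next
    case False
    then have "wire_ok Z ?n u" using u by (cases u) auto
    then have "\<exists>p<k + 2 * ?n. \<forall>a\<in>D. ls a ! p = (val a u \<noteq> c)" using pos by (cases c) simp_all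
    then obtain p where "p < k + 2 * ?n" "\<forall>a\<in>D. ls a ! p = (val a u \<noteq> c)" by blast
    \<comment> \<open>The two new literals are put in front and shift all earlier positions by
      2.\<close>
    then show ?thesis using step wv[OF u] False by (intro exI[of _ "p + 2"]) auto
  qed
  from this[of _ False] this[of _ True] show ?case
    using Ps(1) by (intro exI[of _ "Ps @ [P]"]) (simp del: foldl_append)
qed

text \<open>One mask more than there are gates: the last selects the output wire and brings it to
  the front, where \<open>hyp_value\<close> reads it. Unread padding gives all hypotheses the same
  length. The string is the same for all inputs in \<open>D\<close>.\<close>

lemma circuit_masks:
  assumes lits: "\<And>a. a \<in> D \<Longrightarrow> length (lits a) = k"
    and inputs: "\<And>v. v \<in> Z \<Longrightarrow> \<exists>p<k. \<forall>a\<in>D. lits a ! p = asg a v"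
      "\<And>v. v \<in> Z \<Longrightarrow> \<exists>p<k. \<forall>a\<in>D. lits a ! p = (\<not> asg a v)"
    and C: "circuit_on Z C"
  shows "\<exists>w. length w = Suc (circuit_size C) * (k + 2 * Suc (circuit_size C)) \<and>
    (\<forall>a\<in>D. hyp_value (Suc (circuit_size C)) (lits a) w = circuit_value C (asg a))"
proof -
  let ?n = "circuit_size C"
  have n: "?n = length (gates C)" by (simp add: circuit_size_def)
  have ok: "\<forall>j < length (gates C). gate_ok Z j (gates C ! j)" "wire_ok Z (length (gates C)) (out_wire C)"
    using C by (auto simp: circuit_on_def)
  have "\<exists>Ps. length Ps = ?n \<and> (\<forall>u. wire_ok Z ?n u \<longrightarrow>
    (\<exists>p<k + 2 * ?n. \<forall>a\<in>D. foldl add_conj (lits a) Ps ! p = wire_value (asg a) (gate_values (asg a) (gates C)) u) \<and>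
    (\<exists>p<k + 2 * ?n. \<forall>a\<in>D. foldl add_conj (lits a) Ps ! p = (\<not> wire_value (asg a) (gate_values (asg a) (gates C)) u)))"
    unfolding n by (rule gates_masks[OF lits inputs ok(1)])
  then obtain Ps p where Ps: "length Ps = ?n" "p < k + 2 * ?n"
    "\<forall>a\<in>D. foldl add_conj (lits a) Ps ! p = circuit_value C (asg a)"
    using ok(2) unfolding circuit_value_def n by blast
  let ?Ps = "Ps @ [{p}]"
  have l: "length ?Ps = Suc ?n" using Ps(1) by simp
  define w where "w = masks k ?Ps @ replicate (Suc ?n * (k + 2 * Suc ?n) - length (masks k ?Ps)) False"
  have "length w = Suc ?n * (k + 2 * Suc ?n)"
    using length_masks[of k ?Ps] unfolding w_def l by simp
  moreover have "hyp_value (Suc ?n) (lits a) w = circuit_value C (asg a)" if a: "a \<in> D" for a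
  proof -
    have "hyp_value (Suc ?n) (lits a) w = hd_bit (foldl add_conj (lits a) ?Ps)"
      unfolding hyp_value_def w_def l[symmetric] lits[OF a, symmetric] hyp_steps_masks by simp
    moreover have "length (foldl add_conj (lits a) Ps) = k + 2 * ?n"
      using lits[OF a] Ps(1) by (simp add: length_foldl_add_conj)
    ultimately show ?thesis using Ps(2,3) a by (simp add: add_conj_def Let_def)
  qed
  ultimately show ?thesis by blast
qed

section \<open>Compressing the formula\<close>

text \<open>Variables are replaced by their positions in the list of occurrences, so that the size of the
  learner's input, and with it the number of queries, does not depend on \<open>n\<close> and \<open>m\<close>.\<close>

definition index :: "(nat \<times> nat) list \<Rightarrow> nat \<times> nat \<Rightarrow> nat" where
  "index vs v = foldl (\<lambda>k u. if u = v then 0 else Suc k) 0 (rev vs)"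

definition token_vars :: "(nat \<times> nat \<times> nat) list \<Rightarrow> (nat \<times> nat) list" where
  "token_vars tk = map snd (filter (\<lambda>t. fst t = 1) tk)"

definition rename :: "(nat \<times> nat) list \<Rightarrow> nat \<times> nat \<times> nat \<Rightarrow> nat \<times> nat" where
  "rename vs t = (fst t, if fst t = 1 then index vs (snd t) else fst (snd t))"

fun var_code :: "var \<Rightarrow> nat \<times> nat" where
  "var_code (X j) = (0, j)"
| "var_code (Y j) = (1, j)"

definition code_var :: "nat \<times> nat \<Rightarrow> var" where
  "code_var c = (if fst c = 0 then X (snd c) else Y (snd c))"

lemma code_var_code [simp]: "code_var (var_code v) = v"
  by (cases v) (auto simp: code_var_def)

lemma index_simps [simp]: "index [] v = 0" "index (u # vs) v = (if u = v then 0 else Suc (index vs v))"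
  by (simp_all add: index_def)

lemma index_less: "index vs v < length vs \<longleftrightarrow> v \<in> set vs"
  by (induction vs) auto

lemma index_le: "index vs v \<le> length vs"
  by (induction vs) auto

lemma nth_index: "v \<in> set vs \<Longrightarrow> vs ! index vs v = v"
  by (induction vs) auto

lemma nth_bit_eq: "nth_bit a k = (k < length a \<and> a ! k)"
  by (cases "k < length a") (auto simp: nth_bit_def Cons_nth_drop_Suc[symmetric])

definition assignment_of :: "(nat \<times> nat) list \<Rightarrow> bool list \<Rightarrow> assignment" where
  "assignment_of vs a v = nth_bit a (index vs (var_code v))"

lemma eval_tokens_holds:
  "eval_tokens (map (rename vs) (tokens F)) a = holds F (assignment_of vs a)"
proof -
  have "foldl (token_step a) st (rev (map (rename vs) (tokens F))) = holds F (assignment_of vs a) # st" for st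
  proof (induction F arbitrary: st)
    case (Atom v)
    then show ?case by (cases v) (auto simp: rename_def token_step_def assignment_of_def)
  qed (auto simp: rename_def token_step_def)
  then show ?thesis by (simp add: eval_tokens_def)
qed

lemma code_var_token_vars: "code_var ` set (token_vars (tokens F)) = formula_vars F"
proof (induction F)
  case (Atom v)
  then show ?case by (cases v) (auto simp: token_vars_def code_var_def)
qed (auto simp: token_vars_def image_Un)

lemma var_code_token_vars: "v \<in> formula_vars F \<longleftrightarrow> var_code v \<in> set (token_vars (tokens F))"
proof (induction F)
  case (Atom w)
  then show ?case by (cases v; cases w) (auto simp: token_vars_def)
qed (auto simp: token_vars_def image_Un)

lemma length_tokens: "length (tokens F) = formula_size F"
  by (induction F) auto

lemma length_token_vars: "length (token_vars tk) \<le> length tk"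
  by (simp add: token_vars_def)

lemma holds_cong: "(\<And>v. v \<in> formula_vars F \<Longrightarrow> a v = b v) \<Longrightarrow> holds F a = holds F b"
  by (induction F) auto

lemma assignment_of_map:
  "var_code v \<in> set vs \<Longrightarrow> assignment_of vs (map (\<lambda>c. \<alpha> (code_var c)) vs) v = \<alpha> v"
  by (simp add: assignment_of_def nth_bit_eq index_less nth_index)

definition compress :: "formula \<Rightarrow> nat \<Rightarrow> nat \<Rightarrow> config" where
  "compress F i g = (let vs = token_vars (tokens F) in
     (map (rename vs) (tokens F), index vs (1, i), map (\<lambda>v. fst v = 0 \<or> snd v < i) vs, g))"

lemma nth_concat_pairs: "k < length xs \<Longrightarrow> concat (map (\<lambda>z. [f z, g z]) xs) ! (2 * k) = f (xs ! k)"
  "k < length xs \<Longrightarrow> concat (map (\<lambda>z. [f z, g z]) xs) ! Suc (2 * k) = g (xs ! k)"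
  by (induction xs arbitrary: k) (auto simp: less_Suc_eq_0_disj)

lemma length_concat_pairs: "length (concat (map (\<lambda>z. [f z, g z]) xs)) = 2 * length xs"
  by (induction xs) auto

text \<open>Repeated occurrences of a variable have bits of their own, and a counterexample may set
  them inconsistently. Evaluation of the formula and the target hypothesis both read only first
  occurrences, so the target is consistent with such strings as well.\<close>

lemma compress_target:
  assumes C: "computes_on_models F (preceding_vars n i) (Y i) C" and g: "g = Suc (circuit_size C)"
  shows "\<exists>w \<in> bit_lists (hyp_bits (compress F i g)).
    \<forall>a. length a = length (fst (snd (snd (compress F i g)))) \<longrightarrow>
      eval_tokens (fst (compress F i g)) a \<longrightarrow> consistent (compress F i g) w a"
proof -
  define vs where "vs = token_vars (tokens F)"
  define pre where "pre = map (\<lambda>v. fst v = 0 \<or> snd v < i) vs"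
  have cfg: "compress F i g = (map (rename vs) (tokens F), index vs (1, i), pre, g)"
    by (simp add: compress_def vs_def pre_def Let_def)
  define D where "D = {a :: bool list. length a = length vs}"
  let ?k = "2 + 2 * length vs"
  have len: "length (literals pre a) = ?k" if "a \<in> D" for a
    using that by (simp add: literals_def length_concat_pairs D_def pre_def)
  have inp: "\<exists>p<?k. \<forall>a\<in>D. literals pre a ! p = (assignment_of vs a v \<noteq> b)"
    if v: "v \<in> preceding_vars n i" for v b
  proof (cases "var_code v \<in> set vs")
    case True
    let ?j = "index vs (var_code v)"
    have j: "?j < length vs" using True by (simp add: index_less)
    have "pre ! ?j" using v j True by (auto simp: pre_def nth_index preceding_vars_def)
    then have "literals pre a ! (if b then 3 + 2 * ?j else 2 + 2 * ?j) = (assignment_of vs a v \<noteq> b)" if "a \<in> D" for a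
      using that j nth_concat_pairs[of ?j "zip pre a" "\<lambda>z. fst z \<and> snd z" "\<lambda>z. fst z \<and> \<not> snd z"]
      by (simp add: literals_def D_def pre_def assignment_of_def nth_bit_eq numeral_3_eq_3 numeral_2_eq_2)
    then show ?thesis using j by (intro exI[of _ "if b then 3 + 2 * ?j else 2 + 2 * ?j"]) auto
  next
    case False
    \<comment> \<open>An input of the circuit that is absent from the formula is read as
      \<open>False\<close>, so the constant literals at positions 0 and 1 serve for it and its
      negation.\<close>
    then have "\<not> assignment_of vs a v" if "a \<in> D" for a
      using that index_less[of vs "var_code v"] by (simp add: assignment_of_def nth_bit_eq D_def)
    then show ?thesis by (intro exI[of _ "if b then 0 else 1"]) (auto simp: literals_def)
  qed
  have on: "circuit_on (preceding_vars n i) C" using C by (simp add: computes_on_models_def)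
  have "\<exists>w. length w = Suc (circuit_size C) * (?k + 2 * Suc (circuit_size C)) \<and>
    (\<forall>a\<in>D. hyp_value (Suc (circuit_size C)) (literals pre a) w = circuit_value C (assignment_of vs a))"
    by (rule circuit_masks[where Z = "preceding_vars n i"]) (use len inp[of _ False] inp[of _ True] on in auto)
  then obtain w where w: "length w = g * (?k + 2 * g)"
    "\<forall>a\<in>D. hyp_value g (literals pre a) w = circuit_value C (assignment_of vs a)"
    unfolding g by blast
  have "w \<in> bit_lists (hyp_bits (compress F i g))"
    using w(1) by (simp add: bit_lists_def hyp_bits_def cfg pre_def)
  moreover have "consistent (compress F i g) w a"
    if "length a = length vs" "holds F (assignment_of vs a)" for a
    using C that w(2) by (simp add: consistent_def cfg D_def computes_on_models_def) (simp add: assignment_of_def)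
  ultimately show ?thesis by (intro bexI[of _ w]) (auto simp: cfg eval_tokens_holds pre_def)
qed

lemma compress_adequate:
  assumes ws: "adequate (compress F i g) ws" and u: "uniquely_defined F (preceding_vars n i) (Y i)"
    and \<alpha>: "holds F \<alpha>"
  defines "vs \<equiv> token_vars (tokens F)"
  shows "majority (map (hyp_value g (literals (fst (snd (snd (compress F i g)))) (map (\<lambda>c. \<alpha> (code_var c)) vs))) ws) = \<alpha> (Y i)"
proof -
  let ?a = "map (\<lambda>c. \<alpha> (code_var c)) vs"
  \<comment> \<open>Otherwise flipping \<open>Y i\<close> would give a second model with the same
    preceding variables. Hence the target index points to a real position and not to the default
    \<open>False\<close>.\<close>
  have "Y i \<in> formula_vars F"
  proof (rule ccontr)
    assume "Y i \<notin> formula_vars F"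
    then have "holds F \<alpha> = holds F (\<alpha>(Y i := \<not> \<alpha> (Y i)))" by (intro holds_cong) auto
    then have "holds F (\<alpha>(Y i := \<not> \<alpha> (Y i)))" using \<alpha> by simp
    moreover have "\<forall>z\<in>preceding_vars n i. \<alpha> z = (\<alpha>(Y i := \<not> \<alpha> (Y i))) z" by (auto simp: preceding_vars_def)
    ultimately have "\<alpha> (Y i) = (\<alpha>(Y i := \<not> \<alpha> (Y i))) (Y i)" using u \<alpha> unfolding uniquely_defined_def by blast
    then show False by simp
  qed
  then have y: "var_code (Y i) \<in> set vs" unfolding vs_def var_code_token_vars[symmetric] .
  have "holds F (assignment_of vs ?a)"
    using \<alpha> holds_cong[of F \<alpha> "assignment_of vs ?a"] assignment_of_map[of _ vs \<alpha>]
    by (simp add: vs_def var_code_token_vars)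
  then have "eval_tokens (fst (compress F i g)) ?a" by (simp add: compress_def Let_def eval_tokens_holds vs_def[symmetric])
  moreover have "\<not> counterexample (compress F i g) ws ?a"
    using ws by (simp add: adequate_def compress_def Let_def vs_def)
  ultimately show ?thesis
    using assignment_of_map[OF y, of \<alpha>]
    by (simp add: counterexample_def compress_def Let_def vs_def[symmetric] assignment_of_def)
qed

section \<open>Building the circuit\<close>

text \<open>\<open>Wire 0\<close> is the constant \<open>True\<close> that
  \<open>input_gates\<close> puts first, hence the empty conjunction. In the functions below
  \<open>Wire 1\<close>, the constant \<open>False\<close>, takes the part of the default of
  \<open>hd_bit\<close>.\<close>

definition mask_gates :: "gate list \<Rightarrow> wire list \<Rightarrow> bool list \<Rightarrow> (gate list \<times> wire) \<times> bool list" where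
  "mask_gates gs ls w = foldl (\<lambda>s l.
     (if hd_bit (snd s) then (fst (fst s) @ [And_Gate (snd (fst s)) l], Wire (length (fst (fst s)))) else fst s, tl (snd s)))
     ((gs, Wire 0), w) ls"

definition hyp_gates_step :: "gate list \<times> wire list \<times> bool list \<Rightarrow> gate list \<times> wire list \<times> bool list" where
  "hyp_gates_step s = (let r = mask_gates (fst s) (fst (snd s)) (snd (snd s)) in
     (fst (fst r) @ [Not_Gate (snd (fst r))], snd (fst r) # Wire (length (fst (fst r))) # fst (snd s), snd r))"

definition hyp_gates :: "nat \<Rightarrow> gate list \<Rightarrow> wire list \<Rightarrow> bool list \<Rightarrow> gate list \<times> wire" where
  "hyp_gates g gs ls w = (let s = (hyp_gates_step ^^ g) (gs, ls, w) in (fst s, hd_default (Wire 1) (fst (snd s))))"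

text \<open>One pass of an insertion-sorting network: \<open>Or_Gate\<close> is the maximum and
  stays, \<open>And_Gate\<close> is the minimum and travels on. Sorting the votes turns counting
  into reading the middle wire.\<close>

definition insert_gates :: "gate list \<Rightarrow> wire list \<Rightarrow> wire \<Rightarrow> gate list \<times> wire list" where
  "insert_gates gs ts u = (let s = foldl (\<lambda>s t.
     ((fst (fst s) @ [Or_Gate t (snd (fst s)), And_Gate t (snd (fst s))], Wire (Suc (length (fst (fst s))))),
      snd s @ [Wire (length (fst (fst s)))])) ((gs, u), []) ts
     in (fst (fst s), snd s @ [snd (fst s)]))"

text \<open>Mirrors \<open>literals\<close>: hidden positions get the constant \<open>False\<close>
  twice.\<close>

definition input_gates :: "((nat \<times> nat) \<times> bool) list \<Rightarrow> gate list \<times> wire list" where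
  "input_gates zs = foldl (\<lambda>s z. if snd z
     then (fst s @ [Not_Gate (Input (code_var (fst z)))], snd s @ [Input (code_var (fst z)), Wire (length (fst s))])
     else (fst s, snd s @ [Wire 1, Wire 1])) ([Const_Gate True, Const_Gate False], [Wire 0, Wire 1]) zs"

definition vote_gates :: "nat \<Rightarrow> gate list \<times> wire list \<Rightarrow> bool list list \<Rightarrow> gate list \<times> wire list" where
  "vote_gates g s0 ws = foldl (\<lambda>s w. let r = hyp_gates g (fst s) (snd s0) w in insert_gates (fst r) (snd s) (snd r))
     (fst s0, []) ws"

definition majority_circuit :: "(nat \<times> nat) list \<Rightarrow> bool list \<Rightarrow> nat \<Rightarrow> bool list list \<Rightarrow> circuit" where
  "majority_circuit vs pre g ws = (let s = vote_gates g (input_gates (zip vs pre)) ws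
     in Circuit (fst s) (hd_default (Wire 1) (drop (length ws div 2) (snd s))))"

subsection \<open>Correctness\<close>

definition gates_ok :: "var set \<Rightarrow> gate list \<Rightarrow> bool" where
  "gates_ok Z gs \<longleftrightarrow> (\<forall>k < length gs. gate_ok Z k (gs ! k))"

text \<open>Joins well-formedness and value of a wire. Both persist when gates are appended, so
  wires built earlier can be reused freely.\<close>

definition carries :: "var set \<Rightarrow> assignment \<Rightarrow> gate list \<Rightarrow> wire \<Rightarrow> bool \<Rightarrow> bool" where
  "carries Z a gs u b \<longleftrightarrow> wire_ok Z (length gs) u \<and> wire_value a (gate_values a gs) u = b"

lemma gates_ok_snoc: "gates_ok Z (gs @ [g]) \<longleftrightarrow> gates_ok Z gs \<and> gate_ok Z (length gs) g"
  by (auto simp: gates_ok_def nth_append less_Suc_eq)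

lemma wire_ok_mono: "wire_ok Z k u \<Longrightarrow> k \<le> k' \<Longrightarrow> wire_ok Z k' u"
  by (cases u) auto

lemma gate_values_append: "\<exists>vs. gate_values a (gs @ hs) = gate_values a gs @ vs"
proof (induction hs rule: rev_induct)
  case (snoc h hs)
  then show ?case using gate_values_snoc[of a "gs @ hs" h] by auto
qed simp

lemma carries_append: "carries Z a gs u b \<Longrightarrow> carries Z a (gs @ hs) u b"
proof -
  assume u: "carries Z a gs u b"
  obtain vs where "gate_values a (gs @ hs) = gate_values a gs @ vs" using gate_values_append by blast
  then show ?thesis using u wire_value_append[of Z "gate_values a gs" u a vs] wire_ok_mono[of Z "length gs" u "length (gs @ hs)"]
    by (simp add: carries_def)
qed

lemma carries_new: "gate_value a (gate_values a gs) g = b \<Longrightarrow> carries Z a (gs @ [g]) (Wire (length gs)) b"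
  by (simp add: carries_def gate_values_snoc nth_append)

definition extends :: "gate list \<Rightarrow> gate list \<Rightarrow> bool" where
  "extends gs gs' \<longleftrightarrow> (\<exists>hs. gs' = gs @ hs)"

lemma extends_refl [simp]: "extends gs gs" and extends_app [simp]: "extends gs (gs @ hs)"
  by (auto simp: extends_def)

lemma extends_trans: "extends gs gs' \<Longrightarrow> extends gs' gs'' \<Longrightarrow> extends gs gs''"
  by (auto simp: extends_def)

lemma carries_extends: "extends gs gs' \<Longrightarrow> carries Z a gs u b \<Longrightarrow> carries Z a gs' u b"
  by (auto simp: extends_def intro: carries_append)

lemma carries_list_extends:
  "list_all2 (carries Z a gs) us bs \<Longrightarrow> extends gs gs' \<Longrightarrow> list_all2 (carries Z a gs') us bs"
  by (erule list_all2_mono) (rule carries_extends)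

text \<open>A simulation: the builder does with wires what \<open>read_mask\<close> does with bits,
  related by \<open>list_all2 (carries Z a gs)\<close>, and both consume the same part of the
  string.\<close>

lemma mask_gates_correct:
  fixes w
  assumes "gates_ok Z gs" "carries Z a gs (Wire 0) True" "list_all2 (carries Z a gs) ls bs"
  defines "r \<equiv> mask_gates gs ls w"
  shows "extends gs (fst (fst r)) \<and> gates_ok Z (fst (fst r)) \<and>
    carries Z a (fst (fst r)) (snd (fst r)) (fst (read_mask bs w)) \<and> snd r = snd (read_mask bs w)"
proof -
  let ?f = "\<lambda>s l. (if hd_bit (snd s) then (fst (fst s) @ [And_Gate (snd (fst s)) l], Wire (length (fst (fst s)))) else fst s, tl (snd s))"
  let ?g = "\<lambda>s l. (fst s \<and> (hd_bit (snd s) \<longrightarrow> l), tl (snd s))"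
  have "extends gs (fst (fst (foldl ?f ((gs, u), w) ls))) \<and> gates_ok Z (fst (fst (foldl ?f ((gs, u), w) ls))) \<and>
    carries Z a (fst (fst (foldl ?f ((gs, u), w) ls))) (snd (fst (foldl ?f ((gs, u), w) ls))) (fst (foldl ?g (b, w) bs)) \<and>
    snd (foldl ?f ((gs, u), w) ls) = snd (foldl ?g (b, w) bs)"
    if "gates_ok Z gs" "carries Z a gs u b" "list_all2 (carries Z a gs) ls bs" for gs u b
    using that
  proof (induction ls arbitrary: gs u b w bs)
    case Nil
    then show ?case by simp
  next
    case (Cons l ls)
    then obtain y bs' where bs: "bs = y # bs'" "carries Z a gs l y" "list_all2 (carries Z a gs) ls bs'"
      by (auto simp: list_all2_Cons1)
    show ?case
    proof (cases "hd_bit w")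
      case True
      let ?gs = "gs @ [And_Gate u l]"
      have ok: "gates_ok Z ?gs" using Cons.prems bs(2) by (simp add: gates_ok_snoc carries_def)
      have c: "carries Z a ?gs (Wire (length gs)) (b \<and> y)"
        by (rule carries_new) (use Cons.prems bs(2) in \<open>simp add: carries_def\<close>)
      have "list_all2 (carries Z a ?gs) ls bs'" using bs(3) by (rule carries_list_extends) simp
      from Cons.IH[OF ok c this, of "tl w"] show ?thesis
        using True bs(1) extends_trans[OF extends_app[of gs "[And_Gate u l]"]] by simp
    next
      case False
      then show ?thesis using Cons.IH[OF Cons.prems(1,2) bs(3), of "tl w"] bs(1) by simp
    qed
  qed
  from this[OF assms(1-3)] show ?thesis by (simp add: mask_gates_def read_mask_def r_def)
qed

lemma hyp_gates_step_correct:
  fixes w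
  assumes "gates_ok Z gs" "carries Z a gs (Wire 0) True" "list_all2 (carries Z a gs) ls bs"
  defines "s \<equiv> hyp_gates_step (gs, ls, w)"
  shows "extends gs (fst s) \<and> gates_ok Z (fst s) \<and>
    list_all2 (carries Z a (fst s)) (fst (snd s)) (fst (hyp_step (bs, w))) \<and> snd (snd s) = snd (hyp_step (bs, w))"
proof -
  define r where "r = mask_gates gs ls w"
  have r: "extends gs (fst (fst r))" "gates_ok Z (fst (fst r))"
    "carries Z a (fst (fst r)) (snd (fst r)) (fst (read_mask bs w))" "snd r = snd (read_mask bs w)"
    using mask_gates_correct[OF assms(1-3), of w] by (auto simp: r_def)
  let ?gs = "fst (fst r) @ [Not_Gate (snd (fst r))]"
  have "extends gs ?gs" using r(1) extends_trans by simp
  moreover have "gates_ok Z ?gs" using r(2,3) by (simp add: gates_ok_snoc carries_def)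
  moreover have "carries Z a ?gs (Wire (length (fst (fst r)))) (\<not> fst (read_mask bs w))"
    by (rule carries_new) (use r(3) in \<open>simp add: carries_def\<close>)
  moreover have "carries Z a ?gs (snd (fst r)) (fst (read_mask bs w))" using r(3) by (rule carries_append)
  moreover have "list_all2 (carries Z a ?gs) ls bs" using assms(3) calculation(1) by (rule carries_list_extends)
  ultimately show ?thesis using r(4) by (simp add: s_def hyp_gates_step_def hyp_step_def Let_def r_def)
qed

lemma hyp_gates_correct:
  fixes g w
  assumes "gates_ok Z gs" "carries Z a gs (Wire 0) True" "carries Z a gs (Wire 1) False" "list_all2 (carries Z a gs) ls bs"
  defines "r \<equiv> hyp_gates g gs ls w"
  shows "extends gs (fst r) \<and> gates_ok Z (fst r) \<and> carries Z a (fst r) (snd r) (hyp_value g bs w)"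
proof -
  define s where "s k = (hyp_gates_step ^^ k) (gs, ls, w)" for k
  define h where "h k = (hyp_step ^^ k) (bs, w)" for k
  have inv: "extends gs (fst (s k)) \<and> gates_ok Z (fst (s k)) \<and>
    list_all2 (carries Z a (fst (s k))) (fst (snd (s k))) (fst (h k)) \<and> snd (snd (s k)) = snd (h k)" for k
  proof (induction k)
    case (Suc k)
    have "carries Z a (fst (s k)) (Wire 0) True" using Suc assms(2) carries_extends by blast
    moreover have "(fst (s k), fst (snd (s k)), snd (h k)) = s k" "(fst (h k), snd (h k)) = h k"
      using Suc by (simp_all add: prod_eq_iff)
    moreover have "s (Suc k) = hyp_gates_step (s k)" "h (Suc k) = hyp_step (h k)"
      by (simp_all add: s_def h_def)
    ultimately show ?case
      using hyp_gates_step_correct[of Z "fst (s k)" a "fst (snd (s k))" "fst (h k)" "snd (h k)"] Suc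
        extends_trans[of gs "fst (s k)" "fst (s (Suc k))"] by simp
  qed (use assms in \<open>simp add: s_def h_def\<close>)
  from inv[of g] have i: "extends gs (fst (s g))" "gates_ok Z (fst (s g))"
    "list_all2 (carries Z a (fst (s g))) (fst (snd (s g))) (fst (h g))" by auto
  have "carries Z a (fst (s g)) (hd_default (Wire 1) (fst (snd (s g)))) (hd_bit (fst (h g)))"
    using i(3) carries_extends[OF i(1) assms(3)] by (cases "fst (snd (s g))") (auto simp: list_all2_Cons1)
  then show ?thesis using i by (simp add: r_def hyp_gates_def hyp_value_def s_def h_def Let_def)
qed

definition sorted_bits :: "bool list \<Rightarrow> bool list" where
  "sorted_bits bs = replicate (length (filter (\<lambda>b. b) bs)) True @ replicate (length (filter Not bs)) False"

lemma insert_gates_correct: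
  assumes "gates_ok Z gs" "list_all2 (carries Z a gs) ts (sorted_bits bs)" "carries Z a gs u b"
  defines "r \<equiv> insert_gates gs ts u"
  shows "extends gs (fst r) \<and> gates_ok Z (fst r) \<and> list_all2 (carries Z a (fst r)) (snd r) (sorted_bits (bs @ [b]))"
proof -
  let ?f = "\<lambda>s t. ((fst (fst s) @ [Or_Gate t (snd (fst s)), And_Gate t (snd (fst s))], Wire (Suc (length (fst (fst s))))),
      snd s @ [Wire (length (fst (fst s)))])"
  let ?g = "\<lambda>s t. (fst s \<and> t, snd s @ [t \<or> fst s])"
  have main: "extends gs (fst (fst (foldl ?f ((gs, u), us) ts))) \<and> gates_ok Z (fst (fst (foldl ?f ((gs, u), us) ts))) \<and>
    carries Z a (fst (fst (foldl ?f ((gs, u), us) ts))) (snd (fst (foldl ?f ((gs, u), us) ts))) (fst (foldl ?g (b, cs) ys)) \<and>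
    list_all2 (carries Z a (fst (fst (foldl ?f ((gs, u), us) ts)))) (snd (foldl ?f ((gs, u), us) ts)) (snd (foldl ?g (b, cs) ys))"
    if "gates_ok Z gs" "carries Z a gs u b" "list_all2 (carries Z a gs) ts ys" "list_all2 (carries Z a gs) us cs" for gs u b ts ys us cs
    using that
  proof (induction ts arbitrary: gs u b us ys cs)
    case Nil
    then show ?case by simp
  next
    case (Cons t ts)
    then obtain y ys' where ys: "ys = y # ys'" "carries Z a gs t y" "list_all2 (carries Z a gs) ts ys'"
      by (auto simp: list_all2_Cons1)
    let ?gs1 = "gs @ [Or_Gate t u]"
    let ?gs = "?gs1 @ [And_Gate t u]"
    have c1: "carries Z a ?gs1 u b" "carries Z a ?gs1 t y" using Cons.prems(2) ys(2) carries_append by blast+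
    have ok: "gates_ok Z ?gs" 
      unfolding gates_ok_snoc using Cons.prems(1,2) ys(2) c1 by (simp add: carries_def)
    have e: "extends gs ?gs" unfolding append_assoc by (rule extends_app)
    have c: "carries Z a ?gs (Wire (length ?gs1)) (b \<and> y)"
      by (rule carries_new) (use c1 in \<open>auto simp: carries_def\<close>)
    have o1: "carries Z a ?gs1 (Wire (length gs)) (y \<or> b)"
      by (rule carries_new) (use Cons.prems(2) ys(2) in \<open>auto simp: carries_def\<close>)
    have o: "list_all2 (carries Z a ?gs) (us @ [Wire (length gs)]) (cs @ [y \<or> b])"
      using carries_list_extends[OF Cons.prems(4) e] carries_append[OF o1] by (simp add: list_all2_appendI)
    from Cons.IH[OF ok c carries_list_extends[OF ys(3) e] o] show ?case
      using ys(1) extends_trans[OF e] by simp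
  qed
  \<comment> \<open>Past the \<open>True\<close> entries the travelling value stays
    \<open>b\<close>. The first \<open>False\<close> entry is replaced by \<open>b\<close>, and
    \<open>False\<close> travels on from there; so \<open>b\<close> is inserted at the
    boundary.\<close>
  have "snd (foldl ?g (b, cs) (replicate k True @ replicate l False)) @ [fst (foldl ?g (b, cs) (replicate k True @ replicate l False))]
      = cs @ replicate k True @ (if b then True # replicate l False else False # replicate l False)" for b cs k l
  proof (induction k arbitrary: cs)
    case 0
    have "snd (foldl ?g (b, cs) (replicate l False)) @ [fst (foldl ?g (b, cs) (replicate l False))]
      = cs @ (if b then True # replicate l False else False # replicate l False)" for b cs
      by (induction l arbitrary: b cs) (auto simp: replicate_append_same)
    then show ?case by simp
  next
    case (Suc k)
    show ?case using Suc[of "cs @ [True]"] by simp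
  qed
  from this[of b "[]" "length (filter (\<lambda>b. b) bs)" "length (filter Not bs)"]
  have g: "snd (foldl ?g (b, []) (sorted_bits bs)) @ [fst (foldl ?g (b, []) (sorted_bits bs))] = sorted_bits (bs @ [b])"
    by (cases b) (simp_all add: sorted_bits_def replicate_app_Cons_same)
  show ?thesis using main[OF assms(1,3,2), of "[]" "[]"] unfolding g[symmetric] r_def insert_gates_def Let_def
    by (simp add: list_all2_appendI)
qed

lemma vote_gates_correct:
  fixes g ws
  assumes "gates_ok Z (fst s0)" "carries Z a (fst s0) (Wire 0) True" "carries Z a (fst s0) (Wire 1) False"
    and "list_all2 (carries Z a (fst s0)) (snd s0) bs"
  defines "s \<equiv> vote_gates g s0 ws"
  shows "extends (fst s0) (fst s) \<and> gates_ok Z (fst s) \<and>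
    list_all2 (carries Z a (fst s)) (snd s) (sorted_bits (map (hyp_value g bs) ws))"
  unfolding s_def
proof (induction ws rule: rev_induct)
  case Nil
  then show ?case using assms by (simp add: vote_gates_def sorted_bits_def)
next
  case (snoc w ws)
  define s where "s = vote_gates g s0 ws"
  define r where "r = hyp_gates g (fst s) (snd s0) w"
  have s: "extends (fst s0) (fst s)" "gates_ok Z (fst s)"
    "list_all2 (carries Z a (fst s)) (snd s) (sorted_bits (map (hyp_value g bs) ws))"
    using snoc by (auto simp: s_def)
  have r: "extends (fst s) (fst r)" "gates_ok Z (fst r)" "carries Z a (fst r) (snd r) (hyp_value g bs w)"
    using hyp_gates_correct[OF s(2) carries_extends[OF s(1) assms(2)] carries_extends[OF s(1) assms(3)]
      carries_list_extends[OF assms(4) s(1)], of g w] by (auto simp: r_def)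
  have "vote_gates g s0 (ws @ [w]) = insert_gates (fst r) (snd s) (snd r)"
    by (simp add: vote_gates_def Let_def r_def s_def)
  then show ?case
    using insert_gates_correct[OF r(2) carries_list_extends[OF s(3) r(1)] r(3)] extends_trans s(1) r(1) by auto
qed

lemma input_gates_correct:
  assumes "\<And>z. z \<in> set zs \<Longrightarrow> snd z \<Longrightarrow> code_var (fst z) \<in> Z"
  defines "s \<equiv> input_gates zs"
  shows "gates_ok Z (fst s) \<and> carries Z a (fst s) (Wire 0) True \<and> carries Z a (fst s) (Wire 1) False \<and>
    list_all2 (carries Z a (fst s)) (snd s)
      (True # False # concat (map (\<lambda>z. [snd z \<and> a (code_var (fst z)), snd z \<and> \<not> a (code_var (fst z))]) zs))"
  using assms(1) unfolding s_def
proof (induction zs rule: rev_induct)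
  case Nil
  have "gates_ok Z [Const_Gate True, Const_Gate False]" by (auto simp: gates_ok_def less_Suc_eq)
  then show ?case by (simp add: input_gates_def carries_def gate_values_def)
next
  case (snoc z zs)
  define s where "s = input_gates zs"
  have s: "gates_ok Z (fst s)" "carries Z a (fst s) (Wire 0) True" "carries Z a (fst s) (Wire 1) False"
    "list_all2 (carries Z a (fst s)) (snd s)
      (True # False # concat (map (\<lambda>z. [snd z \<and> a (code_var (fst z)), snd z \<and> \<not> a (code_var (fst z))]) zs))"
    using snoc by (auto simp: s_def)
  show ?case
  proof (cases "snd z")
    case True
    let ?v = "code_var (fst z)"
    let ?gs = "fst s @ [Not_Gate (Input ?v)]"
    have v: "?v \<in> Z" using snoc.prems True by simp
    have ok: "gates_ok Z ?gs" using s(1) v by (simp add: gates_ok_snoc)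
    have c: "carries Z a ?gs (Wire (length (fst s))) (\<not> a ?v)" by (rule carries_new) simp
    have i: "carries Z a ?gs (Input ?v) (a ?v)" using v by (simp add: carries_def)
    have e: "input_gates (zs @ [z]) = (?gs, snd s @ [Input ?v, Wire (length (fst s))])"
      using True by (simp add: input_gates_def s_def)
    have "list_all2 (carries Z a ?gs) (snd s @ [Input ?v, Wire (length (fst s))])
      ((True # False # concat (map (\<lambda>z. [snd z \<and> a (code_var (fst z)), snd z \<and> \<not> a (code_var (fst z))]) zs)) @ [a ?v, \<not> a ?v])"
      by (rule list_all2_appendI[OF carries_list_extends[OF s(4) extends_app]]) (use c i in simp)
    then show ?thesis unfolding e using ok carries_append[OF s(2)] carries_append[OF s(3)] True by simp
  next
    case False
    have e: "input_gates (zs @ [z]) = (fst s, snd s @ [Wire 1, Wire 1])"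
      using False by (simp add: input_gates_def s_def)
    have "list_all2 (carries Z a (fst s)) (snd s @ [Wire 1, Wire 1])
      ((True # False # concat (map (\<lambda>z. [snd z \<and> a (code_var (fst z)), snd z \<and> \<not> a (code_var (fst z))]) zs)) @ [False, False])"
      by (rule list_all2_appendI[OF s(4)]) (use s(3) in simp)
    then show ?thesis unfolding e using s False by simp
  qed
qed

text \<open>With k of n votes for \<open>True\<close>, position \<open>n div 2\<close> of the sorted
  list is \<open>True\<close> iff \<open>n div 2 < k\<close>, that is, iff n is less than twice k.
  For the empty list both sides are \<open>False\<close>.\<close>

lemma sorted_bits_median: "nth_bit (sorted_bits bs) (length bs div 2) = majority bs"
proof -
  have l: "length bs = length (filter (\<lambda>b. b) bs) + length (filter Not bs)"
    using sum_length_filter_compl[of "\<lambda>b. b" bs] by simp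
  show ?thesis unfolding nth_bit_eq sorted_bits_def majority_def
    unfolding l by (cases "length (filter Not bs) < length (filter (\<lambda>b. b) bs)") (auto simp: nth_append)
qed

lemma literals_map:
  "literals (map p vs) (map f vs) = True # False # concat (map (\<lambda>z. [snd z \<and> f (fst z), snd z \<and> \<not> f (fst z)]) (zip vs (map p vs)))"
proof -
  have "concat (map (\<lambda>z. [fst z \<and> snd z, fst z \<and> \<not> snd z]) (zip (map p vs) (map f vs))) =
    concat (map (\<lambda>z. [snd z \<and> f (fst z), snd z \<and> \<not> f (fst z)]) (zip vs (map p vs)))"
    by (induction vs) auto
  then show ?thesis by (simp only: literals_def)
qed

lemma majority_circuit_correct:
  fixes g ws
  assumes Z: "\<And>v. v \<in> set vs \<Longrightarrow> p v \<Longrightarrow> code_var v \<in> Z"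
  defines "C \<equiv> majority_circuit vs (map p vs) g ws"
  shows "circuit_on Z C"
    "circuit_value C a = majority (map (hyp_value g (literals (map p vs) (map (\<lambda>v. a (code_var v)) vs))) ws)"
proof -
  define s0 where "s0 = input_gates (zip vs (map p vs))"
  define s where "s = vote_gates g s0 ws"
  let ?bs = "\<lambda>a. literals (map p vs) (map (\<lambda>v. a (code_var v)) vs)"
  have zz: "code_var (fst z) \<in> Z" if "z \<in> set (zip vs (map p vs))" "snd z" for z
    using that Z by (auto simp: zip_map2 zip_same_conv_map)
  have s0: "gates_ok Z (fst s0)" "carries Z a (fst s0) (Wire 0) True" "carries Z a (fst s0) (Wire 1) False"
    "list_all2 (carries Z a (fst s0)) (snd s0) (?bs a)" for a
    using input_gates_correct[of "zip vs (map p vs)" Z a] zz unfolding literals_map s0_def by auto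
  have s: "extends (fst s0) (fst s)" "gates_ok Z (fst s)"
    "list_all2 (carries Z a (fst s)) (snd s) (sorted_bits (map (hyp_value g (?bs a)) ws))" for a
    using vote_gates_correct[OF s0(1) s0(2) s0(3) s0(4)[of a], of g ws] by (auto simp: s_def)
  let ?u = "hd_default (Wire 1) (drop (length ws div 2) (snd s))"
  have C: "C = Circuit (fst s) ?u" by (simp add: C_def majority_circuit_def s_def s0_def Let_def)
  have u: "carries Z a (fst s) ?u (nth_bit (sorted_bits (map (hyp_value g (?bs a)) ws)) (length ws div 2))" for a
  proof -
    have d: "list_all2 (carries Z a (fst s)) (drop (length ws div 2) (snd s))
        (drop (length ws div 2) (sorted_bits (map (hyp_value g (?bs a)) ws)))"
      using s(3) by (rule list_all2_dropI)
    show ?thesis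
    proof (cases "drop (length ws div 2) (snd s)")
      case Nil
      then have "drop (length ws div 2) (sorted_bits (map (hyp_value g (?bs a)) ws)) = []"
        using d by (metis list_all2_Nil)
      then show ?thesis using carries_extends[OF s(1) s0(3)] unfolding Nil nth_bit_def by simp
    next
      case (Cons x xs)
      then obtain y ys where "drop (length ws div 2) (sorted_bits (map (hyp_value g (?bs a)) ws)) = y # ys"
        "carries Z a (fst s) x y" using d by (metis list_all2_Cons1)
      then show ?thesis unfolding Cons nth_bit_def by simp
    qed
  qed
  show "circuit_on Z C" using s(2) u unfolding C by (simp add: circuit_on_def gates_ok_def carries_def)
  show "circuit_value C a = majority (map (hyp_value g (?bs a)) ws)"
    using u[of a] sorted_bits_median[of "map (hyp_value g (?bs a)) ws"] unfolding C
    by (simp add: circuit_value_def carries_def)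
qed

subsection \<open>Size bounds\<close>

lemma enc_wire: "enc (Input v) = enc (0::nat, v)" "enc (Wire k) = enc (1::nat, k)"
  by (simp_all add: enc_wire_def enc_var_def enc_nat_def enc_prod_def)

lemma enc_gate:
  "enc (Const_Gate b) = enc (0::nat, b)" "enc (Not_Gate u) = enc (1::nat, u)"
  "enc (And_Gate u v) = enc (2::nat, u, v)" "enc (Or_Gate u v) = enc (3::nat, u, v)"
  by (simp_all add: enc_gate_def enc_wire_def enc_nat_def enc_prod_def enc_bool_def)

lemma enc_circuit: "enc (Circuit gs u) = enc (gs, u)"
  by (simp add: enc_circuit_def tree_of_circuit_def enc_list_def enc_gate_def[abs_def] enc_wire_def)

lemma esize_wire [simp]: "esize (Wire k) = k + 2"
  by (simp add: enc_wire)

lemma esize_gate [simp]: "esize (Not_Gate u) = esize u + 2" "esize (And_Gate u v) = esize u + esize v + 4"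
  "esize (Or_Gate u v) = esize u + esize v + 5"
  by (simp_all add: enc_gate)

lemma esize_code_var: "esize (code_var c) \<le> esize c + 1"
  by (simp add: code_var_def enc_var esize_prod)

lemma esize_input: "esize (Input (code_var c)) \<le> esize c + 2"
  using esize_code_var[of c] by (simp add: enc_wire)

lemma ptime_wire [ptime_intros]:
  "ptime d A k \<Longrightarrow> ptime d A (\<lambda>x. Wire (k x))"
  "ptime d A v \<Longrightarrow> ptime d A (\<lambda>x. Input (v x))"
  by (rule ptime_recode[where g = "\<lambda>x. (1::nat, k x)"], intro ptime_intros, assumption, rule enc_wire)
    (rule ptime_recode[where g = "\<lambda>x. (0::nat, v x)"], intro ptime_intros, assumption, rule enc_wire)

lemma ptime_Not_Gate [ptime_intros]: "ptime d A u \<Longrightarrow> ptime d A (\<lambda>x. Not_Gate (u x))"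
  by (rule ptime_recode[where g = "\<lambda>x. (1::nat, u x)"]) (intro ptime_intros, assumption, rule enc_gate)

lemma ptime_binary_gate [ptime_intros]:
  assumes "ptime d A u" "ptime d A v"
  shows "ptime d A (\<lambda>x. And_Gate (u x) (v x))" "ptime d A (\<lambda>x. Or_Gate (u x) (v x))"
  by (rule ptime_recode[where g = "\<lambda>x. (2::nat, u x, v x)"], intro ptime_intros assms, rule enc_gate)
    (rule ptime_recode[where g = "\<lambda>x. (3::nat, u x, v x)"], intro ptime_intros assms, rule enc_gate)

lemma ptime_code_var [ptime_intros]: "ptime d A c \<Longrightarrow> ptime d A (\<lambda>x. code_var (c x))"
  by (rule ptime_recode[where g = "\<lambda>x. if fst (c x) = 0 then (0, snd (c x)) else (1::nat, snd (c x))"])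
    (intro ptime_intros, assumption+, simp add: code_var_def enc_var)

lemma pbounded_length: "ptime d A l \<Longrightarrow> pbounded (\<lambda>x. length (l x))"
  using ptime_esize[OF ptime_length] by simp

lemma pbounded_nat: "ptime d A n \<Longrightarrow> pbounded (\<lambda>x. n x :: nat)"
  using ptime_esize[of d A n] by simp

text \<open>Wires are unary, so a gate's size grows with the number of gates before it. Fixing in
  advance a bound \<open>W\<close> on all wires makes the growth per step uniform.\<close>

lemma mask_gates_bounds:
  assumes "\<And>l. l \<in> set ls \<Longrightarrow> esize l \<le> W" "length gs + length ls + 2 \<le> W"
  shows "length (fst (fst (mask_gates gs ls w))) \<le> length gs + length ls \<and>
    esize (fst (fst (mask_gates gs ls w))) \<le> esize gs + length ls * (2 * W + 5) \<and>
    esize (snd (fst (mask_gates gs ls w))) \<le> W \<and> snd (mask_gates gs ls w) = drop (length ls) w"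
  using assms
proof (induction ls rule: rev_induct)
  case Nil
  then show ?case by (simp add: mask_gates_def)
next
  case (snoc l ls)
  define r where "r = mask_gates gs ls w"
  have r: "length (fst (fst r)) \<le> length gs + length ls" "esize (fst (fst r)) \<le> esize gs + length ls * (2 * W + 5)"
    "esize (snd (fst r)) \<le> W" "snd r = drop (length ls) w"
    using snoc by (auto simp: r_def)
  have e: "mask_gates gs (ls @ [l]) w = (if hd_bit (snd r) then (fst (fst r) @ [And_Gate (snd (fst r)) l], Wire (length (fst (fst r)))) else fst r, tl (snd r))"
    by (simp add: mask_gates_def r_def)
  have "esize l \<le> W" using snoc.prems by simp
  then show ?case unfolding e using r snoc.prems(2) by (auto simp: esize_append tl_drop drop_Suc)
qed

lemma ptime_mask_gates [ptime_intros]: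
  assumes gs: "ptime d A gs" and ls: "ptime d A ls" and w: "ptime d A w"
  shows "ptime d A (\<lambda>x. mask_gates (gs x) (ls x) (w x))"
proof -
  let ?W = "\<lambda>x. esize (ls x) + (length (gs x) + length (ls x) + 2)"
  let ?B = "\<lambda>x. esize (gs x) + length (ls x) * (2 * ?W x + 5) + ?W x + esize (w x) + 2"
  show ?thesis unfolding mask_gates_def
  proof (rule ptime_foldl_bounded[where B = ?B])
    show "pbounded ?B"
      by (intro pbounded_intros ptime_esize[OF gs] ptime_esize[OF ls] ptime_esize[OF w] pbounded_length[OF gs] pbounded_length[OF ls])
    fix x ys zs assume l: "ls x = ys @ zs"
    have "\<And>l. l \<in> set ys \<Longrightarrow> esize l \<le> ?W x" using l esize_mem[of _ "ls x"] by fastforce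
    moreover have "length (gs x) + length ys + 2 \<le> ?W x" using l by simp
    ultimately have b: "length (fst (fst (mask_gates (gs x) ys (w x)))) \<le> length (gs x) + length ys \<and>
      esize (fst (fst (mask_gates (gs x) ys (w x)))) \<le> esize (gs x) + length ys * (2 * ?W x + 5) \<and>
      esize (snd (fst (mask_gates (gs x) ys (w x)))) \<le> ?W x \<and> snd (mask_gates (gs x) ys (w x)) = drop (length ys) (w x)"
      by (rule mask_gates_bounds)
    have m: "length ys * (2 * ?W x + 5) \<le> length (ls x) * (2 * ?W x + 5)" using l by (intro mult_right_mono) auto
    have arith: "a \<le> E + m1 \<Longrightarrow> m1 \<le> m2 \<Longrightarrow> b \<le> W \<Longrightarrow> c \<le> v \<Longrightarrow> Suc (Suc (a + b) + c) \<le> E + m2 + W + v + 2"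
      for a b c E m1 m2 W v :: nat by linarith
    have "esize (mask_gates (gs x) ys (w x)) \<le> ?B x"
      unfolding esize_prod[of "mask_gates _ _ _"] esize_prod[of "fst (mask_gates _ _ _)"]
      by (rule arith[OF _ m]) (use b esize_drop[of "length ys" "w x"] in \<open>simp_all only:\<close>)
    then show "esize (foldl (\<lambda>s l. (if hd_bit (snd s) then (fst (fst s) @ [And_Gate (snd (fst s)) l], Wire (length (fst (fst s)))) else fst s, tl (snd s)))
      ((gs x, Wire 0), w x) ys) \<le> ?B x" unfolding mask_gates_def .
  qed (intro ptime_intros gs ls w)+
qed

text \<open>There are never more than \<open>length ls + 2 * g\<close> literals, so a mask costs at
  most that many And gates and one Not gate. \<open>W\<close> has to exceed the final gate
  count.\<close>

lemma hyp_gates_steps_bounds: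
  fixes w :: "bool list"
  assumes ls: "\<And>l. l \<in> set ls \<Longrightarrow> esize l \<le> W"
    and W: "length gs + g * (length ls + 2 * g + 1) + length ls + 2 * g + 2 \<le> W" and k: "k \<le> g"
  defines "s \<equiv> (hyp_gates_step ^^ k) (gs, ls, w)"
  shows "length (fst s) \<le> length gs + k * (length ls + 2 * g + 1) \<and>
    esize (fst s) \<le> esize gs + k * ((length ls + 2 * g) * (2 * W + 5) + W + 3) \<and>
    length (fst (snd s)) = length ls + 2 * k \<and> (\<forall>u\<in>set (fst (snd s)). esize u \<le> W) \<and>
    esize (snd (snd s)) \<le> esize w"
  using k unfolding s_def
proof (induction k)
  case 0
  then show ?case using ls by simp
next
  case (Suc k)
  define s where "s = (hyp_gates_step ^^ k) (gs, ls, w)"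
  have s: "length (fst s) \<le> length gs + k * (length ls + 2 * g + 1)"
    "esize (fst s) \<le> esize gs + k * ((length ls + 2 * g) * (2 * W + 5) + W + 3)"
    "length (fst (snd s)) = length ls + 2 * k" "\<And>u. u \<in> set (fst (snd s)) \<Longrightarrow> esize u \<le> W"
    "esize (snd (snd s)) \<le> esize w"
    using Suc by (auto simp: s_def)
  define r where "r = mask_gates (fst s) (fst (snd s)) (snd (snd s))"
  have le: "k * (length ls + 2 * g + 1) + (length ls + 2 * g + 1) \<le> g * (length ls + 2 * g + 1)"
    using mult_right_mono[of "Suc k" g "length ls + 2 * g + 1"] Suc.prems by simp
  then have w2: "length (fst s) + length (fst (snd s)) + 2 \<le> W" using s(1,3) W Suc.prems by linarith
  have r: "length (fst (fst r)) \<le> length (fst s) + length (fst (snd s))"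
    "esize (fst (fst r)) \<le> esize (fst s) + length (fst (snd s)) * (2 * W + 5)"
    "esize (snd (fst r)) \<le> W" "snd r = drop (length (fst (snd s))) (snd (snd s))"
    using mask_gates_bounds[OF s(4) w2, of "snd (snd s)"] by (auto simp: r_def)
  have e: "(hyp_gates_step ^^ Suc k) (gs, ls, w) =
    (fst (fst r) @ [Not_Gate (snd (fst r))], snd (fst r) # Wire (length (fst (fst r))) # fst (snd s), snd r)"
    by (simp add: s_def[symmetric] hyp_gates_step_def Let_def r_def[symmetric])
  have "length (fst (snd s)) * (2 * W + 5) \<le> (length ls + 2 * g) * (2 * W + 5)"
    using s(3) Suc.prems by (intro mult_right_mono) auto
  then have "esize (fst (fst r) @ [Not_Gate (snd (fst r))]) \<le>
      esize gs + Suc k * ((length ls + 2 * g) * (2 * W + 5) + W + 3)"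
  proof -
    have arith: "a \<le> E + m1 \<Longrightarrow> m1 \<le> m2 \<Longrightarrow> E \<le> G + k * (m2 + W + 3) \<Longrightarrow> u \<le> W \<Longrightarrow>
      a + (u + 2 + 1) \<le> G + Suc k * (m2 + W + 3)" for a E m1 m2 G u :: nat by simp
    show ?thesis using arith[OF r(2) _ s(2) r(3)] \<open>length (fst (snd s)) * (2 * W + 5) \<le> _\<close>
      by (simp add: esize_append del: mult_Suc)
  qed
  moreover have "length (fst (fst r)) + 2 \<le> W" using r(1) w2 by linarith
  moreover have "esize (snd r) \<le> esize w" using r(4) s(5) esize_drop order_trans by metis
  moreover have "length (fst (fst r) @ [Not_Gate (snd (fst r))]) \<le> length gs + Suc k * (length ls + 2 * g + 1)"
    using r(1) s(1,3) Suc.prems by simp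
  ultimately show ?case unfolding e using r(3) s(3,4) by auto
qed

lemma hyp_gates_bounds:
  assumes "\<And>l. l \<in> set ls \<Longrightarrow> esize l \<le> W"
    and W: "length gs + g * (length ls + 2 * g + 1) + length ls + 2 * g + 3 \<le> W"
  shows "length (fst (hyp_gates g gs ls w)) \<le> length gs + g * (length ls + 2 * g + 1)"
    "esize (fst (hyp_gates g gs ls w)) \<le> esize gs + g * ((length ls + 2 * g) * (2 * W + 5) + W + 3)"
    "esize (snd (hyp_gates g gs ls w)) \<le> W"
proof -
  define s where "s = (hyp_gates_step ^^ g) (gs, ls, w)"
  have W': "length gs + g * (length ls + 2 * g + 1) + length ls + 2 * g + 2 \<le> W" using W by simp
  have e: "hyp_gates g gs ls w = (fst s, hd_default (Wire 1) (fst (snd s)))" by (simp add: hyp_gates_def s_def Let_def)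
  have b: "length (fst s) \<le> length gs + g * (length ls + 2 * g + 1)"
    "esize (fst s) \<le> esize gs + g * ((length ls + 2 * g) * (2 * W + 5) + W + 3)"
    "\<forall>u\<in>set (fst (snd s)). esize u \<le> W"
    using hyp_gates_steps_bounds[OF assms(1) W' order_refl, of w] by (auto simp: s_def)
  then show "length (fst (hyp_gates g gs ls w)) \<le> length gs + g * (length ls + 2 * g + 1)"
    "esize (fst (hyp_gates g gs ls w)) \<le> esize gs + g * ((length ls + 2 * g) * (2 * W + 5) + W + 3)"
    by (simp_all add: e)
  show "esize (snd (hyp_gates g gs ls w)) \<le> W"
    using b(3) W by (cases "fst (snd s)") (auto simp: e)
qed

lemma ptime_hyp_gates [ptime_intros]:
  assumes g: "ptime d A g" and gs: "ptime d A gs" and ls: "ptime d A ls" and w: "ptime d A w"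
  shows "ptime d A (\<lambda>x. hyp_gates (g x) (gs x) (ls x) (w x))"
proof -
  let ?W = "\<lambda>x. esize (ls x) + (length (gs x) + g x * (length (ls x) + 2 * g x + 1) + length (ls x) + 2 * g x + 2)"
  let ?B = "\<lambda>x. (esize (gs x) + g x * ((length (ls x) + 2 * g x) * (2 * ?W x + 5) + ?W x + 3)) +
    (length (ls x) + 2 * g x) * (?W x + 1) + esize (w x) + 2"
  have "ptime d A (\<lambda>x. (hyp_gates_step ^^ g x) (gs x, ls x, w x))"
  proof (rule ptime_funpow_bounded[where B = ?B])
    show "pbounded ?B"
      by (intro pbounded_intros ptime_esize[OF gs] ptime_esize[OF ls] ptime_esize[OF w] pbounded_nat[OF g]
        pbounded_length[OF gs] pbounded_length[OF ls])
    show "ptime d A (\<lambda>z::'a \<times> _. hyp_gates_step (snd z))"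
      unfolding hyp_gates_step_def by (intro ptime_intros)
    fix x k assume k: "k \<le> g x"
    define s where "s = (hyp_gates_step ^^ k) (gs x, ls x, w x)"
    have h1: "\<And>l. l \<in> set (ls x) \<Longrightarrow> esize l \<le> ?W x" using esize_mem[of _ "ls x"] by fastforce
    have h2: "length (gs x) + g x * (length (ls x) + 2 * g x + 1) + length (ls x) + 2 * g x + 2 \<le> ?W x" by simp
    note b' = hyp_gates_steps_bounds[OF h1 h2 k, of "w x", folded s_def]
    have b: "esize (fst s) \<le> esize (gs x) + k * ((length (ls x) + 2 * g x) * (2 * ?W x + 5) + ?W x + 3)"
      "length (fst (snd s)) = length (ls x) + 2 * k" "\<forall>u\<in>set (fst (snd s)). esize u \<le> ?W x" "esize (snd (snd s)) \<le> esize (w x)"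
      using b' by blast+
    have "k * ((length (ls x) + 2 * g x) * (2 * ?W x + 5) + ?W x + 3) \<le> g x * ((length (ls x) + 2 * g x) * (2 * ?W x + 5) + ?W x + 3)"
      using k by (intro mult_right_mono) auto
    moreover have "esize (fst (snd s)) \<le> length (fst (snd s)) * (?W x + 1)" by (rule esize_list_le) (use b in blast)
    moreover have "length (fst (snd s)) * (?W x + 1) \<le> (length (ls x) + 2 * g x) * (?W x + 1)"
      using k b(2) by (intro mult_right_mono) auto
    ultimately have "esize s \<le> ?B x"
      using b(1,4) unfolding esize_prod[of s] esize_prod[of "snd s"] by linarith
    then show "esize ((hyp_gates_step ^^ k) (gs x, ls x, w x)) \<le> ?B x" by (simp only: s_def)
  qed (intro ptime_intros g gs ls w)+
  then show ?thesis unfolding hyp_gates_def by (intro ptime_intros)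
qed

definition insert_gates_step :: "(gate list \<times> wire) \<times> wire list \<Rightarrow> wire \<Rightarrow> (gate list \<times> wire) \<times> wire list" where
  "insert_gates_step s t =
     ((fst (fst s) @ [Or_Gate t (snd (fst s)), And_Gate t (snd (fst s))], Wire (Suc (length (fst (fst s))))),
      snd s @ [Wire (length (fst (fst s)))])"

lemma insert_gates_step_bounds:
  assumes "\<And>t. t \<in> set ts \<Longrightarrow> esize t \<le> W" "esize u \<le> W" "length gs + 2 * length ts + 3 \<le> W"
  defines "s \<equiv> foldl insert_gates_step ((gs, u), []) ts"
  shows "length (fst (fst s)) = length gs + 2 * length ts \<and> esize (fst (fst s)) \<le> esize gs + length ts * (4 * W + 11) \<and>
    esize (snd (fst s)) \<le> W \<and> length (snd s) = length ts \<and> (\<forall>t\<in>set (snd s). esize t \<le> W)"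
  using assms(1-3) unfolding s_def
proof (induction ts rule: rev_induct)
  case Nil
  then show ?case by simp
next
  case (snoc t ts)
  define s where "s = foldl insert_gates_step ((gs, u), []) ts"
  have s: "length (fst (fst s)) = length gs + 2 * length ts" "esize (fst (fst s)) \<le> esize gs + length ts * (4 * W + 11)"
    "esize (snd (fst s)) \<le> W" "length (snd s) = length ts" "\<forall>t\<in>set (snd s). esize t \<le> W"
    using snoc by (auto simp: s_def)
  have "esize t \<le> W" using snoc.prems(1) by simp
  moreover have e: "foldl insert_gates_step ((gs, u), []) (ts @ [t]) = insert_gates_step s t" by (simp add: s_def)
  ultimately show ?case unfolding e unfolding insert_gates_step_def using s snoc.prems(3)
    by (auto simp: esize_append)
qed

lemma insert_gates_eq: "insert_gates gs ts u =
  (let s = foldl insert_gates_step ((gs, u), []) ts in (fst (fst s), snd s @ [snd (fst s)]))"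
  by (simp add: insert_gates_def insert_gates_step_def[abs_def])

lemma insert_gates_bounds:
  assumes "\<And>t. t \<in> set ts \<Longrightarrow> esize t \<le> W" "esize u \<le> W" "length gs + 2 * length ts + 3 \<le> W"
  shows "length (fst (insert_gates gs ts u)) = length gs + 2 * length ts"
    "esize (fst (insert_gates gs ts u)) \<le> esize gs + length ts * (4 * W + 11)"
    "length (snd (insert_gates gs ts u)) = length ts + 1"
    "\<forall>t\<in>set (snd (insert_gates gs ts u)). esize t \<le> W"
  using insert_gates_step_bounds[OF assms] by (auto simp: insert_gates_eq Let_def)

lemma ptime_insert_gates [ptime_intros]:
  assumes gs: "ptime d A gs" and ts: "ptime d A ts" and u: "ptime d A u"
  shows "ptime d A (\<lambda>x. insert_gates (gs x) (ts x) (u x))"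
proof -
  let ?W = "\<lambda>x. esize (ts x) + esize (u x) + (length (gs x) + 2 * length (ts x) + 3)"
  let ?B = "\<lambda>x. (esize (gs x) + length (ts x) * (4 * ?W x + 11)) + ?W x + length (ts x) * (?W x + 1) + 2"
  have "ptime d A (\<lambda>x. foldl insert_gates_step ((gs x, u x), []) (ts x))"
  proof (rule ptime_foldl_bounded[where B = ?B])
    show "pbounded ?B"
      by (intro pbounded_intros ptime_esize[OF gs] ptime_esize[OF ts] ptime_esize[OF u] pbounded_length[OF gs] pbounded_length[OF ts])
    show "ptime d A (\<lambda>z::'a \<times> _ \<times> _. insert_gates_step (fst (snd z)) (snd (snd z)))"
      unfolding insert_gates_step_def by (intro ptime_intros)
    fix x ys zs assume l: "ts x = ys @ zs"
    define s where "s = foldl insert_gates_step ((gs x, u x), []) ys"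
    have "\<And>l. l \<in> set ys \<Longrightarrow> esize l \<le> ?W x" using l esize_mem[of _ "ts x"] by fastforce
    moreover have "length (gs x) + 2 * length ys + 3 \<le> ?W x" using l by simp
    ultimately have b: "esize (fst (fst s)) \<le> esize (gs x) + length ys * (4 * ?W x + 11)" "esize (snd (fst s)) \<le> ?W x"
      "length (snd s) = length ys" "\<forall>t\<in>set (snd s). esize t \<le> ?W x"
      using insert_gates_step_bounds[of ys "?W x" "u x" "gs x"] by (auto simp: s_def)
    have "length ys * (4 * ?W x + 11) \<le> length (ts x) * (4 * ?W x + 11)" using l by (intro mult_right_mono) auto
    moreover have "esize (snd s) \<le> length (snd s) * (?W x + 1)" by (rule esize_list_le) (use b in blast)
    moreover have "length (snd s) * (?W x + 1) \<le> length (ts x) * (?W x + 1)" using l b(3) by (intro mult_right_mono) auto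
    ultimately have "esize s \<le> ?B x" using b(1,2) unfolding esize_prod[of s] esize_prod[of "fst s"] by linarith
    then show "esize (foldl insert_gates_step ((gs x, u x), []) ys) \<le> ?B x" by (simp only: s_def)
  qed (intro ptime_intros gs ts u)+
  then show ?thesis unfolding insert_gates_eq by (intro ptime_intros)
qed

lemma input_gates_bounds:
  assumes "\<And>z. z \<in> set zs \<Longrightarrow> esize z + 3 \<le> W" "length zs + 4 \<le> W"
  shows "length (fst (input_gates zs)) \<le> 2 + length zs \<and> esize (fst (input_gates zs)) \<le> 10 + length zs * (W + 3) \<and>
    length (snd (input_gates zs)) = 2 + 2 * length zs \<and> (\<forall>u\<in>set (snd (input_gates zs)). esize u \<le> W)"
  using assms
proof (induction zs rule: rev_induct)
  case Nil
  then show ?case by (auto simp: input_gates_def enc_gate)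
next
  case (snoc z zs)
  define s where "s = input_gates zs"
  have s: "length (fst s) \<le> 2 + length zs" "esize (fst s) \<le> 10 + length zs * (W + 3)"
    "length (snd s) = 2 + 2 * length zs" "\<forall>u\<in>set (snd s). esize u \<le> W"
    using snoc by (auto simp: s_def)
  have e: "input_gates (zs @ [z]) = (if snd z
     then (fst s @ [Not_Gate (Input (code_var (fst z)))], snd s @ [Input (code_var (fst z)), Wire (length (fst s))])
     else (fst s, snd s @ [Wire 1, Wire 1]))" by (simp add: input_gates_def s_def)
  have "esize z + 3 \<le> W" using snoc.prems(1) by simp
  then have "esize (Input (code_var (fst z))) \<le> W" using esize_input[of "fst z"] by (simp add: esize_prod)
  then show ?case unfolding e using s snoc.prems(2) by (auto simp: esize_append)
qed

lemma ptime_input_gates [ptime_intros]: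
  assumes zs: "ptime d A zs" shows "ptime d A (\<lambda>x. input_gates (zs x))"
  unfolding input_gates_def
proof (rule ptime_foldl_bounded)
  let ?W = "\<lambda>x. esize (zs x) + 3 + (length (zs x) + 4)"
  let ?B = "\<lambda>x. (10 + length (zs x) * (?W x + 3)) + (2 + 2 * length (zs x)) * (?W x + 1) + 1"
  show "pbounded ?B" by (intro pbounded_intros ptime_esize[OF zs] pbounded_length[OF zs])
  fix x ys ys' assume l: "zs x = ys @ ys'"
  define s where "s = input_gates ys"
  have "\<And>l. l \<in> set ys \<Longrightarrow> esize l + 3 \<le> ?W x" using l esize_mem[of _ "zs x"] by fastforce
  moreover have "length ys + 4 \<le> ?W x" using l by simp
  ultimately have b: "esize (fst s) \<le> 10 + length ys * (?W x + 3)" "length (snd s) = 2 + 2 * length ys"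
    "\<forall>u\<in>set (snd s). esize u \<le> ?W x"
    using input_gates_bounds[of ys "?W x"] by (auto simp: s_def)
  have "length ys * (?W x + 3) \<le> length (zs x) * (?W x + 3)" using l by (intro mult_right_mono) auto
  moreover have "esize (snd s) \<le> length (snd s) * (?W x + 1)" by (rule esize_list_le) (use b in blast)
  moreover have "length (snd s) * (?W x + 1) \<le> (2 + 2 * length (zs x)) * (?W x + 1)" using l b(2) by (intro mult_right_mono) auto
  ultimately have "esize s \<le> ?B x" using b(1) unfolding esize_prod[of s] by linarith
  then show "esize (foldl (\<lambda>s z. if snd z
     then (fst s @ [Not_Gate (Input (code_var (fst z)))], snd s @ [Input (code_var (fst z)), Wire (length (fst s))])
     else (fst s, snd s @ [Wire 1, Wire 1])) ([Const_Gate True, Const_Gate False], [Wire 0, Wire 1]) ys) \<le> ?B x"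
    by (simp only: s_def input_gates_def)
qed (intro ptime_intros zs)+

text \<open>\<open>P\<close> is the number of gates per vote: one hypothesis and at most
  \<open>n\<close> comparators of two gates. \<open>Q\<close> is the corresponding size of their
  codes.\<close>

lemma vote_gates_bounds:
  assumes ls: "\<And>l. l \<in> set (snd s0) \<Longrightarrow> esize l \<le> W" and n: "length ws \<le> n"
    and W: "length (fst s0) + n * (g * (length (snd s0) + 2 * g + 1) + 2 * n) +
      g * (length (snd s0) + 2 * g + 1) + length (snd s0) + 2 * g + 2 * n + 3 \<le> W"
  defines "P \<equiv> g * (length (snd s0) + 2 * g + 1) + 2 * n"
    and "Q \<equiv> g * ((length (snd s0) + 2 * g) * (2 * W + 5) + W + 3) + n * (4 * W + 11)"
  shows "length (fst (vote_gates g s0 ws)) \<le> length (fst s0) + length ws * P \<and>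
    esize (fst (vote_gates g s0 ws)) \<le> esize (fst s0) + length ws * Q \<and>
    length (snd (vote_gates g s0 ws)) = length ws \<and> (\<forall>u\<in>set (snd (vote_gates g s0 ws)). esize u \<le> W)"
  using n
proof (induction ws rule: rev_induct)
  case Nil
  then show ?case by (simp add: vote_gates_def)
next
  case (snoc w ws)
  define s where "s = vote_gates g s0 ws"
  define r where "r = hyp_gates g (fst s) (snd s0) w"
  have s: "length (fst s) \<le> length (fst s0) + length ws * P" "esize (fst s) \<le> esize (fst s0) + length ws * Q"
    "length (snd s) = length ws" "\<forall>u\<in>set (snd s). esize u \<le> W"
    using snoc by (auto simp: s_def)
  have e: "vote_gates g s0 (ws @ [w]) = insert_gates (fst r) (snd s) (snd r)"
    by (simp add: vote_gates_def s_def r_def Let_def)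
  have "length ws * P \<le> n * P" using snoc.prems by (intro mult_right_mono) auto
  then have W1: "length (fst s) + g * (length (snd s0) + 2 * g + 1) + length (snd s0) + 2 * g + 3 \<le> W"
    and W0: "length (fst s) + g * (length (snd s0) + 2 * g + 1) + 2 * n + 3 \<le> W"
    using s(1) W unfolding P_def by linarith+
  note r = hyp_gates_bounds[OF ls W1, of w, folded r_def]
  have W2: "length (fst r) + 2 * length (snd s) + 3 \<le> W"
    using r(1) s(3) snoc.prems W0 by simp
  have ts: "\<And>t. t \<in> set (snd s) \<Longrightarrow> esize t \<le> W" using s(4) by blast
  note i = insert_gates_bounds[OF ts r(3) W2]
  have "length (fst (insert_gates (fst r) (snd s) (snd r))) \<le> length (fst s0) + Suc (length ws) * P"
    using i(1) r(1) s(1,3) snoc.prems unfolding P_def by simp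
  moreover have m: "length (snd s) * (4 * W + 11) \<le> n * (4 * W + 11)" using s(3) snoc.prems by (intro mult_right_mono) auto
  have arith: "a \<le> b + m1 \<Longrightarrow> m1 \<le> m2 \<Longrightarrow> b \<le> c + h \<Longrightarrow> c \<le> d + k * (h + m2) \<Longrightarrow>
    a \<le> d + Suc k * (h + m2)" for a b c d k h m1 m2 :: nat by simp
  have "esize (fst (insert_gates (fst r) (snd s) (snd r))) \<le> esize (fst s0) + Suc (length ws) * Q"
    unfolding Q_def by (rule arith[OF i(2) m r(2) s(2)[unfolded Q_def]])
  ultimately show ?case using i(3,4) s(3) unfolding e by simp
qed

lemma ptime_vote_gates [ptime_intros]:
  assumes g: "ptime d A g" and s: "ptime d A s" and ws: "ptime d A ws"
  shows "ptime d A (\<lambda>x. vote_gates (g x) (s x) (ws x))"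
  unfolding vote_gates_def
proof (rule ptime_foldl_bounded)
  let ?L = "\<lambda>x. length (snd (s x))" and ?n = "\<lambda>x. length (ws x)"
  let ?W = "\<lambda>x. esize (snd (s x)) + (length (fst (s x)) + ?n x * (g x * (?L x + 2 * g x + 1) + 2 * ?n x) +
      g x * (?L x + 2 * g x + 1) + ?L x + 2 * g x + 2 * ?n x + 3)"
  let ?Q = "\<lambda>x. g x * ((?L x + 2 * g x) * (2 * ?W x + 5) + ?W x + 3) + ?n x * (4 * ?W x + 11)"
  let ?B = "\<lambda>x. (esize (fst (s x)) + ?n x * ?Q x) + ?n x * (?W x + 1) + 1"
  show "pbounded ?B"
    by (intro pbounded_intros ptime_esize[OF ptime_fst[OF s]] ptime_esize[OF ptime_snd[OF s]]
      pbounded_length[OF ptime_fst[OF s]] pbounded_length[OF ptime_snd[OF s]] pbounded_length[OF ws] pbounded_nat[OF g])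
  show "ptime d A (\<lambda>z. let r = hyp_gates (g (fst z)) (fst (fst (snd z))) (snd (s (fst z))) (snd (snd z))
      in insert_gates (fst r) (snd (fst (snd z))) (snd r))"
    by (intro ptime_intros ptime_comp[OF g] ptime_comp[OF s])
  fix x ys zs assume l: "ws x = ys @ zs"
  define t where "t = vote_gates (g x) (s x) ys"
  have h1: "\<And>l. l \<in> set (snd (s x)) \<Longrightarrow> esize l \<le> ?W x" using esize_mem[of _ "snd (s x)"] by fastforce
  have h2: "length ys \<le> ?n x" using l by simp
  have h3: "length (fst (s x)) + ?n x * (g x * (?L x + 2 * g x + 1) + 2 * ?n x) +
      g x * (?L x + 2 * g x + 1) + ?L x + 2 * g x + 2 * ?n x + 3 \<le> ?W x" by simp
  note b' = vote_gates_bounds[OF h1 h2 h3, folded t_def]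
  have b: "esize (fst t) \<le> esize (fst (s x)) + length ys * ?Q x" "length (snd t) = length ys" "\<forall>u\<in>set (snd t). esize u \<le> ?W x"
    using b' by blast+
  have "length ys * ?Q x \<le> ?n x * ?Q x" using l by (intro mult_right_mono) auto
  moreover have "esize (snd t) \<le> length (snd t) * (?W x + 1)" by (rule esize_list_le) (use b in blast)
  moreover have "length (snd t) * (?W x + 1) \<le> ?n x * (?W x + 1)" using l b(2) by (intro mult_right_mono) auto
  ultimately have "esize t \<le> ?B x" using b(1) unfolding esize_prod[of t] by linarith
  then show "esize (foldl (\<lambda>t w. let r = hyp_gates (g x) (fst t) (snd (s x)) w in insert_gates (fst r) (snd t) (snd r))
     (fst (s x), []) ys) \<le> ?B x" by (simp only: t_def vote_gates_def)
qed (intro ptime_intros s ws)+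

lemma ptime_half [ptime_intros]:
  fixes n :: "'a::encodable \<Rightarrow> nat"
  assumes n: "ptime d A n" shows "ptime d A (\<lambda>x. n x div 2)"
proof -
  let ?f = "\<lambda>s :: nat \<times> bool. (if snd s then Suc (fst s) else fst s, \<not> snd s)"
  have e: "(?f ^^ k) (0, False) = (k div 2, odd k)" for k by (induction k) auto
  have "ptime d A (\<lambda>x. (?f ^^ n x) (0, False))"
  proof (rule ptime_funpow[where G = "\<lambda>_. 2"])
    show "esize (?f s) \<le> esize s + 2" for s using esize_bool[of "\<not> snd s"] by (auto simp: esize_prod)
  qed (intro ptime_intros n pbounded_const)+
  then have "ptime d A (\<lambda>x. fst ((?f ^^ n x) (0, False)))" by (intro ptime_intros)
  then show ?thesis by (simp only: e fst_conv)
qed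

lemma ptime_majority_circuit [ptime_intros]:
  assumes "ptime d A vs" "ptime d A p" "ptime d A g" "ptime d A ws"
  shows "ptime d A (\<lambda>x. majority_circuit (vs x) (p x) (g x) (ws x))"
proof (rule ptime_recode)
  show "ptime d A (\<lambda>x. let s = vote_gates (g x) (input_gates (zip (vs x) (p x))) (ws x)
     in (fst s, hd_default (Wire 1) (drop (length (ws x) div 2) (snd s))))"
    by (intro ptime_intros assms ptime_comp[OF assms(4)])
  show "enc (majority_circuit (vs x) (p x) (g x) (ws x)) = enc (let s = vote_gates (g x) (input_gates (zip (vs x) (p x))) (ws x)
     in (fst s, hd_default (Wire 1) (drop (length (ws x) div 2) (snd s))))" for x
    by (simp only: majority_circuit_def Let_def enc_circuit)
qed

lemma ptime_index [ptime_intros]: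
  assumes "ptime d A vs" "ptime d A v" shows "ptime d A (\<lambda>x. index (vs x) (v x))"
  unfolding index_def
proof (rule ptime_foldl[where G = "\<lambda>_. 1"])
  have "ptime d A (\<lambda>z. if fst (snd (snd z)) = fst (v (fst z)) \<and> snd (snd (snd z)) = snd (v (fst z)) then 0 else Suc (fst (snd z)))"
    by (intro ptime_intros ptime_comp[OF assms(2)])
  then show "ptime d A (\<lambda>z. if snd (snd z) = v (fst z) then 0 else Suc (fst (snd z)))"
    by (simp only: prod_eq_iff)
qed ((intro ptime_intros assms pbounded_const)+, simp)

lemma ptime_token_vars [ptime_intros]: "ptime d A t \<Longrightarrow> ptime d A (\<lambda>x. token_vars (t x))"
  unfolding token_vars_def by (intro ptime_intros)

lemma ptime_compress [ptime_intros]: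
  assumes "ptime d A F" "ptime d A i" "ptime d A g"
  shows "ptime d A (\<lambda>x. compress (F x) (i x) (g x))"
  unfolding compress_def rename_def
  by (intro ptime_intros assms ptime_comp[OF assms(2)] ptime_comp[OF assms(3)] ptime_comp[OF assms(1)])

section \<open>The learner\<close>

text \<open>Link between program semantics and averages: an event's probability is the weight of the
  restricted subdistribution, and weights commute with binding.\<close>

lemma measure_bind_spmf_of_set:
  "measure (measure_spmf (bind_spmf (spmf_of_set (bit_lists k)) f)) S =
    avg k (\<lambda>u. measure (measure_spmf (f u)) S)"
proof -
  have w: "measure (measure_spmf p) S = weight_spmf (restrict_spmf p S)" for p :: "'a spmf"
    by simp
  show ?thesis unfolding w restrict_bind_spmf weight_bind_spmf integral_spmf_of_set
    by (simp add: avg_def)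
qed

lemma bit_lists_Suc: "bind_spmf coin_spmf (\<lambda>b. bind_spmf (spmf_of_set (bit_lists k)) (\<lambda>u. f (b # u))) =
  bind_spmf (spmf_of_set (bit_lists (Suc k))) f"
proof (rule spmf_eqI)
  fix x
  have avg: "spmf (bind_spmf (spmf_of_set (bit_lists k)) g) x = avg k (\<lambda>u. spmf (g u) x)" for k and g :: "_ \<Rightarrow> 'a spmf"
    by (simp add: spmf_bind integral_spmf_of_set avg_def)
  show "spmf (bind_spmf coin_spmf (\<lambda>b. bind_spmf (spmf_of_set (bit_lists k)) (\<lambda>u. f (b # u)))) x =
      spmf (bind_spmf (spmf_of_set (bit_lists (Suc k))) f) x"
    unfolding spmf_bind[of coin_spmf] integral_spmf_of_set avg avg_Suc by (simp add: UNIV_bool add.commute)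
qed

text \<open>The time depends on the drawn bits and not only on their number, since
  \<open>Join\<close> is charged by size and \<open>True\<close> has a larger tree than
  \<open>False\<close>.\<close>

primrec coin_time :: "bool list \<Rightarrow> nat" where
  "coin_time [] = 3"
| "coin_time (b # u) = coin_time u + 6 + esize (b # u)"

lemma coin_time_le: "coin_time u \<le> 3 + length u * (6 + 2 * length u)"
proof (induction u)
  case (Cons b u)
  then show ?case using esize_bits[of "b # u"] by (simp add: algebra_simps)
qed simp

definition coins_body :: "nat \<Rightarrow> expr" where
  "coins_body r = Cond (Var 0) (Join Flip (Call r (Second (Var 0)))) Empty"

lemma eval_coins:
  assumes r: "r < length L" "L ! r = coins_body r"
  shows "eval L A [enc (k::nat)] (coins_body r) =
    bind_spmf (spmf_of_set (bit_lists k)) (\<lambda>u. return_spmf (enc u, coin_time u, 0))"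
proof (induction k)
  case 0
  have "bit_lists 0 = {[]}" by (auto simp: bit_lists_def)
  then show ?case by (simp add: coins_body_def eval_simps spmf_of_set_singleton numeral_3_eq_3)
next
  case (Suc k)
  have "eval L A [enc (Suc k)] (Call r (Second (Var 0))) =
    bind_spmf (spmf_of_set (bit_lists k)) (\<lambda>u. return_spmf (enc u, Suc (Suc (Suc (coin_time u))), 0))"
    unfolding eval_simps(8) eval_simps(5) eval_simps(1) using r Suc by simp
  then have "eval L A [enc (Suc k)] (Join Flip (Call r (Second (Var 0)))) =
    bind_spmf coin_spmf (\<lambda>b. bind_spmf (spmf_of_set (bit_lists k)) (\<lambda>u. return_spmf (enc (b # u), coin_time u + 4 + esize (b # u), 0)))"
    unfolding eval_simps(3) eval_simps(9) by (simp add: enc_bool_def eval_nat_numeral del: enc_simps(1,2))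
  then have "eval L A [enc (Suc k)] (coins_body r) =
    bind_spmf coin_spmf (\<lambda>b. bind_spmf (spmf_of_set (bit_lists k)) (\<lambda>u. return_spmf (enc (b # u), coin_time (b # u), 0)))"
    unfolding coins_body_def eval_simps(6) eval_simps(1) by (simp add: eval_nat_numeral)
  then show ?case using bit_lists_Suc[of k "\<lambda>u. return_spmf (enc u, coin_time u, 0)"] by (simp only:)
qed

lemma eval_Var0: "eval L A (v # env) (Var 0) = return_spmf (v, 1, 0)"
  by (simp add: eval_simps)

lemma eval_Call_det:
  assumes "eval L A env e = return_spmf (v, t0, q0)" "f < length L" "eval L A [v] (L ! f) = return_spmf (w, t, q)"
  shows "eval L A env (Call f e) = return_spmf (w, t0 + t + 1, q0 + q)"
  using assms by (simp add: eval_simps)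

text \<open>Function \<open>r\<close> draws random bits; \<open>ke\<close>, \<open>kc\<close>, \<open>kb\<close> and \<open>kn\<close> compute the number of random bits,
  the hypotheses, the circuit and the next state; \<open>l\<close> is the loop itself.\<close>

definition loop_body :: "nat \<Rightarrow> nat \<Rightarrow> nat \<Rightarrow> nat \<Rightarrow> nat \<Rightarrow> nat \<Rightarrow> expr" where
  "loop_body r ke kc kb kn l = Bind (Call r (Call ke (Var 0)))
     (Bind (Call kc (Join (First (Var 1)) (Var 0)))
       (Cond (Var 0) (Call kb (Join (Var 2) (Var 0))) (Call l (Call kn (Var 2)))))"

text \<open>One unfolding, with the recursive call left symbolic: the loop knows no bound on
  \<open>s\<close> and may diverge. Of the linked functions only \<open>kc\<close> makes queries,
  and it receives only \<open>fst s\<close> and the bits; this matters for the query bound.\<close>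

lemma eval_loop:
  fixes s :: "'a::encodable \<times> 'b::encodable"
  assumes r: "r < length L" "L ! r = coins_body r" and l: "l < length L" "L ! l = loop_body r ke kc kb kn l"
    and k: "ke < length L" "kc < length L" "kb < length L" "kn < length L"
    and e: "eval L A [enc s] (L ! ke) = return_spmf (enc (m::nat), te, 0)"
    and c: "\<And>u. length u = m \<Longrightarrow> eval L A [enc (fst s, u)] (L ! kc) = return_spmf (enc (out u :: 'c::encodable list), tc u, qc u)"
    and b: "\<And>u. length u = m \<Longrightarrow> out u \<noteq> [] \<Longrightarrow> eval L A [enc (s, out u)] (L ! kb) = return_spmf (res u, tb u, 0)"
    and n: "eval L A [enc s] (L ! kn) = return_spmf (enc s', tn, 0)"
  shows "\<exists>t. eval L A [enc s] (L ! l) = bind_spmf (spmf_of_set (bit_lists m)) (\<lambda>u.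
      if out u \<noteq> [] then return_spmf (res u, t u + tb u, qc u)
      else bind_spmf (eval L A [enc s'] (L ! l)) (\<lambda>(v, t2, q2). return_spmf (v, t u + t2, qc u + q2))) \<and>
    (\<forall>u. t u \<le> te + coin_time u + tc u + tn + 20 + 2 * (esize s + esize u + esize (out u)))"
proof -
  define t where "t u = te + coin_time u + tc u + esize (fst s) + esize u +
    (if out u \<noteq> [] then 16 + esize s + esize (out u) else 15 + tn)" for u
  have 1: "eval L A [enc s] (Call r (Call ke (Var 0))) =
    bind_spmf (spmf_of_set (bit_lists m)) (\<lambda>u. return_spmf (enc u, Suc (Suc (Suc (te + coin_time u))), 0))"
    unfolding eval_simps(8)[of L A "[enc s]" r] eval_Call_det[OF eval_Var0 k(1) e]
    using r eval_coins[OF r] by (simp add: algebra_simps)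
  have f: "eval L A [enc u, enc s] (First (Var 1)) = return_spmf (enc (fst s), 2, 0)" for u :: "bool list"
    by (cases s) (simp add: eval_simps)
  have 2: "eval L A [enc u, enc s] (Call kc (Join (First (Var 1)) (Var 0))) =
    return_spmf (enc (out u), 5 + tc u + esize (fst s) + esize u, qc u)" if "length u = m" for u
  proof -
    have "eval L A [enc u, enc s] (Join (First (Var 1)) (Var 0)) = return_spmf (enc (fst s, u), 4 + esize (fst s) + esize u, 0)"
      unfolding eval_simps(3) f eval_Var0 by simp
    from eval_Call_det[OF this k(2) c[OF that]] show ?thesis by (simp add: algebra_simps)
  qed
  have v2: "eval L A [x, y, enc s] (Var 2) = return_spmf (enc s, 1, 0)" for x y
    by (simp add: eval_simps)
  have 3: "eval L A [enc (out u), enc u, enc s] (Call kb (Join (Var 2) (Var 0))) =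
    return_spmf (res u, 4 + tb u + esize s + esize (out u), 0)" if "length u = m" "out u \<noteq> []" for u
  proof -
    have "eval L A [enc (out u), enc u, enc s] (Join (Var 2) (Var 0)) = return_spmf (enc (s, out u), 3 + esize s + esize (out u), 0)"
      unfolding eval_simps(3) v2 eval_Var0 by simp
    from eval_Call_det[OF this k(3) b[OF that]] show ?thesis by (simp add: algebra_simps)
  qed
  have 4: "eval L A [x, y, enc s] (Call l (Call kn (Var 2))) =
    bind_spmf (eval L A [enc s'] (L ! l)) (\<lambda>(v, t2, q2). return_spmf (v, tn + 3 + t2, q2))" for x y
    unfolding eval_simps(8)[of L A _ l] eval_Call_det[OF v2 k(4) n] using l(1)
    by (simp add: case_prod_unfold eval_nat_numeral)
  define rest where "rest = Bind (Call kc (Join (First (Var 1)) (Var 0)))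
       (Cond (Var 0) (Call kb (Join (Var 2) (Var 0))) (Call l (Call kn (Var 2))))"
  have 5: "eval L A [enc u, enc s] rest = (if out u \<noteq> [] then return_spmf (res u, 12 + tb u + esize s + esize (out u) + tc u + esize (fst s) + esize u, qc u)
      else bind_spmf (eval L A [enc s'] (L ! l)) (\<lambda>(v, t2, q2). return_spmf (v, 11 + tn + tc u + esize (fst s) + esize u + t2, qc u + q2)))"
    if "length u = m" for u
  proof (cases "out u = []")
    case True
    then show ?thesis unfolding rest_def eval_simps(7) 2[OF that] using 4
      by (simp add: eval_simps(6) eval_Var0 case_prod_unfold algebra_simps)
  next
    case False
    then show ?thesis unfolding rest_def eval_simps(7) 2[OF that] using 3[OF that]
      by (simp add: eval_simps(6) eval_Var0 algebra_simps)
  qed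
  have "eval L A [enc s] (L ! l) = bind_spmf (spmf_of_set (bit_lists m)) (\<lambda>u.
      if out u \<noteq> [] then return_spmf (res u, t u + tb u, qc u)
      else bind_spmf (eval L A [enc s'] (L ! l)) (\<lambda>(v, t2, q2). return_spmf (v, t u + t2, qc u + q2)))"
    (is "_ = ?rhs")
  proof -
    have "eval L A [enc s] (L ! l) = bind_spmf (spmf_of_set (bit_lists m)) (\<lambda>u.
      bind_spmf (eval L A [enc u, enc s] rest) (\<lambda>(v2, t2, q2). return_spmf (v2, Suc (Suc (Suc (te + coin_time u))) + t2 + 1, 0 + q2)))"
      unfolding l(2) loop_body_def rest_def[symmetric] eval_simps(7)[of L A "[enc s]"] 1 by simp
    also have "\<dots> = ?rhs"
    proof (rule bind_spmf_cong[OF refl])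
      fix u assume "u \<in> set_spmf (spmf_of_set (bit_lists m))"
      then have "u \<in> bit_lists m" by simp
      then have u: "length u = m" by (simp add: bit_lists_def)
      show "bind_spmf (eval L A [enc u, enc s] rest) (\<lambda>(v2, t2, q2).
          return_spmf (v2, Suc (Suc (Suc (te + coin_time u))) + t2 + 1, 0 + q2)) =
        (if out u \<noteq> [] then return_spmf (res u, t u + tb u, qc u)
         else bind_spmf (eval L A [enc s'] (L ! l)) (\<lambda>(v, t2, q2). return_spmf (v, t u + t2, qc u + q2)))"
        unfolding 5[OF u] by (simp add: t_def case_prod_unfold eval_nat_numeral add_ac)
    qed
    finally show ?thesis .
  qed
  moreover have "t u \<le> te + coin_time u + tc u + tn + 20 + 2 * (esize s + esize u + esize (out u))" for u
    using esize_prod[of s] by (simp add: t_def)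
  ultimately show ?thesis by blast
qed

text \<open>The names of the variables travel beside the compressed configuration, because only the
  final circuit mentions them.\<close>

definition learner_state :: "formula \<Rightarrow> nat \<Rightarrow> nat \<Rightarrow> config \<times> (nat \<times> nat) list" where
  "learner_state F i g = (compress F i g, token_vars (tokens F))"

text \<open>A circuit of size s corresponds to s + 1 masks, hence the start at 1.\<close>

definition initial_state :: "nat \<times> nat \<times> formula \<times> nat \<times> unit \<Rightarrow> config \<times> (nat \<times> nat) list" where
  "initial_state z = learner_state (fst (snd (snd z))) (fst (snd (snd (snd z)))) 1"

definition next_state :: "config \<times> (nat \<times> nat) list \<Rightarrow> config \<times> (nat \<times> nat) list" where
  "next_state s = ((fst (fst s), fst (snd (fst s)), fst (snd (snd (fst s))), Suc (snd (snd (snd (fst s))))), snd s)"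

definition output_circuit :: "(config \<times> (nat \<times> nat) list) \<times> bool list list list \<Rightarrow> circuit" where
  "output_circuit z = majority_circuit (snd (fst z)) (fst (snd (snd (fst (fst z)))))
     (snd (snd (snd (fst (fst z))))) (hd_default [] (snd z))"

lemma next_learner_state: "next_state (learner_state F i g) = learner_state F i (Suc g)"
  by (simp add: next_state_def learner_state_def compress_def Let_def)

lemma ptime_learner:
  "ptime d A initial_state" "ptime d A next_state" "ptime d A output_circuit"
  "ptime d A (\<lambda>s :: config \<times> (nat \<times> nat) list. random_bits c (fst s))"
  unfolding initial_state_def[abs_def] learner_state_def next_state_def[abs_def] output_circuit_def[abs_def]
  by (intro ptime_intros)+

lemma output_circuit_correct:
  assumes spec: "relational_spec n m F" and u: "uniquely_defined F (preceding_vars n i) (Y i)"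
    and ws: "ws \<in> set (learn c solvable (compress F i g) r)"
  shows "skolem_function n F i (output_circuit (learner_state F i g, ws # wss))"
proof -
  let ?vs = "token_vars (tokens F)" and ?p = "\<lambda>v. fst v = 0 \<or> snd v < i"
  have C: "output_circuit (learner_state F i g, ws # wss) = majority_circuit ?vs (map ?p ?vs) g ws"
    by (simp add: output_circuit_def learner_state_def compress_def Let_def)
  have Z: "code_var v \<in> preceding_vars n i" if "v \<in> set ?vs" "?p v" for v
  proof -
    have "code_var v \<in> X ` {1..n} \<union> Y ` {1..m}"
      using that(1) code_var_token_vars[of F] spec unfolding relational_spec_def by blast
    then show ?thesis using that(2) by (auto simp: code_var_def preceding_vars_def split: if_splits)
  qed
  have "adequate (compress F i g) ws" using ws by (rule learn_sound)
  from compress_adequate[OF this u] have "circuit_value (majority_circuit ?vs (map ?p ?vs) g ws) a = a (Y i)" if "holds F a" for a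
    using that unfolding compress_def Let_def fst_conv snd_conv by (simp only: majority_circuit_correct(2)[OF Z])
  moreover have "circuit_on (preceding_vars n i) (majority_circuit ?vs (map ?p ?vs) g ws)"
    using Z by (rule majority_circuit_correct(1))
  ultimately show ?thesis unfolding C skolem_function_def computes_on_models_def by blast
qed

lemma linked_eval:
  assumes P: "implements P A k p f" and L: "L = [e] @ map (shift_calls 1) P @ P'"
  shows "Suc k < length L"
    "\<exists>t q. eval L A [enc x] (L ! Suc k) = return_spmf (enc (f x), t, q) \<and> t \<le> poly p (esize x) \<and> q \<le> t"
proof -
  obtain t q where tq: "evals P A [enc x] (P ! k) (enc (f x)) t q" "t \<le> poly p (esize x)"
    using P unfolding implements_def by blast
  have k: "k < length P" using P by (simp add: implements_def)
  then show "Suc k < length L" by (simp add: L)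
  have "L ! Suc k = shift_calls 1 (P ! k)" using k by (simp add: L nth_append)
  then have "evals L A [enc x] (L ! Suc k) (enc (f x)) t q"
    using evals_relocate[OF tq(1), of "[e]" P'] by (simp add: L)
  then show "\<exists>t q. eval L A [enc x] (L ! Suc k) = return_spmf (enc (f x), t, q) \<and> t \<le> poly p (esize x) \<and> q \<le> t"
    using tq(2) eval_evals evals_queries_le by blast
qed

text \<open>Freedom from queries is inherited only from a program that is deterministic as a whole.
  The query-free functions are therefore linked first, and the querying part \<open>P''\<close>
  comes after them.\<close>

lemma linked_eval_det:
  assumes P: "implements P A k p f" "list_all deterministic P" and L: "L = [e] @ map (shift_calls 1) (P @ P'') @ P'"
  shows "\<exists>t. eval L A [enc x] (L ! Suc k) = return_spmf (enc (f x), t, 0) \<and> t \<le> poly p (esize x)"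
proof -
  obtain t q where tq: "evals P A [enc x] (P ! k) (enc (f x)) t q" "t \<le> poly p (esize x)"
    using P unfolding implements_def by blast
  have k: "k < length P" using P by (simp add: implements_def)
  have "q = 0" using evals_deterministic[OF tq(1) P(2)] P(2) k by (simp add: list_all_length)
  have "L ! Suc k = shift_calls 1 (P ! k)" using k by (simp add: L nth_append)
  then have "evals L A [enc x] (L ! Suc k) (enc (f x)) t q"
    using evals_relocate[OF tq(1), of "[e]" "map (shift_calls 1) P'' @ P'"] by (simp add: L)
  then show ?thesis using tq(2) eval_evals \<open>q = 0\<close> by blast
qed

definition main_body :: "nat \<Rightarrow> nat \<Rightarrow> expr" where
  "main_body l kp = Call l (Call kp (Var 0))"

lemma learner_program:
  "\<exists>L l p0 pT pQ :: nat poly. (\<forall>z. \<exists>t0. t0 \<le> poly p0 (esize z) \<and>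
     run L solvable (enc z) = map_spmf (\<lambda>(v, t, q). (v, t0 + t, q)) (eval L solvable [enc (initial_state z)] l)) \<and>
     (\<forall>s. \<exists>t tb qc. eval L solvable [enc s] l = bind_spmf (spmf_of_set (bit_lists (random_bits c (fst s)))) (\<lambda>u.
        if learn c solvable (fst s) u \<noteq> []
        then return_spmf (enc (output_circuit (s, learn c solvable (fst s) u)), t u + tb u, qc u)
        else bind_spmf (eval L solvable [enc (next_state s)] l) (\<lambda>(v, t2, q2). return_spmf (v, t u + t2, qc u + q2))) \<and>
       (\<forall>u. length u = random_bits c (fst s) \<longrightarrow> t u + tb u \<le> poly pT (esize s) \<and> qc u \<le> poly pQ (esize (fst s))))"
proof -
  have init: "ptime True solvable initial_state" and nxt: "ptime True solvable next_state"
    and outp: "ptime True solvable output_circuit"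
    and nb: "ptime True solvable (\<lambda>s :: config \<times> (nat \<times> nat) list. random_bits c (fst s))"
    by (rule ptime_learner)+
  have core: "ptime False solvable (\<lambda>z. learn c solvable (fst z) (snd z))"
    by (intro ptime_intros)
  obtain P1 k1 p1 where 1: "list_all deterministic P1" "implements P1 solvable k1 p1 initial_state"
    using init unfolding ptime_def by auto
  obtain P2 k2 p2 where 2: "list_all deterministic (P1 @ P2)" "implements (P1 @ P2) solvable k2 p2 next_state"
    using ptime_link[OF nxt, of P1] 1 by blast
  obtain P3 k3 p3 where 3: "list_all deterministic ((P1 @ P2) @ P3)" "implements ((P1 @ P2) @ P3) solvable k3 p3 output_circuit"
    using ptime_link[OF outp, of "P1 @ P2"] 2 by blast
  obtain P4 k4 p4 where 4: "list_all deterministic (((P1 @ P2) @ P3) @ P4)"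
    "implements (((P1 @ P2) @ P3) @ P4) solvable k4 p4 (\<lambda>s :: config \<times> (nat \<times> nat) list. random_bits c (fst s))"
    using ptime_link[OF nb, of "(P1 @ P2) @ P3"] 3 by blast
  define D where "D = P1 @ P2 @ P3 @ P4"
  have D: "list_all deterministic D" "implements D solvable k1 p1 initial_state" "implements D solvable k2 p2 next_state"
    "implements D solvable k3 p3 output_circuit"
    "implements D solvable k4 p4 (\<lambda>s :: config \<times> (nat \<times> nat) list. random_bits c (fst s))"
    using 4 implements_append[OF 1(2), of "P2 @ P3 @ P4"] implements_append[OF 2(2), of "P3 @ P4"]
      implements_append[OF 3(2), of P4] by (simp_all add: D_def)
  obtain P5 k5 p5 where 5: "implements (D @ P5) solvable k5 p5 (\<lambda>z. learn c solvable (fst z) (snd z))"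
    using ptime_link[OF core, of D] by blast
  define r where "r = Suc (length (D @ P5))"
  define l where "l = Suc r"
  define L where "L = [main_body l (Suc k1)] @ map (shift_calls 1) (D @ P5) @
    [coins_body r, loop_body r (Suc k4) (Suc k5) (Suc k3) (Suc k2) l]"
  have rl: "r < length L" "L ! r = coins_body r" "l < length L"
    "L ! l = loop_body r (Suc k4) (Suc k5) (Suc k3) (Suc k2) l" "0 < length L" "L ! 0 = main_body l (Suc k1)"
    by (simp_all add: L_def r_def l_def nth_append)
  note det = linked_eval_det[OF _ D(1) L_def]
  have len: "Suc k1 < length L" "Suc k2 < length L" "Suc k3 < length L" "Suc k4 < length L" "Suc k5 < length L"
    using D(2-5) 5 unfolding implements_def L_def by auto
  have "\<forall>x. \<exists>t. eval L solvable [enc x] (L ! Suc k1) = return_spmf (enc (initial_state x), t, 0) \<and> t \<le> poly p1 (esize x)"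
    using det[OF D(2)] by blast
  then obtain t1 where t1: "\<And>x. eval L solvable [enc x] (L ! Suc k1) = return_spmf (enc (initial_state x), t1 x, 0)"
    "\<And>x. t1 x \<le> poly p1 (esize x)" by metis
  have "\<forall>x. \<exists>t. eval L solvable [enc x] (L ! Suc k2) = return_spmf (enc (next_state x), t, 0) \<and> t \<le> poly p2 (esize x)"
    using det[OF D(3)] by blast
  then obtain t2 where t2: "\<And>x. eval L solvable [enc x] (L ! Suc k2) = return_spmf (enc (next_state x), t2 x, 0)"
    "\<And>x. t2 x \<le> poly p2 (esize x)" by metis
  have "\<forall>x. \<exists>t. eval L solvable [enc x] (L ! Suc k3) = return_spmf (enc (output_circuit x), t, 0) \<and> t \<le> poly p3 (esize x)"
    using det[OF D(4)] by blast
  then obtain t3 where t3: "\<And>x. eval L solvable [enc x] (L ! Suc k3) = return_spmf (enc (output_circuit x), t3 x, 0)"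
    "\<And>x. t3 x \<le> poly p3 (esize x)" by metis
  have "\<forall>x :: config \<times> (nat \<times> nat) list. \<exists>t. eval L solvable [enc x] (L ! Suc k4) = return_spmf (enc (random_bits c (fst x)), t, 0) \<and> t \<le> poly p4 (esize x)"
    using det[OF D(5)] by blast
  then obtain t4 where t4: "\<And>x :: config \<times> (nat \<times> nat) list. eval L solvable [enc x] (L ! Suc k4) = return_spmf (enc (random_bits c (fst x)), t4 x, 0)"
    "\<And>x. t4 x \<le> poly p4 (esize x)" by metis
  have "\<forall>x. \<exists>t q. eval L solvable [enc x] (L ! Suc k5) = return_spmf (enc (learn c solvable (fst x) (snd x)), t, q) \<and> t \<le> poly p5 (esize x) \<and> q \<le> t"
    using linked_eval(2)[OF 5 L_def] by blast
  then obtain t5 q5 where t5: "\<And>x. eval L solvable [enc x] (L ! Suc k5) = return_spmf (enc (learn c solvable (fst x) (snd x)), t5 x, q5 x)"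
    "\<And>x. t5 x \<le> poly p5 (esize x)" "\<And>x. q5 x \<le> t5 x" by metis
  obtain pr where pr: "\<And>cfg. random_bits c cfg \<le> poly pr (esize cfg)"
    using pbounded_nat[OF ptime_params(5)[OF ptime_id]] unfolding pbounded_def by blast
  obtain po where po: "\<And>z. esize (learn c solvable (fst z) (snd z)) \<le> poly po (esize z)"
    using ptime_esize[OF core] unfolding pbounded_def by blast
  \<comment> \<open>With \<open>e\<close> the size of the state: \<open>?M\<close> bounds the number
    of random bits, \<open>?C\<close> the input of \<open>learn\<close>, \<open>?O\<close> its
    output, and \<open>?T\<close> the time of a stage.\<close>
  let ?M = "\<lambda>e. poly pr e"
  let ?C = "\<lambda>e. e + 2 * ?M e + 1"
  let ?O = "\<lambda>e. poly po (?C e)"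
  let ?T = "\<lambda>e. poly p4 e + (3 + ?M e * (6 + 2 * ?M e)) + poly p5 (?C e) + poly p2 e + 20 +
    2 * (e + 2 * ?M e + ?O e) + poly p3 (e + ?O e + 1)"
  \<comment> \<open>On numbers \<open>esize\<close> is the identity, so \<open>pbounded\<close>
    delivers single polynomials above \<open>?T\<close> and the query bound.\<close>
  have "pbounded (\<lambda>e::nat. ?T (esize e))" "pbounded (\<lambda>e::nat. poly p5 (?C (esize e)))"
    by (intro pbounded_intros)+
  then obtain pT pQ where pT: "\<And>e. ?T e \<le> poly pT e" and pQ: "\<And>e. poly p5 (?C e) \<le> poly pQ e"
    unfolding pbounded_def by auto
  have round: "\<exists>t tb qc. eval L solvable [enc s] (L ! l) = bind_spmf (spmf_of_set (bit_lists (random_bits c (fst s)))) (\<lambda>u.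
        if learn c solvable (fst s) u \<noteq> []
        then return_spmf (enc (output_circuit (s, learn c solvable (fst s) u)), t u + tb u, qc u)
        else bind_spmf (eval L solvable [enc (next_state s)] (L ! l)) (\<lambda>(v, t2, q2). return_spmf (v, t u + t2, qc u + q2))) \<and>
       (\<forall>u. length u = random_bits c (fst s) \<longrightarrow> t u + tb u \<le> poly pT (esize s) \<and> qc u \<le> poly pQ (esize (fst s)))" for s
  proof -
    let ?out = "\<lambda>u. learn c solvable (fst s) u"
    have c5: "eval L solvable [enc (fst s, u)] (L ! Suc k5) = return_spmf (enc (?out u), t5 (fst s, u), q5 (fst s, u))" for u
      using t5(1)[of "(fst s, u)"] by simp
    from eval_loop[OF rl(1-4) len(4,5,3,2) t4(1) c5 t3(1) t2(1)]
    obtain t where t: "eval L solvable [enc s] (L ! l) = bind_spmf (spmf_of_set (bit_lists (random_bits c (fst s)))) (\<lambda>u.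
        if ?out u \<noteq> [] then return_spmf (enc (output_circuit (s, ?out u)), t u + t3 (s, ?out u), q5 (fst s, u))
        else bind_spmf (eval L solvable [enc (next_state s)] (L ! l)) (\<lambda>(v, t2, q2). return_spmf (v, t u + t2, q5 (fst s, u) + q2)))"
      "\<forall>u. t u \<le> t4 s + coin_time u + t5 (fst s, u) + t2 s + 20 + 2 * (esize s + esize u + esize (?out u))"
      by blast
    have "t u + t3 (s, ?out u) \<le> poly pT (esize s) \<and> q5 (fst s, u) \<le> poly pQ (esize (fst s))"
      if u: "length u = random_bits c (fst s)" for u
    proof -
      define e where "e = esize s"
      have cfg: "esize (fst s) \<le> e" by (simp add: e_def esize_prod)
      have M0: "length u \<le> ?M (esize (fst s))" using pr u by simp
      also have "\<dots> \<le> ?M e" using cfg by (rule poly_mono_nat)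
      finally have M: "length u \<le> ?M e" .
      have eu: "esize u \<le> 2 * ?M e" "esize u \<le> 2 * ?M (esize (fst s))" using esize_bits[of u] M M0 by auto
      have C: "esize (fst s, u) \<le> ?C e" "esize (fst s, u) \<le> ?C (esize (fst s))" using cfg eu by auto
      have "esize (?out u) \<le> poly po (esize (fst s, u))" using po[of "(fst s, u)"] by simp
      also have "\<dots> \<le> ?O e" using C(1) by (rule poly_mono_nat)
      finally have O: "esize (?out u) \<le> ?O e" .
      have 4: "t4 s \<le> poly p4 e" "t2 s \<le> poly p2 e" using t4(2) t2(2) by (simp_all add: e_def)
      have 5: "t5 (fst s, u) \<le> poly p5 (?C e)" "t5 (fst s, u) \<le> poly p5 (?C (esize (fst s)))"
        using t5(2) poly_mono_nat[OF C(1)] poly_mono_nat[OF C(2)] order_trans by blast+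
      have 3: "t3 (s, ?out u) \<le> poly p3 (e + ?O e + 1)"
        by (rule order_trans[OF t3(2) poly_mono_nat]) (use O in \<open>simp add: e_def\<close>)
      have "coin_time u \<le> 3 + length u * (6 + 2 * length u)" by (rule coin_time_le)
      also have "\<dots> \<le> 3 + ?M e * (6 + 2 * ?M e)" using M by (intro add_left_mono mult_mono) auto
      finally have ct: "coin_time u \<le> 3 + ?M e * (6 + 2 * ?M e)" .
      have arith: "t \<le> a + k + b + d + 20 + 2 * (e + x + y) \<Longrightarrow> a \<le> a' \<Longrightarrow> k \<le> k' \<Longrightarrow> b \<le> b' \<Longrightarrow> d \<le> d' \<Longrightarrow>
        x \<le> x' \<Longrightarrow> y \<le> y' \<Longrightarrow> v \<le> v' \<Longrightarrow> t + v \<le> a' + k' + b' + d' + 20 + 2 * (e + x' + y') + v'"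
        for t a k b d e x y v a' k' b' d' x' y' v' :: nat by simp
      have "t u + t3 (s, ?out u) \<le> ?T e"
        using t(2)[rule_format, of u] unfolding e_def[symmetric]
        by (rule arith[OF _ 4(1) ct 5(1) 4(2) eu(1) O 3])
      then have "t u + t3 (s, ?out u) \<le> poly pT e" by (rule order_trans[OF _ pT])
      moreover have "q5 (fst s, u) \<le> poly pQ (esize (fst s))"
        by (rule order_trans[OF t5(3) order_trans[OF 5(2) pQ]])
      ultimately show ?thesis by (simp only: e_def)
    qed
    then have "\<forall>u. length u = random_bits c (fst s) \<longrightarrow>
      t u + t3 (s, ?out u) \<le> poly pT (esize s) \<and> q5 (fst s, u) \<le> poly pQ (esize (fst s))" by blast
    with t(1) show ?thesis
      by (rule exI[of _ t, OF exI[of _ "\<lambda>u. t3 (s, ?out u)", OF exI[of _ "\<lambda>u. q5 (fst s, u)", OF conjI]]])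
  qed
  have main: "run L solvable (enc z) =
      map_spmf (\<lambda>(v, t, q). (v, (t1 z + 5) + t, q)) (eval L solvable [enc (initial_state z)] (L ! l))" for z
  proof -
    have "eval L solvable [enc z] (main_body l (Suc k1)) = bind_spmf (eval L solvable [enc (initial_state z)] (L ! l))
        (\<lambda>(v, t, q). return_spmf (v, (1 + t1 z + 1) + t + 1, q))"
      unfolding main_body_def eval_simps(8)[of L solvable _ l] eval_Call_det[OF eval_Var0 len(1) t1(1)]
      using rl(3) by simp
    then have "run L solvable (enc z) = bind_spmf (eval L solvable [enc (initial_state z)] (L ! l))
        (\<lambda>(v, t, q). return_spmf (v, Suc (Suc (Suc (Suc (Suc (t1 z + t))))), q))"
      unfolding run_def eval_simps(8)[of L solvable _ 0] eval_Var0 rl(6) using rl(5)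
      by (simp add: case_prod_unfold)
    then show ?thesis by (simp add: map_spmf_conv_bind_spmf case_prod_unfold eval_nat_numeral)
  qed
  have "t1 z + 5 \<le> poly (p1 + [:5:]) (esize z)" for z using t1(2)[of z] by simp
  then have start: "\<exists>t0. t0 \<le> poly (p1 + [:5:]) (esize z) \<and> run L solvable (enc z) =
      map_spmf (\<lambda>(v, t, q). (v, t0 + t, q)) (eval L solvable [enc (initial_state z)] (L ! l))" for z
    using main by blast
  show ?thesis
    by (rule exI[of _ L], rule exI[of _ "L ! l"], rule exI[of _ "p1 + [:5:]"], rule exI[of _ pT], rule exI[of _ pQ],
      rule conjI, rule allI, rule start, rule allI, rule round)
qed

section \<open>Success probability and resource bounds\<close>

lemma measure_map_spmf_mono:
  assumes "S \<subseteq> h -` S'"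
  shows "measure (measure_spmf p) S \<le> measure (measure_spmf (map_spmf h p)) S'"
  unfolding measure_map_spmf by (rule measure_spmf.finite_measure_mono[OF assms]) simp

lemma measure_return_spmf_mem: "x \<in> S \<Longrightarrow> measure (measure_spmf (return_spmf x)) S = 1"
  by (simp add: measure_spmf_return_spmf measure_return)

lemma esize_formula:
  "relational_spec n m F \<Longrightarrow> esize F \<le> formula_size F * (n + m + 8)"
  unfolding relational_spec_def
proof (induction F)
  case (Const b)
  then show ?case using esize_bool[of b] by (simp add: enc_formula)
next
  case (Atom v)
  then show ?case by (auto simp: enc_formula enc_var enc_numerals)
qed (auto simp: enc_formula enc_numerals algebra_simps)

text \<open>After renaming, an index is at most the number of occurrences, so \<open>n\<close> and
  \<open>m\<close> do not enter; contrast \<open>esize_formula\<close>.\<close>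

lemma esize_compress: "esize (compress F i g) \<le> formula_size F * (formula_size F + 10) + 3 * formula_size F + g + 10"
proof -
  let ?vs = "token_vars (tokens F)" and ?n = "formula_size F"
  have vs: "length ?vs \<le> ?n" using length_token_vars[of "tokens F"] by (simp add: length_tokens)
  have tok: "fst t \<le> 4 \<and> (fst t = 1 \<or> fst (snd t) \<le> 1)" if "t \<in> set (tokens F)" for t
    using that by (induction F) (auto split: var.splits)
  have "esize (rename ?vs t) \<le> ?n + 6" if "t \<in> set (tokens F)" for t
    using tok[OF that] index_le[of ?vs "snd t"] vs by (auto simp: rename_def)
  then have "esize (map (rename ?vs) (tokens F)) \<le> length (map (rename ?vs) (tokens F)) * (?n + 6 + 1)"
    by (intro esize_list_le) auto
  moreover have "index ?vs (1, i) \<le> ?n" using index_le[of ?vs "(1, i)"] vs by simp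
  moreover have "esize (map (\<lambda>v. fst v = 0 \<or> snd v < i) ?vs) \<le> 2 * ?n"
    using esize_bits[of "map (\<lambda>v. fst v = 0 \<or> snd v < i) ?vs"] vs by simp
  ultimately show ?thesis by (simp add: compress_def Let_def length_tokens algebra_simps)
qed

lemma compress_mono: "g \<le> g' \<Longrightarrow> esize (compress F i g) \<le> esize (compress F i g')"
  by (simp add: compress_def Let_def)

theorem theorem7:
  fixes c :: nat
  shows "\<exists>A \<in> NP. \<exists>(L :: program) (p :: nat poly) (q :: nat poly).
    \<forall>n m F i s.
      relational_spec n m F \<longrightarrow> i \<in> {1..m} \<longrightarrow>
      uniquely_defined_by_circuit F (preceding_vars n i) (Y i) s \<longrightarrow>
      measure (measure_spmf (run L A (learner_input n m F i)))
        {(out, time, calls).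
           (\<exists>h. out = tree_of_circuit h \<and> skolem_function n F i h) \<and>
           calls \<le> poly p (formula_size F + s) \<and>
           time \<le> poly q (formula_size F + n + m + s)}
      \<ge> 1 - 1 / 2 ^ (c * formula_size F)"
proof -
  obtain L l p0 pT pQ where run: "\<And>z :: nat \<times> nat \<times> formula \<times> nat \<times> unit. \<exists>t0. t0 \<le> poly p0 (esize z) \<and>
      run L solvable (enc z) = map_spmf (\<lambda>(v, t, q). (v, t0 + t, q)) (eval L solvable [enc (initial_state z)] l)"
    and round: "\<And>s. \<exists>t tb qc. eval L solvable [enc s] l = bind_spmf (spmf_of_set (bit_lists (random_bits c (fst s)))) (\<lambda>u.
        if learn c solvable (fst s) u \<noteq> []
        then return_spmf (enc (output_circuit (s, learn c solvable (fst s) u)), t u + tb u, qc u)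
        else bind_spmf (eval L solvable [enc (next_state s)] l) (\<lambda>(v, t2, q2). return_spmf (v, t u + t2, qc u + q2))) \<and>
       (\<forall>u. length u = random_bits c (fst s) \<longrightarrow> t u + tb u \<le> poly pT (esize s) \<and> qc u \<le> poly pQ (esize (fst s)))"
    using learner_program[of c] by (elim exE conjE) (rule that, blast+)
  obtain pz where pz: "\<And>z. esize (initial_state z) \<le> poly pz (esize z)"
    using ptime_esize[OF ptime_learner(1)] unfolding pbounded_def by blast
  \<comment> \<open>\<open>?R\<close> dominates the size of the compressed configuration with
    \<open>s + 1\<close> masks, \<open>?Z\<close> that of the learner's input.\<close>
  let ?R = "\<lambda>N. N * (N + 10) + 3 * N + (N + 1) + 10"
  let ?Z = "\<lambda>N. 3 * N + N * (N + 8) + 5"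
  have "pbounded (\<lambda>N::nat. (esize N + 1) * poly pQ (?R (esize N)))"
    "pbounded (\<lambda>N::nat. poly p0 (?Z (esize N)) + (esize N + 1) * poly pT (poly pz (?Z (esize N)) + esize N))"
    by (intro pbounded_intros)+
  then obtain p q where p: "\<And>N. (N + 1) * poly pQ (?R N) \<le> poly p N"
    and q: "\<And>N. poly p0 (?Z N) + (N + 1) * poly pT (poly pz (?Z N) + N) \<le> poly q N"
    unfolding pbounded_def by auto
  have "measure (measure_spmf (run L solvable (learner_input n m F i)))
        {(out, time, calls).
           (\<exists>h. out = tree_of_circuit h \<and> skolem_function n F i h) \<and>
           calls \<le> poly p (formula_size F + s) \<and>
           time \<le> poly q (formula_size F + n + m + s)}
      \<ge> 1 - 1 / 2 ^ (c * formula_size F)"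
    if spec: "relational_spec n m F" and i: "i \<in> {1..m}"
      and ud: "uniquely_defined_by_circuit F (preceding_vars n i) (Y i) s" for n m F i s
  proof -
    let ?eps = "1 / 2 ^ (c * formula_size F) :: real"
    let ?z = "(n, m, F, i, ())"
    define right where "right = {v. \<exists>h. v = tree_of_circuit h \<and> skolem_function n F i h}"
    define BT where "BT = poly pT (esize (learner_state F i (Suc s)))"
    define BQ where "BQ = poly pQ (esize (compress F i (Suc s)))"
    \<comment> \<open>Success within \<open>d + 1\<close> stages. \<open>BT\<close> and
      \<open>BQ\<close> are the bounds of the stage with \<open>Suc s\<close> masks; they dominate
      those of all smaller stages.\<close>
    define S where "S d = {(v, t, q). v \<in> right \<and> t \<le> (d + 1) * BT \<and> q \<le> (d + 1) * BQ}" for d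
    have u: "uniquely_defined F (preceding_vars n i) (Y i)" using ud by (simp add: uniquely_defined_by_circuit_def)
    obtain C where C: "circuit_size C = s" "computes_on_models F (preceding_vars n i) (Y i) C"
      using ud by (auto simp: uniquely_defined_by_circuit_def)
    have fst_state: "fst (learner_state F i g) = compress F i g" for g by (simp add: learner_state_def)
    have correct: "enc (output_circuit (learner_state F i g, ws)) \<in> right"
      if "ws = learn c solvable (compress F i g) r" "ws \<noteq> []" for g r ws
    proof (cases ws)
      case (Cons w ws')
      then have "w \<in> set (learn c solvable (compress F i g) r)" using that(1) by (metis list.set_intros(1))
      from output_circuit_correct[OF spec u this] show ?thesis
        unfolding Cons right_def enc_circuit_def by blast
    qed (use that(2) in simp)
    \<comment> \<open>Backward induction: \<open>d\<close> stages remain before the hypothesis class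
      contains the target. Only the last of these stages is charged with failure, so the error does
      not add up over the stages.\<close>
    have loop: "1 - ?eps \<le> measure (measure_spmf (eval L solvable [enc (learner_state F i (Suc s - d))] l)) (S d)"
      if "d \<le> s" for d
      using that
    proof (induction d)
      case 0
      let ?cfg = "compress F i (Suc s)"
      let ?k = "random_bits c ?cfg"
      obtain t tb qc where e: "eval L solvable [enc (learner_state F i (Suc s))] l = bind_spmf (spmf_of_set (bit_lists ?k)) (\<lambda>u.
        if learn c solvable ?cfg u \<noteq> []
        then return_spmf (enc (output_circuit (learner_state F i (Suc s), learn c solvable ?cfg u)), t u + tb u, qc u)
        else bind_spmf (eval L solvable [enc (next_state (learner_state F i (Suc s)))] l) (\<lambda>(v, t2, q2). return_spmf (v, t u + t2, qc u + q2)))"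
        and b0: "\<forall>u. length u = ?k \<longrightarrow> t u + tb u \<le> BT \<and> qc u \<le> BQ"
        using round[of "learner_state F i (Suc s)"] unfolding BT_def BQ_def fst_state by blast
      have b: "t u + tb u \<le> BT \<and> qc u \<le> BQ" if "length u = ?k" for u using b0 that by blast
      obtain w where w: "w \<in> bit_lists (hyp_bits ?cfg)" "\<And>a. length a = length (input_flags ?cfg) \<Longrightarrow>
          eval_tokens (fst ?cfg) a \<Longrightarrow> consistent ?cfg w a"
        using compress_target[OF C(2), of "Suc s"] C(1) by blast
      have pos: "0 < hyp_bits ?cfg" by (simp add: hyp_bits_def compress_def Let_def)
      have len: "length (fst ?cfg) = formula_size F" "length (input_flags ?cfg) \<le> length (fst ?cfg)"
        using length_token_vars[of "tokens F"] by (simp_all add: compress_def Let_def length_tokens)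
      have "1 - ?eps \<le> 1 - avg ?k (\<lambda>u. of_bool (bad_bits c ?cfg u))"
        using avg_bad_bits[OF len(2), of c] len(1) by simp
      also have "\<dots> = avg ?k (\<lambda>u. 1 - of_bool (bad_bits c ?cfg u))" by (simp add: avg_diff)
      \<comment> \<open>If the bits are bad, the loop may still succeed in a later stage; this
        chance is estimated by 0.\<close>
      also have "\<dots> \<le> measure (measure_spmf (eval L solvable [enc (learner_state F i (Suc s))] l)) (S 0)"
        unfolding e measure_bind_spmf_of_set
      proof (rule avg_mono)
        fix u :: "bool list" assume ul: "length u = ?k"
        show "1 - of_bool (bad_bits c ?cfg u) \<le> measure (measure_spmf (if learn c solvable ?cfg u \<noteq> []
          then return_spmf (enc (output_circuit (learner_state F i (Suc s), learn c solvable ?cfg u)), t u + tb u, qc u)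
          else bind_spmf (eval L solvable [enc (next_state (learner_state F i (Suc s)))] l) (\<lambda>(v, t2, q2). return_spmf (v, t u + t2, qc u + q2)))) (S 0)"
        proof (cases "bad_bits c ?cfg u")
          case False
          then have ne: "learn c solvable ?cfg u \<noteq> []" using learn_complete[OF w pos] by blast
          have "(enc (output_circuit (learner_state F i (Suc s), learn c solvable ?cfg u)), t u + tb u, qc u) \<in> S 0"
            using correct[OF refl ne] b[OF ul] by (simp add: S_def)
          from measure_return_spmf_mem[OF this] show ?thesis using ne by simp
        qed simp
      qed
      finally show ?case by simp
    next
      case (Suc d)
      let ?g = "Suc s - Suc d"
      have g: "Suc ?g = Suc s - d" "?g \<le> Suc s" using Suc.prems by auto
      let ?cfg = "compress F i ?g"
      let ?k = "random_bits c ?cfg"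
      have "esize (learner_state F i ?g) \<le> esize (learner_state F i (Suc s))"
        using compress_mono[OF g(2), of F i] by (simp add: learner_state_def)
      then have mono: "poly pT (esize (learner_state F i ?g)) \<le> BT" "poly pQ (esize ?cfg) \<le> BQ"
        unfolding BT_def BQ_def using compress_mono[OF g(2), of F i] by (auto intro: poly_mono_nat)
      obtain t tb qc where e: "eval L solvable [enc (learner_state F i ?g)] l = bind_spmf (spmf_of_set (bit_lists ?k)) (\<lambda>u.
        if learn c solvable ?cfg u \<noteq> []
        then return_spmf (enc (output_circuit (learner_state F i ?g, learn c solvable ?cfg u)), t u + tb u, qc u)
        else bind_spmf (eval L solvable [enc (next_state (learner_state F i ?g))] l) (\<lambda>(v, t2, q2). return_spmf (v, t u + t2, qc u + q2)))"
        and b0: "\<forall>u. length u = ?k \<longrightarrow> t u + tb u \<le> poly pT (esize (learner_state F i ?g)) \<and> qc u \<le> poly pQ (esize ?cfg)"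
        using round[of "learner_state F i ?g"] unfolding fst_state by blast
      have b: "t u + tb u \<le> BT" "qc u \<le> BQ" if "length u = ?k" for u
        using b0 that mono order_trans by blast+
      have nxt: "next_state (learner_state F i ?g) = learner_state F i (Suc s - d)"
        unfolding next_learner_state g(1) ..
      have IH: "1 - ?eps \<le> measure (measure_spmf (eval L solvable [enc (learner_state F i (Suc s - d))] l)) (S d)"
        using Suc by simp
      have "1 - ?eps = avg ?k (\<lambda>_. 1 - ?eps)" by simp
      also have "\<dots> \<le> measure (measure_spmf (eval L solvable [enc (learner_state F i ?g)] l)) (S (Suc d))"
        unfolding e measure_bind_spmf_of_set
      proof (rule avg_mono)
        fix u :: "bool list" assume ul: "length u = ?k"
        show "1 - ?eps \<le> measure (measure_spmf (if learn c solvable ?cfg u \<noteq> []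
          then return_spmf (enc (output_circuit (learner_state F i ?g, learn c solvable ?cfg u)), t u + tb u, qc u)
          else bind_spmf (eval L solvable [enc (next_state (learner_state F i ?g))] l) (\<lambda>(v, t2, q2). return_spmf (v, t u + t2, qc u + q2)))) (S (Suc d))"
        proof (cases "learn c solvable ?cfg u = []")
          case False
          have "t u + tb u \<le> (Suc d + 1) * BT" "qc u \<le> (Suc d + 1) * BQ" using b[OF ul] by simp_all
          then have "(enc (output_circuit (learner_state F i ?g, learn c solvable ?cfg u)), t u + tb u, qc u) \<in> S (Suc d)"
            using correct[OF refl False] by (simp add: S_def)
          from measure_return_spmf_mem[OF this] show ?thesis using False by simp
        next
          case True
          let ?h = "\<lambda>(v, t2, q2). (v, t u + t2, qc u + q2)"
          \<comment> \<open>An unsuccessful stage uses up one unit of the budget and leaves the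
            success probability of the rest unchanged.\<close>
          have "S d \<subseteq> ?h -` S (Suc d)" using b[OF ul] by (auto simp: S_def)
          from order_trans[OF IH measure_map_spmf_mono[OF this]] show ?thesis
            using True unfolding nxt by (simp add: map_spmf_conv_bind_spmf case_prod_unfold)
        qed
      qed
      finally show ?case .
    qed
    obtain t0 where t0: "t0 \<le> poly p0 (esize ?z)"
      "run L solvable (enc ?z) = map_spmf (\<lambda>(v, t, q). (v, t0 + t, q)) (eval L solvable [enc (initial_state ?z)] l)"
      using run by blast
    let ?N = "formula_size F + s" and ?N' = "formula_size F + n + m + s"
    have z: "learner_input n m F i = enc ?z"
      by (simp add: learner_input_def enc_nat_def enc_formula_def)
    have zN: "esize ?z \<le> ?Z ?N'"
    proof -
      have "esize F \<le> formula_size F * (n + m + 8)" using esize_formula[OF spec] .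
      also have "\<dots> \<le> ?N' * (?N' + 8)" by (intro mult_mono) auto
      finally show ?thesis using i by simp
    qed
    have "esize (compress F i (Suc s)) \<le> ?R ?N"
    proof -
      have "formula_size F * (formula_size F + 10) \<le> ?N * (?N + 10)" by (intro mult_mono) auto
      then show ?thesis using esize_compress[of F i "Suc s"] by simp
    qed
    then have "BQ \<le> poly pQ (?R ?N)" unfolding BQ_def by (rule poly_mono_nat)
    then have "(s + 1) * BQ \<le> (?N + 1) * poly pQ (?R ?N)" by (intro mult_mono) auto
    then have Q: "(s + 1) * BQ \<le> poly p ?N" using p[of ?N] by linarith
    \<comment> \<open>The two states differ only in the unary number of masks, \<open>Suc s\<close>
      against 1.\<close>
    have "esize (learner_state F i (Suc s)) = esize (initial_state ?z) + s"
      by (simp add: initial_state_def learner_state_def compress_def Let_def)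
    also have "\<dots> \<le> poly pz (?Z ?N') + ?N'"
      using pz[of ?z] poly_mono_nat[OF zN, of pz] by simp
    finally have "BT \<le> poly pT (poly pz (?Z ?N') + ?N')" unfolding BT_def by (rule poly_mono_nat)
    then have "(s + 1) * BT \<le> (?N' + 1) * poly pT (poly pz (?Z ?N') + ?N')" by (intro mult_mono) auto
    moreover have "t0 \<le> poly p0 (?Z ?N')" using t0(1) poly_mono_nat[OF zN] order_trans by blast
    ultimately have T: "t0 + (s + 1) * BT \<le> poly q ?N'" using q[of ?N'] by linarith
    have "1 - ?eps \<le> measure (measure_spmf (eval L solvable [enc (initial_state ?z)] l)) (S s)"
      using loop[of s] by (simp add: initial_state_def)
    also have "\<dots> \<le> measure (measure_spmf (run L solvable (learner_input n m F i)))
        {(out, time, calls).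
           (\<exists>h. out = tree_of_circuit h \<and> skolem_function n F i h) \<and>
           calls \<le> poly p ?N \<and> time \<le> poly q ?N'}"
      unfolding z t0(2)
    proof (rule measure_map_spmf_mono, rule subsetI)
      fix x assume "x \<in> S s"
      then obtain v t k where x: "x = (v, t, k)" "v \<in> right" "t \<le> (s + 1) * BT" "k \<le> (s + 1) * BQ"
        unfolding S_def by blast
      have "k \<le> poly p ?N" "t0 + t \<le> poly q ?N'" using x(3,4) Q T by linarith+
      then show "x \<in> (\<lambda>(v, t, q). (v, t0 + t, q)) -` {(out, time, calls).
           (\<exists>h. out = tree_of_circuit h \<and> skolem_function n F i h) \<and>
           calls \<le> poly p ?N \<and> time \<le> poly q ?N'}"
        using x(1,2) by (simp add: right_def)
    qed
    finally show ?thesis .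
  qed
  then show ?thesis using solvable_NP by blast
qed

end
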